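(* Let $\alpha>1$ and let $f\in\mathcal{A}$ with $|v|^\alpha\widehat f(v)\in L^2(\mathbb{R})\cap C_b(\mathbb{R})$. For $t_0>0$ let $\lambda$ be a non-negative, nonincreasing function on $[t_0,\infty)$. Then the following statements are equivalent: (i) $\mathrm{dist}_\infty(D_{\rm s}^{\{\alpha\}}f,B_\sigma^1)=\mathcal{O}(\lambda(\sigma))$ as $\sigma\to\infty$; (ii) $R_\sigma(f(\tau+\cdot))=\mathcal{O}(\sigma^{-\alpha}\lambda(\sigma))$ as $\sigma\to\infty$, uniformly for $-\frac{\pi}{\sigma}\le\tau\le\frac{\pi}{\sigma}$ (i.e. there are constants $c>0$ and $\sigma_0\ge t_0$ such that $|R_\sigma(f(\tau+\cdot))|\le c\,\sigma^{-\alpha}\lambda(\sigma)$ for all $\sigma\ge\sigma_0$ and all $\tau\in[-\pi/\sigma,\pi/\sigma]$).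
   Context: Fourier transform: $\widehat f(v)=\frac{1}{\sqrt{2\pi}}\int_{\mathbb{R}} f(u)e^{-iuv}\,du$, defined as a Lebesgue integral for $f\in L^1(\mathbb{R})$ and by the usual limiting process for $f\in L^2(\mathbb{R})$. $C_b(\mathbb{R})$ is the class of continuous bounded functions $f:\mathbb{R}\to\mathbb{C}$. $\mathcal{A}=\{f\in L^1(\mathbb{R})\cap C_b(\mathbb{R}) : f\in \mathrm{BV}(\mathbb{R})\text{ or }\widehat f\in \mathrm{BV}(\mathbb{R})\}$, where $\mathrm{BV}(\mathbb{R})$ is the set of functions of bounded variation over $\mathbb{R}$. For $\sigma>0$ and $h=2\pi/\sigma$, $R_\sigma(f)$ denotes the remainder in the quadrature formula $\int_{-\infty}^\infty f(t)\,dt=h\sum_{k\in\mathbb{Z}}f(hk)+R_\sigma(f)$; by the Poisson summation formula, $R_\sigma(f)=-\sqrt{2\pi}\sum_{k\in\mathbb{Z}\setminus\{0\}}\widehat f(k\sigma)$ for $f\in\mathcal{A}$. The translate $f(\tau+\cdot)$ is the function $t\mapsto f(\tau+t)$, and $R_\sigma(f(\tau+\cdot))=-\sqrt{2\pi}\sum_{k\in\mathbb{Z}\setminus\{0\}}\widehat f(k\sigma)e^{i\tau k\sigma}$. Bernstein space: $B_\sigma^1$ is the set of all $f\in L^1(\mathbb{R})$ whose Fourier transform vanishes outside $(-\sigma,\sigma)$. For $f\in L^2(\mathbb{R})$ with $\widehat f\in C_b(\mathbb{R})$, $\mathrm{dist}_\infty(f,B_\sigma^1):=\inf_{g\in B_\sigma^1}\sup_{v\in\mathbb{R}}|\widehat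 f(v)-\widehat g(v)|$. Strong Riesz derivative: a function $f\in L^2(\mathbb{R})$ has a strong Riesz derivative of order $\alpha$, $0<\alpha<2j$, $j\in\mathbb{N}$, if there is $g\in L^2(\mathbb{R})$ with $$\lim_{\varepsilon\to0+}\Big\|\frac{1}{C_{\alpha,2j}}\int_\varepsilon^\infty\frac{\overline\Delta_u^{2j}f(\cdot)}{u^{1+\alpha}}\,du-g(\cdot)\Big\|_{L^2(\mathbb{R})}=0,$$ where $\overline\Delta_u^{2j}f(x)=\sum_{k=0}^{2j}(-1)^k\binom{2j}{k}f(x+(j-k)u)$ and $C_{\alpha,2j}=(-1)^j2^{2j-\alpha}\int_0^\infty\frac{\sin^{2j}u}{u^{1+\alpha}}\,du$; then $D_{\rm s}^{\{\alpha\}}f:=g$ (independent of $j$). It is known that $f\in L^2(\mathbb{R})$ has a strong Riesz derivative of order $\alpha$ if and only if there is $g\in L^2(\mathbb{R})$ with $\widehat g(v)=|v|^\alpha\widehat f(v)$, and then $\widehat{D_{\rm s}^{\{\alpha\}}f}(v)=|v|^\alpha\widehat f(v)$. *)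

theory Defs
  imports "HOL-Analysis.Analysis" "HOL-Library.Landau_Symbols"
begin

text \<open>
  Elements of the Lebesgue spaces are represented by Borel functions (every class of Lebesgue
  measurable functions modulo null sets contains one); functions equal almost everywhere are not
  identified.  The space of bounded continuous functions is the library set \<^const>\<open>bcontfun\<close>.
\<close>

definition L1_space :: "(real \<Rightarrow> complex) set" where
  "L1_space = {f. integrable lborel f}"

definition L2_space :: "(real \<Rightarrow> complex) set" where
  "L2_space = {f. f \<in> borel_measurable lborel \<and> integrable lborel (\<lambda>x. (cmod (f x))\<^sup>2)}"

text \<open>
  Convergence in the quadratic norm.  The square of the norm is an extended nonnegative integral,
  so that a difference which is not square integrable has norm infinity (and not zero, as it would
  with the Bochner integral).
\<close>

definition L2_tendsto :: "('i \<Rightarrow> real \<Rightarrow> complex) \<Rightarrow> (real \<Rightarrow> complex) \<Rightarrow> 'i filter \<Rightarrow> bool" where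
  "L2_tendsto F g net \<longleftrightarrow>
     ((\<lambda>i. \<integral>\<^sup>+ x. ennreal ((cmod (F i x - g x))\<^sup>2) \<partial>lborel) \<longlongrightarrow> 0) net"

definition BV_space :: "(real \<Rightarrow> complex) set" where
  "BV_space = {f. \<exists>M. \<forall>(x :: nat \<Rightarrow> real) n. mono x \<longrightarrow> (\<Sum>i<n. cmod (f (x (Suc i)) - f (x i))) \<le> M}"

definition fourier :: "(real \<Rightarrow> complex) \<Rightarrow> real \<Rightarrow> complex" where
  "fourier f v =
     complex_of_real (1 / sqrt (2 * pi)) * (LINT u|lborel. f u * exp (- \<i> * complex_of_real (u * v)))"

text \<open>
  The transform on the space of square integrable functions is only determined almost everywhere,
  hence a relation: \<open>F\<close> is a representative of the transform of \<open>f\<close>.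
\<close>

definition is_L2_fourier :: "(real \<Rightarrow> complex) \<Rightarrow> (real \<Rightarrow> complex) \<Rightarrow> bool" where
  "is_L2_fourier f F \<longleftrightarrow> f \<in> L2_space \<and> F \<in> L2_space \<and>
     L2_tendsto (\<lambda>R v. complex_of_real (1 / sqrt (2 * pi)) *
       (LINT u:{-R..R}|lborel. f u * exp (- \<i> * complex_of_real (u * v)))) F at_top"

definition class_A :: "(real \<Rightarrow> complex) set" where
  "class_A = {f \<in> L1_space \<inter> bcontfun. f \<in> BV_space \<or> fourier f \<in> BV_space}"

text \<open>
  The bilateral series is the limit of its symmetric partial sums: if only the
  Fourier transform of \<open>f\<close> is of bounded variation, the samples need not be absolutely summable.
\<close>

definition quad_remainder :: "real \<Rightarrow> (real \<Rightarrow> complex) \<Rightarrow> complex" where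
  "quad_remainder \<sigma> f = (let h = 2 * pi / \<sigma> in
     (LINT t|lborel. f t) -
     complex_of_real h * lim (\<lambda>N. \<Sum>k\<in>{- int N..int N}. f (h * real_of_int k)))"

definition bernstein1 :: "real \<Rightarrow> (real \<Rightarrow> complex) set" where
  "bernstein1 \<sigma> = {f \<in> L1_space. \<forall>v. v \<notin> {-\<sigma><..<\<sigma>} \<longrightarrow> fourier f v = 0}"

text \<open>
  For square integrable \<open>f\<close> whose transform has a bounded continuous representative, that
  (unique) representative.
\<close>

definition fourier_Cb :: "(real \<Rightarrow> complex) \<Rightarrow> real \<Rightarrow> complex" where
  "fourier_Cb f = (THE F. is_L2_fourier f F \<and> F \<in> bcontfun)"

definition dist_inf :: "(real \<Rightarrow> complex) \<Rightarrow> real \<Rightarrow> real" where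
  "dist_inf f \<sigma> = (INF g\<in>bernstein1 \<sigma>. SUP v. cmod (fourier_Cb f v - fourier g v))"

definition central_diff :: "nat \<Rightarrow> real \<Rightarrow> (real \<Rightarrow> complex) \<Rightarrow> real \<Rightarrow> complex" where
  "central_diff j u f x =
     (\<Sum>k=0..2*j. (-1) ^ k * of_nat ((2 * j) choose k) * f (x + (real j - real k) * u))"

definition riesz_const :: "real \<Rightarrow> nat \<Rightarrow> real" where
  "riesz_const \<alpha> j = (-1) ^ j * 2 powr (2 * real j - \<alpha>) *
     (LINT u:{0<..}|lborel. sin u ^ (2 * j) / u powr (1 + \<alpha>))"

definition is_strong_riesz_deriv ::
  "real \<Rightarrow> nat \<Rightarrow> (real \<Rightarrow> complex) \<Rightarrow> (real \<Rightarrow> complex) \<Rightarrow> bool" where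
  "is_strong_riesz_deriv \<alpha> j f g \<longleftrightarrow>
     0 < \<alpha> \<and> \<alpha> < 2 * real j \<and> f \<in> L2_space \<and> g \<in> L2_space \<and>
     L2_tendsto (\<lambda>\<epsilon> x. complex_of_real (1 / riesz_const \<alpha> j) *
       (LINT u:{\<epsilon>..}|lborel. central_diff j u f x / complex_of_real (u powr (1 + \<alpha>)))) g (at_right 0)"

text \<open>
  The derivative does not depend on the admissible \<open>j\<close> and is unique almost everywhere, so the
  choice below only picks a representative.
\<close>

definition strong_riesz_deriv :: "real \<Rightarrow> (real \<Rightarrow> complex) \<Rightarrow> real \<Rightarrow> complex" where
  "strong_riesz_deriv \<alpha> f = (SOME g. \<exists>j. is_strong_riesz_deriv \<alpha> j f g)"

end

(* Put F(v) = |v|^alpha * fourier f v. The truncated Riesz integrals of f are convolutions, so their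
   transforms are multiples of fourier f and converge to F in the quadratic norm; by Bessel's
   inequality for the transform and for its inverse they converge to some g, and F is the transform
   of every such limit. The distance of g to the Bernstein space is the supremum of |F| over
   |v| >= sigma: transforms of the Bernstein space vanish there, and piecewise linear interpolation
   of F by hat functions attains this bound up to epsilon.

   Poisson summation writes the remainder as a trigonometric series in tau with coefficients
   -sqrt(2 pi) * fourier f (k sigma), k nonzero. Since |fourier f v| <= C |v|^(-alpha) with alpha > 1,
   Fejer's theorem gives it for Cesaro means of the samples of f without using bounded variation.
   Bounded variation is needed only to pass from Cesaro means to partial sums: if f is BV the samples
   are absolutely summable, and if fourier f is BV then f(t) = O(1/|t|), a Tauberian condition.

   From (i), summing |fourier f (k sigma)| <= |k sigma|^(-alpha) * dist over k gives (ii). From (ii), the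
   Fourier coefficients of the remainder at k = 1 and k = -1 bound |F(sigma)| and |F(-sigma)| by a
   multiple of lam(sigma), and monotonicity of lam gives the bound for all |v| >= sigma. *)

theory Submission
  imports Defs "HOL-Probability.Probability"
begin

section \<open>The Fourier transform of integrable functions\<close>

text \<open>Everything about the transform is drawn from Gaussian convergence factors: the
  multiplication formula turns them into normal averages of the function, which yields pointwise
  inversion and the two energy inequalities that take the place of Plancherel. The reverse
  inequality is available only for integrable bounded continuous functions with integrable
  transform, which is why the truncated Riesz integrals are shown to stay in that class.
  \<open>strong_riesz_deriv\<close> is a choice and \<open>fourier_Cb\<close> a definite
  description, so the distance has no usable value until a limit is shown to exist, every limit is
  shown to have transform F, and the continuous representative is shown to be unique. The condition
  \<alpha> > 1 acts twice: it makes \<open>fourier f\<close> integrable, so that inversion applies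
  to the samples, and it makes the series over the multiples of \<sigma> converge absolutely. The
  translates from -pi/\<sigma> to pi/\<sigma> cover one full period of the remainder in \<tau>,
  which is what recovers a single coefficient from a uniform bound.\<close>

lemma fourier_cis:
  "fourier f v = complex_of_real (1 / sqrt (2 * pi)) * (LINT u|lborel. f u * cis (- (u * v)))"
  unfolding fourier_def by (simp add: cis_conv_exp)

lemma borel_measurable_cis [measurable]: "cis \<in> borel_measurable borel"
  by (intro borel_measurable_continuous_onI continuous_intros)

lemma integrable_mult_bounded:
  fixes f g :: "'a \<Rightarrow> complex"
  assumes "integrable M f" and [measurable]: "g \<in> borel_measurable M" and "\<And>x. cmod (g x) \<le> B"
  shows "integrable M (\<lambda>x. f x * g x)"
proof (rule Bochner_Integration.integrable_bound)
  show "integrable M (\<lambda>x. B *\<^sub>R f x)" using assms by auto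
  show "(\<lambda>x. f x * g x) \<in> borel_measurable M"
    using assms(1)[THEN borel_measurable_integrable] by measurable
  show "AE x in M. norm (f x * g x) \<le> norm (B *\<^sub>R f x)"
  proof (intro AE_I2)
    fix x
    have "cmod (g x) \<le> \<bar>B\<bar>" using assms(3)[of x] by linarith
    then show "norm (f x * g x) \<le> norm (B *\<^sub>R f x)"
      by (simp add: norm_mult) (metis mult.commute mult_right_mono norm_ge_zero)
  qed
qed

lemma integrable_mult_cis:
  fixes f :: "'a \<Rightarrow> complex"
  assumes "integrable M f" and [measurable]: "g \<in> borel_measurable M"
  shows "integrable M (\<lambda>x. f x * cis (g x))"
  by (rule integrable_mult_bounded[where B=1]) (use assms in auto)

lemma norm_fourier_le:
  assumes "integrable lborel f"
  shows "cmod (fourier f v) \<le> (1 / sqrt (2 * pi)) * (LINT u|lborel. cmod (f u))"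
proof -
  have "cmod (LINT u|lborel. f u * cis (- (u * v))) \<le> (LINT u|lborel. cmod (f u * cis (- (u * v))))"
    by (rule integral_norm_bound)
  then show ?thesis by (simp add: fourier_cis norm_mult norm_divide divide_simps)
qed

lemma continuous_on_fourier:
  assumes "integrable lborel f"
  shows "continuous_on UNIV (fourier f)"
proof -
  note [measurable] = borel_measurable_integrable[OF assms]
  have "(\<lambda>n. fourier f (X n)) \<longlonglongrightarrow> fourier f v" if "X \<longlonglongrightarrow> v" for X v
    unfolding fourier_cis
  proof (intro tendsto_intros integral_dominated_convergence[where w="\<lambda>u. cmod (f u)"])
    show "AE x in lborel. (\<lambda>i. f x * cis (- (x * X i))) \<longlonglongrightarrow> f x * cis (- (x * v))"
      by (intro AE_I2 tendsto_intros that)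
  qed (use assms in \<open>auto simp: norm_mult\<close>)
  then show ?thesis by (intro continuous_at_imp_continuous_on) (simp add: continuous_at_sequentially comp_def)
qed

lemma borel_measurable_fourier [measurable]:
  "integrable lborel f \<Longrightarrow> fourier f \<in> borel_measurable borel"
  by (intro borel_measurable_continuous_onI continuous_on_fourier)

lemma fourier_cmult: "fourier (\<lambda>x. c * f x) v = c * fourier f v"
  by (simp add: fourier_cis mult.assoc)

lemma fourier_diff:
  assumes "integrable lborel f" "integrable lborel g"
  shows "fourier (\<lambda>x. f x - g x) v = fourier f v - fourier g v"
  unfolding fourier_cis left_diff_distrib
  by (subst Bochner_Integration.integral_diff) (auto intro!: integrable_mult_cis assms simp: algebra_simps)

lemma fourier_sum:
  assumes "\<And>i. i \<in> I \<Longrightarrow> integrable lborel (f i)"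
  shows "fourier (\<lambda>x. \<Sum>i\<in>I. f i x) v = (\<Sum>i\<in>I. fourier (f i) v)"
  unfolding fourier_cis sum_distrib_right
  by (subst Bochner_Integration.integral_sum) (auto intro!: integrable_mult_cis assms simp: sum_distrib_left)

lemma fourier_shift:
  "fourier (\<lambda>x. f (x + a)) v = cis (a * v) * fourier f v"
proof -
  have "(LINT u|lborel. f u * cis (- (u * v))) = (LINT u|lborel. f (u + a) * cis (- ((u + a) * v)))"
    by (subst lborel_integral_real_affine[where c=1 and t=a]) (auto simp: ac_simps)
  also have "\<dots> = (LINT u|lborel. (f (u + a) * cis (- (u * v))) * cis (- (a * v)))"
    by (intro Bochner_Integration.integral_cong) (auto simp: mult.assoc cis_mult algebra_simps)
  also have "\<dots> = (LINT u|lborel. (f (u + a) * cis (- (u * v)))) * cis (- (a * v))" by simp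
  finally show ?thesis by (simp add: fourier_cis cis_mult)
qed

section \<open>Multiplication formula, Gaussian averages and inversion\<close>

lemma integrable_lborel_pair_mult:
  fixes f g :: "real \<Rightarrow> complex"
  assumes "integrable lborel f" "integrable lborel g"
  shows "integrable (lborel \<Otimes>\<^sub>M lborel) (\<lambda>(x, y). f x * g y)"
proof (rule lborel_pair.Fubini_integrable)
  note [measurable] = assms[THEN borel_measurable_integrable]
  show "(\<lambda>(x, y). f x * g y) \<in> borel_measurable (lborel \<Otimes>\<^sub>M lborel)" by measurable
  show "integrable lborel (\<lambda>x. \<integral>y. norm (case (x, y) of (x, y) \<Rightarrow> f x * g y) \<partial>lborel)"
    using assms by (auto simp: norm_mult)
  show "AE x in lborel. integrable lborel (\<lambda>y. case (x, y) of (x, y) \<Rightarrow> f x * g y)"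
    using assms by auto
qed

text \<open>Fubini: the exponential kernel is symmetric in its two variables, so it can be attached
  to either factor. Inversion and Bessel's inequality both rest on this exchange.\<close>

lemma fourier_multiplication_formula:
  assumes f: "integrable lborel f" and g: "integrable lborel g"
  shows "(LINT v|lborel. fourier f v * g v) = (LINT u|lborel. f u * fourier g u)"
proof -
  note [measurable] = assms[THEN borel_measurable_integrable]
  let ?c = "complex_of_real (1 / sqrt (2 * pi))"
  have int: "integrable (lborel \<Otimes>\<^sub>M lborel) (\<lambda>(u, v). f u * g v * cis (- (u * v)))"
    using integrable_mult_cis[OF integrable_lborel_pair_mult[OF f g], of "\<lambda>(u,v). - (u * v)"]
    by (auto simp: case_prod_beta')
  have "(LINT v|lborel. fourier f v * g v) = ?c * (LINT v|lborel. (LINT u|lborel. f u * cis (- (u * v))) * g v)"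
    unfolding fourier_cis mult.assoc by simp
  also have "(LINT v|lborel. (LINT u|lborel. f u * cis (- (u * v))) * g v)
      = (LINT v|lborel. (LINT u|lborel. f u * g v * cis (- (u * v))))"
    by (subst integral_mult_left_zero[symmetric]) (simp add: ac_simps)
  also have "\<dots> = (LINT u|lborel. (LINT v|lborel. f u * g v * cis (- (u * v))))"
    using lborel_pair.Fubini_integral[OF int] by simp
  also have "\<dots> = (LINT u|lborel. f u * (LINT v|lborel. g v * cis (- (v * u))))"
    by (simp add: ac_simps flip: integral_mult_right_zero)
  also have "?c * \<dots> = (LINT u|lborel. f u * fourier g u)"
    unfolding fourier_cis by (simp flip: integral_mult_right_zero add: ac_simps)
  finally show ?thesis .
qed

text \<open>A convergence factor tending to 1 as e tends to 0. By \<open>gauss_std_normal\<close> it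
  is a rescaled normal density, so its transform is known from probability theory.\<close>

definition gauss :: "real \<Rightarrow> real \<Rightarrow> real" where "gauss e v = exp (- (e * v)\<^sup>2 / 2)"

lemma gauss_std_normal: "gauss e v = sqrt (2 * pi) * std_normal_density (e * v)"
  by (simp add: gauss_def std_normal_density_def)

lemma gauss_pos: "0 < gauss e v" and gauss_le1: "gauss e v \<le> 1"
  by (auto simp: gauss_def)

lemma measurable_gauss [measurable]: "gauss e \<in> borel_measurable borel"
  unfolding gauss_def by measurable

lemma integrable_gauss: "e > 0 \<Longrightarrow> integrable lborel (gauss e)"
  using lborel_integrable_real_affine[OF integrable_std_normal_moment[of 0], of e 0]
  by (simp add: gauss_std_normal[abs_def])

text \<open>Rescaling by e reduces this to the characteristic function of the standard normal
  distribution; the factor \<open>cis (x * v)\<close> moves the centre of the resulting density to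
  x.\<close>

lemma fourier_gauss:
  assumes "e > 0"
  shows "fourier (\<lambda>v. complex_of_real (gauss e v) * cis (x * v)) y
     = complex_of_real (sqrt (2 * pi) / e * std_normal_density ((y - x) / e))"
proof -
  let ?s = "complex_of_real (sqrt (2 * pi))"
  have *: "(LINT v|lborel. complex_of_real (std_normal_density v) * cis (t * v)) = complex_of_real (exp (- t\<^sup>2 / 2))" for t
  proof -
    have "(LINT v|lborel. complex_of_real (std_normal_density v) * cis (t * v)) =
        (LINT v|lborel. std_normal_density v *\<^sub>R iexp (t * v))"
      by (simp add: scaleR_conv_of_real cis_conv_exp)
    also have "\<dots> = (LINT v|std_normal_distribution. iexp (t * v))"
      by (subst integral_density) auto
    also have "\<dots> = complex_of_real (exp (- t\<^sup>2 / 2))"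
      using fun_cong[OF char_std_normal_distribution, of t] unfolding char_def by simp
    finally show ?thesis .
  qed
  have "fourier (\<lambda>v. complex_of_real (gauss e v) * cis (x * v)) y
     = complex_of_real (1 / sqrt (2 * pi)) * (LINT v|lborel. complex_of_real (gauss e v) * cis ((x - y) * v))"
    unfolding fourier_cis mult.assoc cis_mult by (simp add: algebra_simps)
  also have "(LINT v|lborel. complex_of_real (gauss e v) * cis ((x - y) * v))
     = (LINT v|lborel. complex_of_real (gauss e (v / e)) * cis ((x - y) * (v / e))) / e"
    using assms by (subst lborel_integral_real_affine[where c="1/e" and t=0]) (auto simp: scaleR_conv_of_real)
  also have "(\<lambda>v. complex_of_real (gauss e (v / e)) * cis ((x - y) * (v / e)))
      = (\<lambda>v. ?s * (complex_of_real (std_normal_density v) * cis ((x - y) / e * v)))"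
    using assms by (auto simp: gauss_std_normal)
  also have "(LINT v|lborel. ?s * (complex_of_real (std_normal_density v) * cis ((x - y) / e * v)))
      = ?s * complex_of_real (exp (- ((x - y) / e)\<^sup>2 / 2))"
    using *[of "(x - y) / e"] by simp
  also have "((x - y) / e)\<^sup>2 = ((y - x) / e)\<^sup>2" by (simp add: power2_commute power_divide)
  finally show ?thesis using assms by (simp add: std_normal_density_def)
qed

text \<open>The multiplication formula with a modulated Gaussian in place of g: the damped inversion
  integral is a normal average of f around x at scale e.\<close>

lemma gauss_regularized_inversion:
  assumes f: "integrable lborel f" and e: "e > 0"
  shows "(LINT v|lborel. fourier f v * (complex_of_real (gauss e v) * cis (x * v)))
      = complex_of_real (sqrt (2 * pi)) * (LINT s|lborel. complex_of_real (std_normal_density s) * f (x + e * s))"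
proof -
  have i: "integrable lborel (\<lambda>v. complex_of_real (gauss e v) * cis (x * v))"
    using integrable_gauss[OF e] by (intro integrable_mult_cis) auto
  have "(LINT v|lborel. fourier f v * (complex_of_real (gauss e v) * cis (x * v)))
      = (LINT u|lborel. f u * complex_of_real (sqrt (2 * pi) / e * std_normal_density ((u - x) / e)))"
    unfolding fourier_multiplication_formula[OF f i] fourier_gauss[OF e] ..
  also have "\<dots> = e * (LINT s|lborel. f (x + e * s) * complex_of_real (sqrt (2 * pi) / e * std_normal_density s))"
    using e by (subst lborel_integral_real_affine[where c=e and t=x]) (auto simp: scaleR_conv_of_real)
  also have "\<dots> = complex_of_real (sqrt (2 * pi)) * (LINT s|lborel. complex_of_real (std_normal_density s) * f (x + e * s))"
    using e by (simp flip: integral_mult_right_zero add: field_simps)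
  finally show ?thesis .
qed

text \<open>Let e tend to 0 in the damped formula. The frequency side is dominated by the integrable
  \<open>fourier f\<close>; on the other side continuity gives the limit and boundedness the
  majorant. Evaluating the second transform at -x makes it the inverse transform.\<close>

theorem fourier_inversion:
  assumes f: "integrable lborel f" and cb: "f \<in> bcontfun" and Ff: "integrable lborel (fourier f)"
  shows "fourier (fourier f) (- x) = f x"
proof -
  note [measurable] = f[THEN borel_measurable_integrable] Ff[THEN borel_measurable_integrable]
  obtain B where B: "\<And>x. cmod (f x) \<le> B"
    using cb unfolding bcontfun_def bounded_iff by auto
  have ct: "isCont f x" using cb unfolding bcontfun_def by (auto intro: continuous_on_interior)
  define e where "e n = 1 / real (Suc n)" for n
  have e0: "e \<longlonglongrightarrow> 0" and ep: "e n > 0" for n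
    unfolding e_def using LIMSEQ_Suc[OF lim_1_over_n[where 'a=real]] by auto
  have "(\<lambda>n. LINT v|lborel. fourier f v * (complex_of_real (gauss (e n) v) * cis (x * v)))
      \<longlonglongrightarrow> (LINT v|lborel. fourier f v * (complex_of_real 1 * cis (x * v)))"
  proof (rule integral_dominated_convergence[where w="\<lambda>v. cmod (fourier f v)"])
    have "(\<lambda>n. gauss (e n) v) \<longlonglongrightarrow> exp (- (0 * v)\<^sup>2 / 2)" for v
      unfolding gauss_def by (intro tendsto_intros e0) simp
    then show "AE v in lborel. (\<lambda>n. fourier f v * (complex_of_real (gauss (e n) v) * cis (x * v)))
        \<longlonglongrightarrow> fourier f v * (complex_of_real 1 * cis (x * v))"
      by (intro AE_I2 tendsto_intros) auto
    show "AE v in lborel. norm (fourier f v * (complex_of_real (gauss (e n) v) * cis (x * v))) \<le> cmod (fourier f v)" for n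
      by (intro AE_I2) (auto simp: norm_mult abs_of_pos gauss_pos gauss_le1 intro: mult_left_le)
  qed (use Ff in \<open>auto simp: f\<close>)
  moreover have "(\<lambda>n. LINT s|lborel. complex_of_real (std_normal_density s) * f (x + e n * s))
      \<longlonglongrightarrow> (LINT s|lborel. complex_of_real (std_normal_density s) * f x)"
  proof (rule integral_dominated_convergence[where w="\<lambda>s. std_normal_density s * B"])
    have "(\<lambda>n. f (x + e n * s)) \<longlonglongrightarrow> f x" for s
      by (intro isCont_tendsto_compose[OF ct]) (auto intro!: tendsto_eq_intros e0)
    then show "AE s in lborel. (\<lambda>n. complex_of_real (std_normal_density s) * f (x + e n * s))
        \<longlonglongrightarrow> complex_of_real (std_normal_density s) * f x"
      by (intro AE_I2 tendsto_intros) auto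
    show "AE s in lborel. norm (complex_of_real (std_normal_density s) * f (x + e n * s)) \<le> std_normal_density s * B" for n
      by (intro AE_I2) (auto simp: norm_mult intro!: mult_left_mono B)
    show "integrable lborel (\<lambda>s. std_normal_density s * B)"
      using integrable_std_normal_moment[of 0] by simp
  qed auto
  moreover have "(LINT s|lborel. complex_of_real (std_normal_density s) * f x) = f x"
  proof -
    have "(LINT s|lborel. std_normal_density s) = 1"
      using integral_std_normal_moment_even[of 0] by simp
    then show ?thesis using integrable_std_normal_moment[of 0]
      by (simp del: integral_complex_of_real add: integral_complex_of_real[symmetric])
  qed
  ultimately have "(LINT v|lborel. fourier f v * (complex_of_real 1 * cis (x * v)))
      = complex_of_real (sqrt (2 * pi)) * f x"
    unfolding gauss_regularized_inversion[OF f ep]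
    by (auto intro: LIMSEQ_unique tendsto_mult_left)
  then show ?thesis by (simp add: fourier_cis mult.commute)
qed

section \<open>Square integrable functions\<close>

lemma borel_measurable_cnj [measurable]: "cnj \<in> borel_measurable borel"
  by (intro borel_measurable_continuous_onI continuous_intros)

text \<open>With the weight \<open>gauss e\<close> the energy of \<open>fourier h\<close> becomes a
  pairing of h with its own normal averages. The inequality a * b \<le> a^2/2 + b^2/2 and
  translation invariance bound this by the energy of h, uniformly in e; Fatou's lemma then removes
  the weight.\<close>

theorem fourier_Bessel:
  assumes h: "integrable lborel h"
  shows "(\<integral>\<^sup>+v. ennreal ((cmod (fourier h v))\<^sup>2) \<partial>lborel) \<le> (\<integral>\<^sup>+x. ennreal ((cmod (h x))\<^sup>2) \<partial>lborel)"
    (is "_ \<le> ?H")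
proof -
  note [measurable] = h[THEN borel_measurable_integrable] borel_measurable_fourier[OF h]
  let ?H2 = "\<integral>\<^sup>+x. ennreal ((cmod (h x))\<^sup>2 / 2) \<partial>lborel"
  have H2: "?H2 + ?H2 = ?H"
    by (subst nn_integral_add[symmetric]) (auto simp flip: ennreal_plus)
  have std1: "(\<integral>\<^sup>+s. ennreal (std_normal_density s) \<partial>lborel) = 1"
    using integral_std_normal_moment_even[of 0] integrable_std_normal_moment[of 0]
    by (subst nn_integral_eq_integral) auto
  obtain B where B: "\<And>v. cmod (fourier h v) \<le> B" using norm_fourier_le[OF h] by blast
  have A: "(\<integral>\<^sup>+v. ennreal ((cmod (fourier h v))\<^sup>2 * gauss e v) \<partial>lborel) \<le> ?H" if e: "e > 0" for e
  proof -
    \<comment> \<open>Chosen so that \<open>fourier h v * k v\<close> is the weighted energy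
      density; the conjugate makes \<open>fourier k\<close> the conjugate of a normal average of
      h.\<close>
    define k where "k v = complex_of_real (gauss e v) * cnj (fourier h v)" for v
    have k: "integrable lborel k" unfolding k_def
      by (intro integrable_mult_bounded[where B=B]) (use integrable_gauss[OF e] B in auto)
    have Fk: "fourier k u = cnj (LINT s|lborel. complex_of_real (std_normal_density s) * h (u + e * s))" for u
    proof -
      have "fourier k u = cnj (complex_of_real (1 / sqrt (2 * pi)) *
          (LINT v|lborel. fourier h v * (complex_of_real (gauss e v) * cis (u * v))))"
        unfolding fourier_cis[of k] k_def complex_cnj_mult complex_cnj_complex_of_real
          Bochner_Integration.integral_cnj[symmetric, of lborel "\<lambda>v. fourier h v * (complex_of_real (gauss e v) * cis (u * v))"]
        by (intro arg_cong[where f="\<lambda>z. complex_of_real (1 / sqrt (2 * pi)) * z"] Bochner_Integration.integral_cong refl)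
          (simp only: complex_cnj_mult complex_cnj_complex_of_real cis_cnj ac_simps)
      also have "\<dots> = cnj (LINT s|lborel. complex_of_real (std_normal_density s) * h (u + e * s))"
        unfolding gauss_regularized_inversion[OF h e] by simp
      finally show ?thesis .
    qed
    have hk: "integrable lborel (\<lambda>u. h u * fourier k u)"
      by (rule integrable_mult_bounded[OF h]) (use norm_fourier_le[OF k] k in auto)
    have int: "integrable lborel (\<lambda>v. (cmod (fourier h v))\<^sup>2 * gauss e v)"
    proof (rule Bochner_Integration.integrable_bound[where f="\<lambda>v. B\<^sup>2 * gauss e v"])
      show "AE v in lborel. norm ((cmod (fourier h v))\<^sup>2 * gauss e v) \<le> norm (B\<^sup>2 * gauss e v)"
        by (intro AE_I2) (auto simp: abs_mult gauss_pos less_imp_le intro!: mult_right_mono power_mono B)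
    qed (use integrable_gauss[OF e] in auto)
    have "complex_of_real (LINT v|lborel. (cmod (fourier h v))\<^sup>2 * gauss e v) = (LINT v|lborel. fourier h v * k v)"
      unfolding integral_complex_of_real[symmetric] k_def
      by (intro Bochner_Integration.integral_cong refl) (simp only: of_real_mult complex_norm_square ac_simps)
    also have "\<dots> = (LINT u|lborel. h u * fourier k u)"
      by (rule fourier_multiplication_formula[OF h k])
    finally have eq: "complex_of_real (LINT v|lborel. (cmod (fourier h v))\<^sup>2 * gauss e v) = \<dots>" .
    have "(\<integral>\<^sup>+v. ennreal ((cmod (fourier h v))\<^sup>2 * gauss e v) \<partial>lborel)
        = ennreal (LINT v|lborel. (cmod (fourier h v))\<^sup>2 * gauss e v)"
      by (rule nn_integral_eq_integral[OF int]) (simp add: gauss_pos less_imp_le)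
    also have "\<dots> \<le> ennreal (cmod (LINT u|lborel. h u * fourier k u))"
      by (intro ennreal_leI) (simp flip: eq)
    also have "\<dots> \<le> (\<integral>\<^sup>+u. ennreal (cmod (h u * fourier k u)) \<partial>lborel)"
      by (rule integral_norm_bound_ennreal[OF hk])
    also have "\<dots> \<le> (\<integral>\<^sup>+u. (\<integral>\<^sup>+s. ennreal (std_normal_density s) * (ennreal ((cmod (h u))\<^sup>2 / 2) + ennreal ((cmod (h (u + e * s)))\<^sup>2 / 2)) \<partial>lborel) \<partial>lborel)"
    proof (intro nn_integral_mono)
      fix u
      have i: "integrable lborel (\<lambda>s. complex_of_real (std_normal_density s) * h (u + e * s))"
        unfolding mult.commute[of "complex_of_real _"]
      proof (rule integrable_mult_bounded[where B="1 / sqrt (2 * pi)"])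
        show "integrable lborel (\<lambda>s. h (u + e * s))" using h e by (intro lborel_integrable_real_affine) auto
      qed (auto simp: std_normal_density_def norm_divide intro!: divide_right_mono)
      have "ennreal (cmod (h u * fourier k u))
         = ennreal (cmod (h u)) * ennreal (cmod (LINT s|lborel. complex_of_real (std_normal_density s) * h (u + e * s)))"
        by (simp add: norm_mult Fk ennreal_mult)
      also have "\<dots> \<le> ennreal (cmod (h u)) * (\<integral>\<^sup>+s. ennreal (cmod (complex_of_real (std_normal_density s) * h (u + e * s))) \<partial>lborel)"
        by (intro mult_left_mono integral_norm_bound_ennreal[OF i]) simp
      also have "\<dots> = (\<integral>\<^sup>+s. ennreal (cmod (h u)) * ennreal (cmod (complex_of_real (std_normal_density s) * h (u + e * s))) \<partial>lborel)"
        by (simp add: nn_integral_cmult)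
      also have "\<dots> \<le> (\<integral>\<^sup>+s. ennreal (std_normal_density s) * (ennreal ((cmod (h u))\<^sup>2 / 2) + ennreal ((cmod (h (u + e * s)))\<^sup>2 / 2)) \<partial>lborel)"
      proof (intro nn_integral_mono)
        fix s
        let ?a = "cmod (h u)" and ?b = "cmod (h (u + e * s))" and ?n = "std_normal_density s"
        have "0 \<le> (?a - ?b)\<^sup>2" by simp
        then have "?a * ?b \<le> ?a\<^sup>2 / 2 + ?b\<^sup>2 / 2" by (simp add: power2_diff)
        then have "?n * (?a * ?b) \<le> ?n * (?a\<^sup>2 / 2 + ?b\<^sup>2 / 2)" by (intro mult_left_mono) auto
        then have "ennreal (?n * (?a * ?b)) \<le> ennreal (?n * (?a\<^sup>2 / 2 + ?b\<^sup>2 / 2))" by (rule ennreal_leI)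
        then show "ennreal ?a * ennreal (cmod (complex_of_real ?n * h (u + e * s))) \<le> ennreal ?n * (ennreal (?a\<^sup>2 / 2) + ennreal (?b\<^sup>2 / 2))"
          by (simp add: norm_mult ennreal_mult mult.left_commute flip: ennreal_plus)
      qed
      finally show "ennreal (cmod (h u * fourier k u)) \<le> \<dots>" .
    qed
    \<comment> \<open>With u integrated first, the translate by \<open>e * s\<close> has the same
      energy as h, so the two halves add up to the full energy and the density integrates to
      1.\<close>
    also have "\<dots> = (\<integral>\<^sup>+s. (\<integral>\<^sup>+u. ennreal (std_normal_density s) * (ennreal ((cmod (h u))\<^sup>2 / 2) + ennreal ((cmod (h (u + e * s)))\<^sup>2 / 2)) \<partial>lborel) \<partial>lborel)"
      by (rule lborel_pair.Fubini') measurable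
    also have "\<dots> = (\<integral>\<^sup>+s. ennreal (std_normal_density s) * ?H \<partial>lborel)"
    proof (intro nn_integral_cong)
      fix s
      have "(\<integral>\<^sup>+u. ennreal ((cmod (h (u + e * s)))\<^sup>2 / 2) \<partial>lborel) = ?H2"
        by (subst nn_integral_real_affine[where c=1 and t="e * s"]) (auto simp: add.commute)
      then show "(\<integral>\<^sup>+u. ennreal (std_normal_density s) * (ennreal ((cmod (h u))\<^sup>2 / 2) + ennreal ((cmod (h (u + e * s)))\<^sup>2 / 2)) \<partial>lborel)
        = ennreal (std_normal_density s) * ?H"
        by (simp add: nn_integral_cmult nn_integral_add H2)
    qed
    also have "\<dots> = ?H" by (simp add: nn_integral_multc std1)
    finally show ?thesis .
  qed
  define e where "e n = 1 / real (Suc n)" for n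
  have e0: "e \<longlonglongrightarrow> 0" and ep: "e n > 0" for n
    unfolding e_def using LIMSEQ_Suc[OF lim_1_over_n[where 'a=real]] by auto
  have "(\<lambda>n. gauss (e n) v) \<longlonglongrightarrow> exp (- (0 * v)\<^sup>2 / 2)" for v
    unfolding gauss_def by (intro tendsto_intros e0) simp
  then have "(\<lambda>n. ennreal ((cmod (fourier h v))\<^sup>2 * gauss (e n) v)) \<longlonglongrightarrow> ennreal ((cmod (fourier h v))\<^sup>2 * 1)" for v
    by (intro tendsto_ennrealI tendsto_mult tendsto_const) simp
  note lim_imp_Liminf[OF trivial_limit_sequentially this]
  then have "(\<integral>\<^sup>+v. ennreal ((cmod (fourier h v))\<^sup>2) \<partial>lborel)
      = (\<integral>\<^sup>+v. liminf (\<lambda>n. ennreal ((cmod (fourier h v))\<^sup>2 * gauss (e n) v)) \<partial>lborel)"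
    by simp
  also have "\<dots> \<le> liminf (\<lambda>n. \<integral>\<^sup>+v. ennreal ((cmod (fourier h v))\<^sup>2 * gauss (e n) v) \<partial>lborel)"
    by (rule nn_integral_liminf) measurable
  also have "\<dots> \<le> ?H"
    by (rule Liminf_le) (use A ep in auto)
  finally show ?thesis .
qed

section \<open>Completeness in the quadratic norm\<close>

lemma fast_L2_Cauchy_AE_limit:
  fixes h :: "nat \<Rightarrow> 'a \<Rightarrow> complex"
  assumes [measurable]: "\<And>n. h n \<in> borel_measurable M"
    and d: "\<And>n. (\<integral>\<^sup>+x. ennreal ((cmod (h (Suc n) x - h n x))\<^sup>2) \<partial>M) \<le> ennreal ((1/4) ^ n)"
  obtains g where "g \<in> borel_measurable M" "AE x in M. (\<lambda>n. h n x) \<longlonglongrightarrow> g x"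
proof -
  \<comment> \<open>The weight 2^n against the bound 4^(-n) leaves the summable 2^(-n), so the
    weighted sum of squared increments is finite almost everywhere.\<close>
  have "(\<integral>\<^sup>+x. (\<Sum>n. ennreal (2 ^ n * (cmod (h (Suc n) x - h n x))\<^sup>2)) \<partial>M)
      = (\<Sum>n. \<integral>\<^sup>+x. ennreal (2 ^ n * (cmod (h (Suc n) x - h n x))\<^sup>2) \<partial>M)"
    by (rule nn_integral_suminf) measurable
  also have "\<dots> \<le> (\<Sum>n. ennreal ((1/2) ^ n))"
  proof (intro suminf_le)
    fix n
    have "(\<integral>\<^sup>+x. ennreal (2 ^ n * (cmod (h (Suc n) x - h n x))\<^sup>2) \<partial>M)
        = ennreal (2 ^ n) * (\<integral>\<^sup>+x. ennreal ((cmod (h (Suc n) x - h n x))\<^sup>2) \<partial>M)"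
      by (subst nn_integral_cmult[symmetric]) (auto simp: ennreal_mult)
    also have "\<dots> \<le> ennreal (2 ^ n) * ennreal ((1/4) ^ n)"
      by (intro mult_left_mono d) simp
    also have "\<dots> = ennreal ((1/2) ^ n)"
      by (subst ennreal_mult[symmetric]) (auto simp flip: power_mult_distrib)
    finally show "(\<integral>\<^sup>+x. ennreal (2 ^ n * (cmod (h (Suc n) x - h n x))\<^sup>2) \<partial>M) \<le> ennreal ((1/2) ^ n)" .
  qed auto
  also have "\<dots> < \<infinity>" 
    unfolding infinity_ennreal_def less_top[symmetric]
    by (rule ennreal_suminf_neq_top) (auto intro: summable_geometric)
  finally have fin: "(\<integral>\<^sup>+x. (\<Sum>n. ennreal (2 ^ n * (cmod (h (Suc n) x - h n x))\<^sup>2)) \<partial>M) < \<infinity>" .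
  have "AE x in M. (\<Sum>n. ennreal (2 ^ n * (cmod (h (Suc n) x - h n x))\<^sup>2)) \<noteq> \<infinity>"
    by (rule nn_integral_PInf_AE[OF _ less_imp_neq[OF fin]]) measurable
  then have "AE x in M. (\<lambda>n. h n x) \<longlonglongrightarrow> lim (\<lambda>n. h n x)"
  proof eventually_elim
    case (elim x)
    let ?d = "\<lambda>n. h (Suc n) x - h n x"
    have "summable (\<lambda>n. 2 ^ n * (cmod (?d n))\<^sup>2)"
      using elim by (intro summable_suminf_not_top) auto
    then have "summable (\<lambda>n. (1/2) ^ n + 2 ^ n * (cmod (?d n))\<^sup>2)"
      by (intro summable_add) auto
    \<comment> \<open>Weighted square summability gives absolute summability: an increment above
      2^(-n) is at most 2^n times its own square.\<close>
    moreover have "norm (?d n) \<le> (1/2) ^ n + 2 ^ n * (cmod (?d n))\<^sup>2" for n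
    proof (cases "cmod (?d n) \<le> (1/2) ^ n")
      case False
      then have "1 \<le> 2 ^ n * cmod (?d n)" by (simp add: field_simps power_divide)
      then have "1 * cmod (?d n) \<le> (2 ^ n * cmod (?d n)) * cmod (?d n)" by (intro mult_right_mono) auto
      then have "cmod (?d n) \<le> 2 ^ n * (cmod (?d n))\<^sup>2" by (simp add: power2_eq_square mult.assoc)
      moreover have "0 \<le> (1/2::real) ^ n" by simp
      ultimately show ?thesis by linarith
    qed (simp add: add_increasing2)
    ultimately have "summable ?d" by (rule summable_comparison_test'[where N=0])
    then have "(\<lambda>n. h 0 x + (\<Sum>i<n. ?d i)) \<longlonglongrightarrow> h 0 x + (\<Sum>i. ?d i)"
      by (intro tendsto_intros summable_LIMSEQ)
    then have "convergent (\<lambda>n. h n x)"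
      using sum_lessThan_telescope[of "\<lambda>n. h n x"] by (auto simp: convergent_def)
    then show ?case by (simp add: convergent_LIMSEQ_iff)
  qed
  moreover have "(\<lambda>x. lim (\<lambda>n. h n x)) \<in> borel_measurable M" by measurable
  ultimately show ?thesis by (rule that[rotated])
qed

text \<open>A pairwise error of the form \<open>E i + E j\<close> passes by Fatou's lemma to the
  error \<open>E i\<close> against the limit. A general net is used because the truncation parameter
  runs to 0 through the reals.\<close>

lemma L2_Cauchy_limit:
  fixes G :: "'i \<Rightarrow> 'a \<Rightarrow> complex" and E :: "'i \<Rightarrow> ennreal"
  assumes I: "eventually (\<lambda>i. i \<in> I) net" "net \<noteq> bot"
    and [measurable]: "\<And>i. i \<in> I \<Longrightarrow> G i \<in> borel_measurable M"
    and d: "\<And>i j. i \<in> I \<Longrightarrow> j \<in> I \<Longrightarrow> (\<integral>\<^sup>+x. ennreal ((cmod (G i x - G j x))\<^sup>2) \<partial>M) \<le> E i + E j"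
    and E: "(E \<longlongrightarrow> 0) net"
  obtains g where "g \<in> borel_measurable M"
    "\<And>i. i \<in> I \<Longrightarrow> (\<integral>\<^sup>+x. ennreal ((cmod (G i x - g x))\<^sup>2) \<partial>M) \<le> E i"
proof -
  \<comment> \<open>Half of 4^(-n), so that two consecutive chosen members differ by at most 4^(-n)
    in squared norm.\<close>
  have "\<exists>i\<in>I. E i < ennreal ((1/4) ^ n / 2)" for n
  proof -
    have "eventually (\<lambda>i. E i < ennreal ((1/4) ^ n / 2)) net"
      using E by (rule order_tendstoD) auto
    with I(1) have "eventually (\<lambda>i. i \<in> I \<and> E i < ennreal ((1/4) ^ n / 2)) net"
      by eventually_elim auto
    then show ?thesis using eventually_happens[of _ net] I(2) by blast
  qed
  then obtain i where i: "\<And>n. i n \<in> I" "\<And>n. E (i n) < ennreal ((1/4) ^ n / 2)" by metis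
  have [measurable]: "\<And>n. G (i n) \<in> borel_measurable M" using i by auto
  have "(\<integral>\<^sup>+x. ennreal ((cmod (G (i (Suc n)) x - G (i n) x))\<^sup>2) \<partial>M) \<le> ennreal ((1/4) ^ n)" for n
  proof -
    have "(\<integral>\<^sup>+x. ennreal ((cmod (G (i (Suc n)) x - G (i n) x))\<^sup>2) \<partial>M) \<le> E (i (Suc n)) + E (i n)"
      by (intro d i)
    also have "\<dots> \<le> ennreal ((1/4) ^ Suc n / 2) + ennreal ((1/4) ^ n / 2)"
      by (intro add_mono less_imp_le i)
    also have "\<dots> = ennreal ((1/4) ^ Suc n / 2 + (1/4) ^ n / 2)" by (rule ennreal_plus[symmetric]) auto
    also have "\<dots> \<le> ennreal ((1/4) ^ n)" by (intro ennreal_leI) simp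
    finally show ?thesis .
  qed
  then obtain g where [measurable]: "g \<in> borel_measurable M" and g: "AE x in M. (\<lambda>n. G (i n) x) \<longlonglongrightarrow> g x"
    by (rule fast_L2_Cauchy_AE_limit[rotated]) (use i in auto)
  have Ei: "(\<lambda>n. E (i n)) \<longlonglongrightarrow> 0"
  proof (rule tendsto_sandwich[OF _ _ tendsto_const])
    have "(\<lambda>n. ennreal ((1/4) ^ n / 2)) \<longlonglongrightarrow> ennreal (0 / 2)"
      by (intro tendsto_ennrealI tendsto_divide LIMSEQ_power_zero tendsto_const) auto
    then show "(\<lambda>n. ennreal ((1/4) ^ n / 2)) \<longlonglongrightarrow> 0" by simp
  qed (use i in \<open>auto intro: always_eventually less_imp_le\<close>)
  show ?thesis
  proof (rule that)
    fix j assume j: "j \<in> I"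
    then have [measurable]: "G j \<in> borel_measurable M" by auto
    have "(\<integral>\<^sup>+x. ennreal ((cmod (G j x - g x))\<^sup>2) \<partial>M) = (\<integral>\<^sup>+x. liminf (\<lambda>n. ennreal ((cmod (G j x - G (i n) x))\<^sup>2)) \<partial>M)"
      using g
    proof (intro nn_integral_cong_AE, eventually_elim)
      case (elim x)
      have "(\<lambda>n. ennreal ((cmod (G j x - G (i n) x))\<^sup>2)) \<longlonglongrightarrow> ennreal ((cmod (G j x - g x))\<^sup>2)"
        by (intro tendsto_ennrealI tendsto_intros elim)
      then show ?case by (rule lim_imp_Liminf[OF trivial_limit_sequentially, symmetric])
    qed
    also have "\<dots> \<le> liminf (\<lambda>n. \<integral>\<^sup>+x. ennreal ((cmod (G j x - G (i n) x))\<^sup>2) \<partial>M)"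
      by (rule nn_integral_liminf) measurable
    also have "\<dots> \<le> liminf (\<lambda>n. E j + E (i n))"
      by (intro Liminf_mono always_eventually allI d j i)
    also have "(\<lambda>n. E j + E (i n)) \<longlonglongrightarrow> E j + 0"
      by (intro tendsto_intros Ei)
    then have "liminf (\<lambda>n. E j + E (i n)) = E j" using lim_imp_Liminf[OF trivial_limit_sequentially] by fastforce
    finally show "(\<integral>\<^sup>+x. ennreal ((cmod (G j x - g x))\<^sup>2) \<partial>M) \<le> E j" .
  qed measurable
qed

text \<open>A triangle inequality for squared norms: the factor 2 is the price for staying with
  extended integrals and avoiding square roots.\<close>

lemma nn_integral_cmod_square_add:
  fixes a b c :: "'a \<Rightarrow> complex"
  assumes [measurable]: "a \<in> borel_measurable M" "b \<in> borel_measurable M" "c \<in> borel_measurable M"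
  shows "(\<integral>\<^sup>+x. ennreal ((cmod (a x - c x))\<^sup>2) \<partial>M)
    \<le> 2 * (\<integral>\<^sup>+x. ennreal ((cmod (a x - b x))\<^sup>2) \<partial>M) + 2 * (\<integral>\<^sup>+x. ennreal ((cmod (b x - c x))\<^sup>2) \<partial>M)"
proof -
  have "(cmod (a x - c x))\<^sup>2 \<le> 2 * (cmod (a x - b x))\<^sup>2 + 2 * (cmod (b x - c x))\<^sup>2" for x
  proof -
    let ?p = "cmod (a x - b x)" and ?q = "cmod (b x - c x)"
    have "cmod (a x - c x) \<le> ?p + ?q" using norm_triangle_ineq[of "a x - b x" "b x - c x"] by simp
    then have "(cmod (a x - c x))\<^sup>2 \<le> (?p + ?q)\<^sup>2" by (rule power_mono) simp
    moreover have "0 \<le> (?p - ?q)\<^sup>2" by simp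
    ultimately show ?thesis by (simp add: power2_sum power2_diff)
  qed
  then have "(\<integral>\<^sup>+x. ennreal ((cmod (a x - c x))\<^sup>2) \<partial>M)
    \<le> (\<integral>\<^sup>+x. 2 * ennreal ((cmod (a x - b x))\<^sup>2) + 2 * ennreal ((cmod (b x - c x))\<^sup>2) \<partial>M)"
    by (intro nn_integral_mono) (simp add: ennreal_mult[symmetric] ennreal_plus[symmetric] ennreal_numeral[symmetric] ennreal_leI del: ennreal_plus ennreal_numeral)
  also have "\<dots> = 2 * (\<integral>\<^sup>+x. ennreal ((cmod (a x - b x))\<^sup>2) \<partial>M) + 2 * (\<integral>\<^sup>+x. ennreal ((cmod (b x - c x))\<^sup>2) \<partial>M)"
    by (simp add: nn_integral_add nn_integral_cmult)
  finally show ?thesis .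
qed

section \<open>Truncated Riesz derivatives\<close>

lemma fourier_LINT:
  fixes K :: "real \<Rightarrow> real \<Rightarrow> complex"
  assumes K: "integrable (lborel \<Otimes>\<^sub>M lborel) (case_prod K)"
  shows "fourier (\<lambda>x. LINT u|lborel. K u x) v = (LINT u|lborel. fourier (K u) v)"
proof -
  have int: "integrable (lborel \<Otimes>\<^sub>M lborel) (case_prod (\<lambda>u x. K u x * cis (- (x * v))))"
    using integrable_mult_cis[OF K, of "\<lambda>(u, x). - (x * v)"] by (auto simp: case_prod_beta')
  have "(LINT x|lborel. (LINT u|lborel. K u x) * cis (- (x * v)))
      = (LINT x|lborel. (LINT u|lborel. K u x * cis (- (x * v))))" by simp
  also have "\<dots> = (LINT u|lborel. (LINT x|lborel. K u x * cis (- (x * v))))"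
    by (rule lborel_pair.Fubini_integral[OF int])
  finally show ?thesis unfolding fourier_cis by simp
qed

lemma set_integrable_powr_to_inf:
  fixes a e :: real
  assumes "a > 0" "e < -1"
  shows "integrable lborel (\<lambda>u. indicator {a..} u * u powr e)"
proof -
  have "(\<lambda>x. x powr e) absolutely_integrable_on {a..}"
    using has_integral_powr_to_inf[OF assms(2,1)] by (intro nonnegative_absolutely_integrable_1) (auto simp: integrable_on_def)
  then show ?thesis unfolding set_integrable_def
    by (subst (asm) integrable_completion) auto
qed

lemma set_integrable_powr_from_0:
  fixes e :: real
  assumes "e > -1"
  shows "integrable lborel (\<lambda>u. indicator {0..1} u * u powr e)"
proof -
  have "(\<lambda>x. x powr e) absolutely_integrable_on {0..1}"
    using integrable_on_powr_from_0[OF assms, of 1] by (intro nonnegative_absolutely_integrable_1) auto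
  then show ?thesis unfolding set_integrable_def
    by (subst (asm) integrable_completion) auto
qed

section \<open>Fourier multiplier of the truncated Riesz integral\<close>

definition riesz_kernel :: "real \<Rightarrow> nat \<Rightarrow> real \<Rightarrow> real" where
  "riesz_kernel \<alpha> j u = indicator {0<..} u * (sin u ^ (2 * j) / u powr (1 + \<alpha>))"

lemma measurable_riesz_kernel [measurable]: "riesz_kernel \<alpha> j \<in> borel_measurable borel"
  unfolding riesz_kernel_def by measurable

lemma riesz_kernel_nonneg: "0 \<le> riesz_kernel \<alpha> j u"
  unfolding riesz_kernel_def power_mult by (auto simp: indicator_def)

text \<open>Near 0 the zero of order 2j of the sine power compensates u^(1 + \<alpha>) because
  \<alpha> < 2j; towards infinity the bound 1 on the sine suffices because \<alpha> > 0.\<close>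

lemma integrable_riesz_kernel:
  assumes "0 < \<alpha>" "\<alpha> < 2 * real j"
  shows "integrable lborel (riesz_kernel \<alpha> j)"
proof (rule Bochner_Integration.integrable_bound)
  show "integrable lborel (\<lambda>u. indicator {0..1} u * u powr (2 * real j - (1 + \<alpha>)) + indicator {1..} u * u powr (- (1 + \<alpha>)))"
    using assms by (intro Bochner_Integration.integrable_add set_integrable_powr_from_0 set_integrable_powr_to_inf) auto
  have "riesz_kernel \<alpha> j u \<le> indicator {0..1} u * u powr (2 * real j - (1 + \<alpha>)) + indicator {1..} u * u powr (- (1 + \<alpha>))" for u
  proof (cases "u \<le> 0")
    case False
    show ?thesis
    proof (cases "u \<le> 1")
      case True
      have "\<bar>sin u\<bar> ^ (2 * j) \<le> \<bar>u\<bar> ^ (2 * j)"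
        using False by (intro power_mono abs_sin_x_le_abs_x) auto
      then have "sin u ^ (2 * j) \<le> u powr (2 * real j)"
        using False by (simp add: power_even_abs powr_realpow[symmetric])
      then show ?thesis using True False
        by (auto simp: riesz_kernel_def powr_diff indicator_def divide_right_mono add_increasing2)
    next
      case c: False
      have "\<bar>sin u\<bar> ^ (2 * j) \<le> 1" by (intro power_le_one) auto
      then have "sin u ^ (2 * j) / u powr (1 + \<alpha>) \<le> 1 / u powr (1 + \<alpha>)"
        by (intro divide_right_mono) (auto simp: power_even_abs)
      then show ?thesis using c False
        unfolding powr_minus_divide riesz_kernel_def by auto
    qed
  qed (auto simp: riesz_kernel_def)
  then show "AE u in lborel. norm (riesz_kernel \<alpha> j u)
      \<le> norm (indicator {0..1} u * u powr (2 * real j - (1 + \<alpha>)) + indicator {1..} u * u powr (- (1 + \<alpha>)))"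
    by (intro AE_I2) (simp add: riesz_kernel_nonneg order_trans[OF _ abs_ge_self])
qed auto

definition riesz_mass :: "real \<Rightarrow> nat \<Rightarrow> real" where
  "riesz_mass \<alpha> j = (LINT u|lborel. riesz_kernel \<alpha> j u)"

lemma riesz_const_eq: "riesz_const \<alpha> j = (-1) ^ j * 2 powr (2 * real j - \<alpha>) * riesz_mass \<alpha> j"
  by (simp add: riesz_const_def riesz_mass_def riesz_kernel_def[abs_def] set_lebesgue_integral_def)

text \<open>Positivity of the kernel between 0 and pi rules out a vanishing
  \<open>riesz_const\<close>, for which the division in the Riesz integral would return 0.\<close>

lemma riesz_mass_pos:
  assumes "0 < \<alpha>" "\<alpha> < 2 * real j"
  shows "0 < riesz_mass \<alpha> j"
proof -
  have "riesz_mass \<alpha> j \<noteq> 0"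
  proof
    assume "riesz_mass \<alpha> j = 0"
    then have "AE u in lborel. riesz_kernel \<alpha> j u = 0"
      using integral_nonneg_eq_0_iff_AE[OF integrable_riesz_kernel[OF assms]] riesz_kernel_nonneg
      by (simp add: riesz_mass_def)
    then have "AE u in lborel. u \<notin> {0<..<pi}"
    proof eventually_elim
      case (elim u)
      show ?case
      proof
        assume "u \<in> {0<..<pi}"
        then have "0 < sin u" by (intro sin_gt_zero) auto
        then show False using elim \<open>u \<in> {0<..<pi}\<close> by (auto simp: riesz_kernel_def)
      qed
    qed
    then have "{0<..<pi} \<in> null_sets lborel" by (subst AE_iff_null_sets) auto
    then have "emeasure lborel {0<..<pi} = 0" by (rule null_setsD1)
    then show False by simp
  qed
  moreover have "0 \<le> riesz_mass \<alpha> j"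
    unfolding riesz_mass_def by (intro integral_nonneg_AE) (auto simp: riesz_kernel_nonneg)
  ultimately show ?thesis by simp
qed

text \<open>The constant \<open>2 powr \<alpha> / riesz_mass \<alpha> j\<close> is
  \<open>(-1) ^ j * 2 ^ (2 * j) / riesz_const \<alpha> j\<close>, the numerator being the constant
  in the symbol of the central difference.\<close>

definition riesz_multiplier :: "real \<Rightarrow> nat \<Rightarrow> real \<Rightarrow> real \<Rightarrow> real" where
  "riesz_multiplier \<alpha> j \<epsilon> v = 2 powr \<alpha> / riesz_mass \<alpha> j *
     (LINT u|lborel. indicator {\<epsilon>..} u * (sin (u * v / 2) ^ (2 * j) / u powr (1 + \<alpha>)))"

text \<open>The substitution of |v| * u / 2 for u produces the power of |v|, and evenness of the
  sine power disposes of the sign of v. The substitution degenerates at v = 0, which is treated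
  apart.\<close>

lemma riesz_kernel_scaled:
  assumes "0 < \<alpha>" "\<alpha> < 2 * real j"
  shows "has_bochner_integral lborel (\<lambda>u. indicator {0<..} u * (sin (u * v / 2) ^ (2 * j) / u powr (1 + \<alpha>)))
      ((\<bar>v\<bar> / 2) powr \<alpha> * riesz_mass \<alpha> j)"
proof (cases "v = 0")
  case True
  then show ?thesis using assms by (simp add: power_0_left has_bochner_integral_zero)
next
  case False
  let ?c = "\<bar>v\<bar> / 2"
  have c: "?c > 0" using False by simp
  have "has_bochner_integral lborel (\<lambda>u. riesz_kernel \<alpha> j (0 + ?c * u)) (riesz_mass \<alpha> j /\<^sub>R \<bar>?c\<bar>)"
    using c lborel_has_bochner_integral_real_affine_iff[of ?c "riesz_kernel \<alpha> j" "riesz_mass \<alpha> j" 0]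
      integrable_riesz_kernel[OF assms] by (auto simp: riesz_mass_def has_bochner_integral_iff)
  then have "has_bochner_integral lborel (\<lambda>u. ?c powr (1 + \<alpha>) * riesz_kernel \<alpha> j (?c * u)) (?c powr (1 + \<alpha>) * (riesz_mass \<alpha> j /\<^sub>R ?c))"
    by (intro has_bochner_integral_mult_right) (use c in simp)
  moreover have "?c powr (1 + \<alpha>) * (riesz_mass \<alpha> j /\<^sub>R ?c) = ?c powr \<alpha> * riesz_mass \<alpha> j"
    using c by (simp add: powr_add)
  moreover have "?c powr (1 + \<alpha>) * riesz_kernel \<alpha> j (?c * u) = indicator {0<..} u * (sin (u * v / 2) ^ (2 * j) / u powr (1 + \<alpha>))" for u
  proof -
    have "sin (?c * u) ^ (2 * j) = sin (u * v / 2) ^ (2 * j)"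
      by (cases "v \<ge> 0") (auto simp: mult.commute)
    moreover have "(?c * u > 0) = (u > 0)" using c zero_less_mult_pos by (auto simp: zero_less_mult_iff)
    moreover have "(?c * u) powr (1 + \<alpha>) = ?c powr (1 + \<alpha>) * u powr (1 + \<alpha>)" if "u > 0"
      by (rule powr_mult)
    ultimately show ?thesis using c by (auto simp: riesz_kernel_def indicator_def simp del: times_divide_eq_left)
  qed
  ultimately show ?thesis by simp
qed

lemmas integrable_riesz_kernel_scaled = riesz_kernel_scaled[THEN has_bochner_integral_iff[THEN iffD1], THEN conjunct1]

lemma integrable_riesz_multiplier:
  assumes "0 < \<alpha>" "\<alpha> < 2 * real j" "0 < \<epsilon>"
  shows "integrable lborel (\<lambda>u. indicator {\<epsilon>..} u * (sin (u * v / 2) ^ (2 * j) / u powr (1 + \<alpha>)))"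
  by (rule Bochner_Integration.integrable_bound[OF integrable_riesz_kernel_scaled[OF assms(1,2), of v]])
    (use assms(3) in \<open>auto simp: indicator_def\<close>)

text \<open>The integrand is nonnegative, so cutting off at \<epsilon> only lowers the integral. The
  resulting bound is uniform in \<epsilon> and supplies the majorant for convergence in the
  quadratic norm.\<close>

lemma riesz_multiplier_bounds:
  assumes "0 < \<alpha>" "\<alpha> < 2 * real j" "0 < \<epsilon>"
  shows "0 \<le> riesz_multiplier \<alpha> j \<epsilon> v" "riesz_multiplier \<alpha> j \<epsilon> v \<le> \<bar>v\<bar> powr \<alpha>"
proof -
  have sin: "0 \<le> sin (u * v / 2) ^ (2 * j)" for u by (simp add: power_mult)
  show "0 \<le> riesz_multiplier \<alpha> j \<epsilon> v"
    unfolding riesz_multiplier_def using riesz_mass_pos[OF assms(1,2)] sin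
    by (intro mult_nonneg_nonneg integral_nonneg_AE AE_I2) auto
  have "(LINT u|lborel. indicator {\<epsilon>..} u * (sin (u * v / 2) ^ (2 * j) / u powr (1 + \<alpha>)))
    \<le> (LINT u|lborel. indicator {0<..} u * (sin (u * v / 2) ^ (2 * j) / u powr (1 + \<alpha>)))"
    using sin assms(3) by (intro integral_mono integrable_riesz_multiplier[OF assms]
        integrable_riesz_kernel_scaled[OF assms(1,2)]) (auto simp: indicator_def)
  also have "\<dots> = (\<bar>v\<bar> / 2) powr \<alpha> * riesz_mass \<alpha> j"
    by (rule has_bochner_integral_integral_eq[OF riesz_kernel_scaled[OF assms(1,2)]])
  finally show "riesz_multiplier \<alpha> j \<epsilon> v \<le> \<bar>v\<bar> powr \<alpha>"
    unfolding riesz_multiplier_def using riesz_mass_pos[OF assms(1,2)]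
    by (simp add: powr_divide field_simps)
qed

lemma riesz_multiplier_tendsto:
  assumes "0 < \<alpha>" "\<alpha> < 2 * real j" and X: "X \<longlonglongrightarrow> 0" "\<And>n. 0 < X n"
  shows "(\<lambda>n. riesz_multiplier \<alpha> j (X n) v) \<longlonglongrightarrow> \<bar>v\<bar> powr \<alpha>"
proof -
  let ?w = "\<lambda>u. indicator {0<..} u * (sin (u * v / 2) ^ (2 * j) / u powr (1 + \<alpha>))"
  have sin: "0 \<le> sin (u * v / 2) ^ (2 * j)" for u by (simp add: power_mult)
  have "(\<lambda>n. LINT u|lborel. indicator {X n..} u * (sin (u * v / 2) ^ (2 * j) / u powr (1 + \<alpha>))) \<longlonglongrightarrow> (LINT u|lborel. ?w u)"
  proof (rule integral_dominated_convergence[where w="?w"])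
    show "integrable lborel ?w"
      by (rule integrable_riesz_kernel_scaled[OF assms(1,2)])
    show "AE u in lborel. (\<lambda>n. indicator {X n..} u * (sin (u * v / 2) ^ (2 * j) / u powr (1 + \<alpha>))) \<longlonglongrightarrow> ?w u"
    proof (intro AE_I2 tendsto_intros)
      fix u :: real
      have "eventually (\<lambda>n. indicator {X n..} u = (indicator {0<..} u :: real)) sequentially"
      proof (cases "u > 0")
        case True
        then have "eventually (\<lambda>n. X n < u) sequentially" using X(1) by (intro order_tendstoD)
        then show ?thesis by eventually_elim (use True in auto)
      next
        case False
        have "indicator {X n..} u = (indicator {0<..} u :: real)" for n using X(2)[of n] False by (auto simp: indicator_def)
        then show ?thesis by simp
      qed
      then show "(\<lambda>n. indicator {X n..} u :: real) \<longlonglongrightarrow> indicator {0<..} u"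
        by (rule tendsto_eventually)
    qed
    show "AE u in lborel. norm (indicator {X n..} u * (sin (u * v / 2) ^ (2 * j) / u powr (1 + \<alpha>))) \<le> ?w u" for n
      using X(2)[of n] sin by (intro AE_I2) (auto simp: indicator_def abs_mult power_mult)
  qed measurable
  then have "(\<lambda>n. riesz_multiplier \<alpha> j (X n) v) \<longlonglongrightarrow> 2 powr \<alpha> / riesz_mass \<alpha> j * (LINT u|lborel. ?w u)"
    unfolding riesz_multiplier_def by (intro tendsto_intros)
  also have "2 powr \<alpha> / riesz_mass \<alpha> j * (LINT u|lborel. ?w u) = \<bar>v\<bar> powr \<alpha>"
    unfolding has_bochner_integral_integral_eq[OF riesz_kernel_scaled[OF assms(1,2)]]
    using riesz_mass_pos[OF assms(1,2)] by (simp add: powr_divide)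
  finally show ?thesis .
qed

text \<open>The binomial theorem for the power \<open>2 * j\<close> of
  \<open>cis (t / 2) - cis (- (t / 2))\<close>, which is 2i times the sine of t/2.\<close>

lemma central_diff_symbol:
  "(\<Sum>k=0..2*j. (-1) ^ k * of_nat ((2 * j) choose k) * cis ((real j - real k) * t))
     = complex_of_real ((-1) ^ j * 2 ^ (2 * j) * sin (t / 2) ^ (2 * j))"
proof -
  have "(\<Sum>k=0..2*j. (-1) ^ k * of_nat ((2 * j) choose k) * cis ((real j - real k) * t))
      = (\<Sum>k\<le>2*j. of_nat ((2 * j) choose k) * (- cis (- (t / 2))) ^ k * cis (t / 2) ^ (2 * j - k))"
  proof (intro sum.cong)
    fix k assume "k \<in> {..2*j}"
    then have k: "k \<le> 2 * j" by simp
    have "(- cis (- (t / 2))) ^ k * cis (t / 2) ^ (2 * j - k) = (-1) ^ k * (cis (- (t / 2)) ^ k * cis (t / 2) ^ (2 * j - k))"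
      by (subst power_minus) simp
    also have "cis (- (t / 2)) ^ k * cis (t / 2) ^ (2 * j - k) = cis ((real j - real k) * t)"
      unfolding Complex.DeMoivre cis_mult using k by (simp add: of_nat_diff algebra_simps)
    finally show "(-1) ^ k * of_nat ((2 * j) choose k) * cis ((real j - real k) * t)
      = of_nat ((2 * j) choose k) * (- cis (- (t / 2))) ^ k * cis (t / 2) ^ (2 * j - k)"
      by (simp add: mult.assoc mult.left_commute)
  qed auto
  also have "\<dots> = (- cis (- (t / 2)) + cis (t / 2)) ^ (2 * j)"
    by (rule binomial_ring[symmetric])
  also have "- cis (- (t / 2)) + cis (t / 2) = 2 * \<i> * complex_of_real (sin (t / 2))"
    by (simp add: complex_eq_iff)
  also have "(2 * \<i> * complex_of_real (sin (t / 2))) ^ (2 * j) = complex_of_real ((-1) ^ j * 2 ^ (2 * j) * sin (t / 2) ^ (2 * j))"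
    unfolding power_mult power_mult_distrib[of _ _ 2]
    by (simp add: power_minus[of "4 * (complex_of_real (sin (t / 2)))\<^sup>2" j] power_mult_distrib)
  finally show ?thesis .
qed

lemma fourier_central_diff:
  assumes f: "integrable lborel f"
  shows "fourier (\<lambda>x. central_diff j u f x) v
     = complex_of_real ((-1) ^ j * 2 ^ (2 * j) * sin (u * v / 2) ^ (2 * j)) * fourier f v"
proof -
  have *: "integrable lborel (\<lambda>x. f (x + a))" for a
    using lborel_integrable_real_affine[OF f, of 1 a] by (simp add: add.commute)
  have "fourier (\<lambda>x. central_diff j u f x) v
      = (\<Sum>k=0..2*j. (-1) ^ k * of_nat ((2 * j) choose k) * cis ((real j - real k) * u * v) * fourier f v)"
    unfolding central_diff_def by (subst fourier_sum) (auto intro!: * integrable_mult_right simp: fourier_cmult fourier_shift mult.assoc)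
  then show ?thesis
    unfolding sum_distrib_right[symmetric] mult.assoc[of "real j - real _"] central_diff_symbol .
qed

lemma norm_central_diff_le:
  assumes "\<And>x. cmod (f x) \<le> B"
  shows "cmod (central_diff j u f x) \<le> (\<Sum>k=0..2*j. real ((2 * j) choose k) * B)"
  unfolding central_diff_def
  by (intro order_trans[OF norm_sum] sum_mono) (auto simp: norm_mult norm_power assms intro!: mult_left_mono)

definition riesz_trunc :: "real \<Rightarrow> nat \<Rightarrow> (real \<Rightarrow> complex) \<Rightarrow> real \<Rightarrow> real \<Rightarrow> complex" where
  "riesz_trunc \<alpha> j f \<epsilon> x = complex_of_real (1 / riesz_const \<alpha> j) *
     (LINT u:{\<epsilon>..}|lborel. central_diff j u f x / complex_of_real (u powr (1 + \<alpha>)))"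

lemma riesz_trunc_eq:
  "riesz_trunc \<alpha> j f \<epsilon> x = complex_of_real (1 / riesz_const \<alpha> j) *
     (LINT u|lborel. complex_of_real (indicator {\<epsilon>..} u * u powr (- (1 + \<alpha>))) * central_diff j u f x)"
  unfolding riesz_trunc_def set_lebesgue_integral_def
  by (intro arg_cong[where f="\<lambda>z. _ * z"] Bochner_Integration.integral_cong)
    (auto simp: scaleR_conv_of_real powr_minus_divide indicator_def simp del: minus_add_distrib)

context
  fixes \<alpha> :: real and j :: nat and f :: "real \<Rightarrow> complex" and \<epsilon> :: real
  assumes \<alpha>: "0 < \<alpha>" "\<alpha> < 2 * real j" and f: "integrable lborel f" and \<epsilon>: "0 < \<epsilon>"
begin

text \<open>Each translate of f has the same integral norm, and the cutoff at \<epsilon> makes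
  \<open>u powr (- (1 + \<alpha>))\<close> integrable, so the iterated norm factors. This permits
  the exchange of integrals in the transform of the truncation.\<close>

lemma integrable_riesz_integrand:
  "integrable (lborel \<Otimes>\<^sub>M lborel)
     (\<lambda>(u, x). complex_of_real (indicator {\<epsilon>..} u * u powr (- (1 + \<alpha>))) * central_diff j u f x)"
proof -
  note [measurable] = borel_measurable_integrable[OF f]
  let ?p = "\<lambda>u. indicator {\<epsilon>..} u * u powr (- (1 + \<alpha>))"
  have p: "integrable lborel ?p" using \<epsilon> \<alpha> by (intro set_integrable_powr_to_inf) auto
  have "integrable (lborel \<Otimes>\<^sub>M lborel) (\<lambda>(u, x). complex_of_real (?p u) * f (x + a * u))" for a
  proof (rule lborel_pair.Fubini_integrable)
    show "(\<lambda>(u, x). complex_of_real (?p u) * f (x + a * u)) \<in> borel_measurable (lborel \<Otimes>\<^sub>M lborel)"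
      by measurable
    have fi: "integrable lborel (\<lambda>x. f (x + a * u))" for u
      using lborel_integrable_real_affine[OF f, of 1 "a * u"] by (simp add: add.commute)
    have "(LINT x|lborel. cmod (f (x + a * u))) = (LINT x|lborel. cmod (f x))" for u
      using lborel_integral_real_affine[of 1 "\<lambda>x. cmod (f x)" "a * u"] by (simp add: add.commute)
    then show "integrable lborel (\<lambda>u. LINT x|lborel. norm (case (u, x) of (u, x) \<Rightarrow> complex_of_real (?p u) * f (x + a * u)))"
      using p by (auto simp: norm_mult abs_mult simp del: of_real_mult intro!: integrable_mult_left)
    show "AE u in lborel. integrable lborel (\<lambda>x. case (u, x) of (u, x) \<Rightarrow> complex_of_real (?p u) * f (x + a * u))"
      using fi by (auto simp del: of_real_mult)
  qed
  then have "integrable (lborel \<Otimes>\<^sub>M lborel) (\<lambda>z. \<Sum>k=0..2*j. ((-1) ^ k * of_nat ((2 * j) choose k)) *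
      (case z of (u, x) \<Rightarrow> complex_of_real (?p u) * f (x + (real j - real k) * u)))"
    by (intro Bochner_Integration.integrable_sum integrable_mult_right)
  then show ?thesis
    by (rule Bochner_Integration.integrable_cong[THEN iffD1, OF refl, rotated])
      (auto simp: central_diff_def sum_distrib_left ac_simps)
qed

lemma integrable_riesz_trunc: "integrable lborel (riesz_trunc \<alpha> j f \<epsilon>)"
  unfolding riesz_trunc_eq[abs_def]
  by (intro integrable_mult_right lborel_pair.integrable_snd integrable_riesz_integrand)

lemma fourier_riesz_trunc:
  "fourier (riesz_trunc \<alpha> j f \<epsilon>) v = complex_of_real (riesz_multiplier \<alpha> j \<epsilon> v) * fourier f v"
proof -
  let ?p = "\<lambda>u. indicator {\<epsilon>..} u * u powr (- (1 + \<alpha>))"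
  have "fourier (riesz_trunc \<alpha> j f \<epsilon>) v = complex_of_real (1 / riesz_const \<alpha> j) *
     (LINT u|lborel. fourier (\<lambda>x. complex_of_real (?p u) * central_diff j u f x) v)"
    unfolding riesz_trunc_eq[abs_def] fourier_cmult[of "complex_of_real (1 / _)"]
    by (intro arg_cong[where f="\<lambda>z. _ * z"] fourier_LINT integrable_riesz_integrand)
  also have "(LINT u|lborel. fourier (\<lambda>x. complex_of_real (?p u) * central_diff j u f x) v)
     = (LINT u|lborel. complex_of_real ((-1) ^ j * 2 ^ (2 * j)) * complex_of_real (indicator {\<epsilon>..} u * (sin (u * v / 2) ^ (2 * j) / u powr (1 + \<alpha>))) * fourier f v)"
    unfolding fourier_cmult fourier_central_diff[OF f]
    by (intro Bochner_Integration.integral_cong refl)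
      (simp add: powr_minus_divide indicator_def del: minus_add_distrib)
  also have "\<dots> = complex_of_real ((-1) ^ j * 2 ^ (2 * j)) * complex_of_real (LINT u|lborel. indicator {\<epsilon>..} u * (sin (u * v / 2) ^ (2 * j) / u powr (1 + \<alpha>))) * fourier f v"
    by (simp only: integral_mult_left_zero integral_mult_right_zero integral_complex_of_real)
  also have "complex_of_real (1 / riesz_const \<alpha> j) * \<dots>
      = complex_of_real (1 / riesz_const \<alpha> j * ((-1) ^ j * 2 ^ (2 * j)) * (LINT u|lborel. indicator {\<epsilon>..} u * (sin (u * v / 2) ^ (2 * j) / u powr (1 + \<alpha>)))) * fourier f v"
    by simp
  also have "1 / riesz_const \<alpha> j * ((-1) ^ j * 2 ^ (2 * j)) = 2 powr \<alpha> / riesz_mass \<alpha> j"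
  proof -
    have "2 powr (2 * real j - \<alpha>) = 2 ^ (2 * j) / 2 powr \<alpha>"
      by (simp add: powr_diff flip: powr_realpow)
    then show ?thesis by (cases "even j") (auto simp: riesz_const_eq)
  qed
  finally show ?thesis by (simp add: riesz_multiplier_def)
qed

text \<open>Continuity and boundedness are wanted because the reverse Bessel inequality goes through
  pointwise inversion. Both follow from one integrable majorant in u.\<close>

lemma riesz_trunc_bcontfun:
  assumes fb: "f \<in> bcontfun"
  shows "riesz_trunc \<alpha> j f \<epsilon> \<in> bcontfun"
proof -
  note [measurable] = borel_measurable_integrable[OF f]
  let ?p = "\<lambda>u. indicator {\<epsilon>..} u * u powr (- (1 + \<alpha>))"
  have p: "integrable lborel ?p" using \<epsilon> \<alpha> by (intro set_integrable_powr_to_inf) auto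
  obtain B where B: "\<And>x. cmod (f x) \<le> B"
    using fb unfolding bcontfun_def bounded_iff by auto
  define B' where "B' = (\<Sum>k=0..2*j. real ((2 * j) choose k) * B)"
  have bd: "cmod (complex_of_real (?p u) * central_diff j u f x) \<le> ?p u * B'" for u x
    using norm_central_diff_le[of f B j u x, OF B] unfolding B'_def norm_mult norm_of_real
    by (simp add: mult_left_mono abs_mult)
  have ct: "continuous_on UNIV f" using fb by (simp add: bcontfun_def)
  have "(\<lambda>n. riesz_trunc \<alpha> j f \<epsilon> (X n)) \<longlonglongrightarrow> riesz_trunc \<alpha> j f \<epsilon> x" if X: "X \<longlonglongrightarrow> x" for X x
    unfolding riesz_trunc_eq
  proof (intro tendsto_mult_left integral_dominated_convergence[where w="\<lambda>u. ?p u * B'"])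
    have "(\<lambda>n. f (X n + a)) \<longlonglongrightarrow> f (x + a)" for a
      by (rule continuous_on_tendsto_compose[OF ct]) (auto intro!: tendsto_intros X)
    then show "AE u in lborel. (\<lambda>n. complex_of_real (?p u) * central_diff j u f (X n)) \<longlonglongrightarrow> complex_of_real (?p u) * central_diff j u f x"
      unfolding central_diff_def by (intro AE_I2 tendsto_intros) auto
    show "(\<lambda>u. complex_of_real (?p u) * central_diff j u f x) \<in> borel_measurable lborel" for x
      unfolding central_diff_def by measurable
    show "(\<lambda>u. complex_of_real (?p u) * central_diff j u f (X n)) \<in> borel_measurable lborel" for n
      unfolding central_diff_def by measurable
    show "integrable lborel (\<lambda>u. ?p u * B')" using p by simp
  qed (use bd in auto)
  then have "continuous_on UNIV (riesz_trunc \<alpha> j f \<epsilon>)"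
    by (intro continuous_at_imp_continuous_on) (simp add: continuous_at_sequentially comp_def)
  moreover have "cmod (riesz_trunc \<alpha> j f \<epsilon> x) \<le> \<bar>1 / riesz_const \<alpha> j\<bar> * (LINT u|lborel. ?p u * B')" for x
    unfolding riesz_trunc_eq norm_mult norm_of_real
    by (intro mult_left_mono order_trans[OF integral_norm_bound] integral_mono'[OF _ bd order_trans[OF norm_ge_zero bd]])
      (use p in auto)
  then have "bounded (range (riesz_trunc \<alpha> j f \<epsilon>))" by (auto simp: bounded_iff)
  ultimately show ?thesis by (simp add: bcontfun_def)
qed

end

text \<open>Bessel's inequality for \<open>fourier h\<close>: by inversion its transform is h
  reflected, and reflection preserves the energy.\<close>

lemma fourier_Bessel_reverse:
  assumes "integrable lborel h" "h \<in> bcontfun" "integrable lborel (fourier h)"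
  shows "(\<integral>\<^sup>+x. ennreal ((cmod (h x))\<^sup>2) \<partial>lborel) \<le> (\<integral>\<^sup>+v. ennreal ((cmod (fourier h v))\<^sup>2) \<partial>lborel)"
proof -
  note [measurable] = borel_measurable_fourier[OF assms(3)]
  have "(\<integral>\<^sup>+x. ennreal ((cmod (h x))\<^sup>2) \<partial>lborel) = (\<integral>\<^sup>+x. ennreal ((cmod (fourier (fourier h) (0 + (-1) * x)))\<^sup>2) \<partial>lborel)"
    using fourier_inversion[OF assms] by simp
  also have "\<dots> = (\<integral>\<^sup>+x. ennreal ((cmod (fourier (fourier h) x))\<^sup>2) \<partial>lborel)"
    by (subst nn_integral_real_affine[where c="-1" and t=0]) auto
  also have "\<dots> \<le> (\<integral>\<^sup>+v. ennreal ((cmod (fourier h v))\<^sup>2) \<partial>lborel)"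
    by (rule fourier_Bessel[OF assms(3)])
  finally show ?thesis .
qed

section \<open>Existence and transform of the strong Riesz derivative\<close>

lemma L2_space_iff:
  "f \<in> L2_space \<longleftrightarrow> f \<in> borel_measurable borel \<and> (\<integral>\<^sup>+x. ennreal ((cmod (f x))\<^sup>2) \<partial>lborel) < \<infinity>"
  unfolding L2_space_def by (auto simp: integrable_iff_bounded)

lemma L2_space_L1_bounded:
  assumes "integrable lborel f" "\<And>x. cmod (f x) \<le> B"
  shows "f \<in> L2_space"
proof -
  note [measurable] = borel_measurable_integrable[OF assms(1)]
  have "integrable lborel (\<lambda>x. (cmod (f x))\<^sup>2)"
  proof (rule Bochner_Integration.integrable_bound)
    show "integrable lborel (\<lambda>x. B * cmod (f x))" using assms(1) by simp
    have "0 \<le> B" using assms(2)[of 0] norm_ge_zero order_trans by blast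
    then show "AE x in lborel. norm ((cmod (f x))\<^sup>2) \<le> norm (B * cmod (f x))"
      using assms(2) by (intro AE_I2) (auto simp: power2_eq_square intro: mult_right_mono)
  qed measurable
  then show ?thesis by (simp add: L2_space_def)
qed

text \<open>Two limits in the quadratic norm agree almost everywhere; for continuous functions the
  set of disagreement is open, and an open null set is empty. This makes the description in
  \<open>fourier_Cb\<close> definite.\<close>

lemma is_L2_fourier_unique:
  assumes "is_L2_fourier g F" "is_L2_fourier g F'" "F \<in> bcontfun" "F' \<in> bcontfun"
  shows "F = F'"
proof -
  have cont: "continuous_on UNIV F" "continuous_on UNIV F'" using assms(3,4) by (auto simp: bcontfun_def)
  note [measurable] = this[THEN borel_measurable_continuous_onI]
  have g: "g \<in> L2_space" using assms(1) by (simp add: is_L2_fourier_def)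
  then have [measurable]: "g \<in> borel_measurable borel" by (simp add: L2_space_iff)
  define T where "T R v = complex_of_real (1 / sqrt (2 * pi)) *
       (LINT u:{-R..R}|lborel. g u * exp (- \<i> * complex_of_real (u * v)))" for R v
  have [measurable]: "T R \<in> borel_measurable borel" for R
    unfolding T_def set_lebesgue_integral_def by measurable
  have lim: "((\<lambda>R. \<integral>\<^sup>+v. ennreal ((cmod (T R v - F v))\<^sup>2) \<partial>lborel) \<longlongrightarrow> 0) at_top"
    "((\<lambda>R. \<integral>\<^sup>+v. ennreal ((cmod (T R v - F' v))\<^sup>2) \<partial>lborel) \<longlongrightarrow> 0) at_top"
    using assms(1,2) unfolding is_L2_fourier_def L2_tendsto_def T_def by blast+
  have "(\<integral>\<^sup>+v. ennreal ((cmod (F v - F' v))\<^sup>2) \<partial>lborel) \<le> 2 * 0 + 2 * 0"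
  proof (rule tendsto_lowerbound)
    show "((\<lambda>R. 2 * (\<integral>\<^sup>+v. ennreal ((cmod (F v - T R v))\<^sup>2) \<partial>lborel)
        + 2 * (\<integral>\<^sup>+v. ennreal ((cmod (T R v - F' v))\<^sup>2) \<partial>lborel)) \<longlongrightarrow> 2 * 0 + 2 * 0) at_top"
      using lim by (intro tendsto_add ennreal_tendsto_cmult) (auto simp: norm_minus_commute)
    show "\<forall>\<^sub>F R in at_top. (\<integral>\<^sup>+v. ennreal ((cmod (F v - F' v))\<^sup>2) \<partial>lborel)
       \<le> 2 * (\<integral>\<^sup>+v. ennreal ((cmod (F v - T R v))\<^sup>2) \<partial>lborel)
        + 2 * (\<integral>\<^sup>+v. ennreal ((cmod (T R v - F' v))\<^sup>2) \<partial>lborel)"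
      by (intro always_eventually allI nn_integral_cmod_square_add) measurable
  qed auto
  then have "(\<integral>\<^sup>+v. ennreal ((cmod (F v - F' v))\<^sup>2) \<partial>lborel) = 0" by simp
  then have "AE v in lborel. F v = F' v"
    by (subst (asm) nn_integral_0_iff_AE) auto
  then have "AE v in lborel. v \<notin> {v. F v \<noteq> F' v}" by simp
  then have "{v. F v \<noteq> F' v} \<in> null_sets lborel" by (subst AE_iff_null_sets) measurable
  then have "negligible {v. F v \<noteq> F' v}"
    unfolding negligible_iff_null_sets by (rule null_sets_completionI)
  moreover have "open {v. F v \<noteq> F' v}" by (rule open_Collect_neq[OF cont])
  ultimately have "{v. F v \<noteq> F' v} = {}" using open_not_negligible by blast
  then show ?thesis by auto
qed

text \<open>For fixed \<epsilon> the bound 1 on the sine power gives a bound independent of v,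
  unlike the growing \<open>\<bar>v\<bar> powr \<alpha>\<close>; thus the transform of a truncation
  inherits integrability from \<open>fourier f\<close>.\<close>

lemma riesz_multiplier_bounded:
  assumes "0 < \<alpha>" "\<alpha> < 2 * real j" "0 < \<epsilon>"
  shows "\<exists>B. \<forall>v. riesz_multiplier \<alpha> j \<epsilon> v \<le> B"
proof -
  have "riesz_multiplier \<alpha> j \<epsilon> v \<le> 2 powr \<alpha> / riesz_mass \<alpha> j * (LINT u|lborel. indicator {\<epsilon>..} u * u powr (- (1 + \<alpha>)))" for v
    unfolding riesz_multiplier_def
  proof (rule mult_left_mono[OF integral_mono])
    show "integrable lborel (\<lambda>u. indicator {\<epsilon>..} u * (sin (u * v / 2) ^ (2 * j) / u powr (1 + \<alpha>)))"
      by (rule integrable_riesz_multiplier[OF assms])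
    show "integrable lborel (\<lambda>u. indicator {\<epsilon>..} u * u powr (- (1 + \<alpha>)))"
      using assms by (intro set_integrable_powr_to_inf) auto
    fix u :: real
    have "\<bar>sin (u * v / 2)\<bar> ^ (2 * j) \<le> 1" by (intro power_le_one) auto
    then have "sin (u * v / 2) ^ (2 * j) / u powr (1 + \<alpha>) \<le> 1 / u powr (1 + \<alpha>)"
      by (intro divide_right_mono) (auto simp: power_even_abs)
    then show "indicator {\<epsilon>..} u * (sin (u * v / 2) ^ (2 * j) / u powr (1 + \<alpha>)) \<le> indicator {\<epsilon>..} u * u powr (- (1 + \<alpha>))"
      unfolding powr_minus_divide by (intro mult_left_mono) auto
  qed (use assms riesz_mass_pos[OF assms(1,2)] in auto)
  then show ?thesis by blast
qed

context
  fixes \<alpha> :: real and f F :: "real \<Rightarrow> complex"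
  assumes \<alpha>: "0 < \<alpha>" and f: "integrable lborel f" and fb: "f \<in> bcontfun" and Ff: "integrable lborel (fourier f)"
    and F_def: "F = (\<lambda>v. complex_of_real (\<bar>v\<bar> powr \<alpha>) * fourier f v)" and F: "F \<in> L2_space"
begin

text \<open>The multiplier differs from its limit by at most the limit itself, so the squared error
  is dominated by the integrable |F|^2. Passing to sequences makes dominated convergence
  applicable.\<close>

lemma fourier_riesz_trunc_tendsto:
  assumes j: "\<alpha> < 2 * real j"
  shows "((\<lambda>\<epsilon>. \<integral>\<^sup>+v. ennreal ((cmod (fourier (riesz_trunc \<alpha> j f \<epsilon>) v - F v))\<^sup>2) \<partial>lborel) \<longlongrightarrow> 0) (at_right 0)"
  unfolding tendsto_at_iff_sequentially comp_def
proof (intro allI impI)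
  fix X :: "nat \<Rightarrow> real"
  assume "\<forall>i. X i \<in> {0<..} - {0}" and X: "X \<longlonglongrightarrow> 0"
  then have pos: "0 < X i" for i by auto
  have [measurable]: "F \<in> borel_measurable borel" using F by (simp add: L2_space_iff)
  have [measurable]: "fourier (riesz_trunc \<alpha> j f (X i)) \<in> borel_measurable borel" for i
    by (intro borel_measurable_fourier integrable_riesz_trunc \<alpha> j f pos)
  have eq: "fourier (riesz_trunc \<alpha> j f (X i)) v - F v
      = complex_of_real (riesz_multiplier \<alpha> j (X i) v - \<bar>v\<bar> powr \<alpha>) * fourier f v" for i v
    by (simp add: fourier_riesz_trunc[OF \<alpha> j f pos] F_def algebra_simps)
  have "(\<lambda>i. \<integral>\<^sup>+v. ennreal ((cmod (fourier (riesz_trunc \<alpha> j f (X i)) v - F v))\<^sup>2) \<partial>lborel) \<longlonglongrightarrow> (\<integral>\<^sup>+v. 0 \<partial>(lborel :: real measure))"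
  proof (rule nn_integral_dominated_convergence[where w="\<lambda>v. ennreal ((cmod (F v))\<^sup>2)"])
    show "AE v in lborel. ennreal ((cmod (fourier (riesz_trunc \<alpha> j f (X i)) v - F v))\<^sup>2) \<le> ennreal ((cmod (F v))\<^sup>2)" for i
    proof (intro AE_I2 ennreal_leI power_mono)
      fix v
      have "\<bar>riesz_multiplier \<alpha> j (X i) v - \<bar>v\<bar> powr \<alpha>\<bar> \<le> \<bar>v\<bar> powr \<alpha>"
        using riesz_multiplier_bounds[OF \<alpha> j pos, of i v] by auto
      then show "cmod (fourier (riesz_trunc \<alpha> j f (X i)) v - F v) \<le> cmod (F v)"
        unfolding eq norm_mult norm_of_real by (simp add: F_def norm_mult mult_right_mono)
    qed auto
    show "AE v in lborel. (\<lambda>i. ennreal ((cmod (fourier (riesz_trunc \<alpha> j f (X i)) v - F v))\<^sup>2)) \<longlonglongrightarrow> 0"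
    proof (intro AE_I2)
      fix v
      have "(\<lambda>i. ennreal ((cmod (fourier (riesz_trunc \<alpha> j f (X i)) v - F v))\<^sup>2))
         \<longlonglongrightarrow> ennreal ((cmod (complex_of_real (\<bar>v\<bar> powr \<alpha> - \<bar>v\<bar> powr \<alpha>) * fourier f v))\<^sup>2)"
        unfolding eq by (intro tendsto_ennrealI tendsto_intros riesz_multiplier_tendsto \<alpha> j X pos)
      then show "(\<lambda>i. ennreal ((cmod (fourier (riesz_trunc \<alpha> j f (X i)) v - F v))\<^sup>2)) \<longlonglongrightarrow> 0" by simp
    qed
    show "(\<integral>\<^sup>+v. ennreal ((cmod (F v))\<^sup>2) \<partial>lborel) < \<infinity>" using F by (simp add: L2_space_iff)
  qed measurable
  then show "(\<lambda>i. \<integral>\<^sup>+v. ennreal ((cmod (fourier (riesz_trunc \<alpha> j f (X i)) v - F v))\<^sup>2) \<partial>lborel) \<longlonglongrightarrow> 0" by simp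
qed

text \<open>The truncations are close on the transform side, and the reverse Bessel inequality
  carries this back to the truncations themselves; completeness then gives g.\<close>

lemma ex_strong_riesz_deriv:
  assumes j: "\<alpha> < 2 * real j"
  shows "\<exists>g. is_strong_riesz_deriv \<alpha> j f g"
proof -
  let ?G = "riesz_trunc \<alpha> j f"
  let ?E = "\<lambda>\<epsilon>. \<integral>\<^sup>+v. ennreal ((cmod (fourier (?G \<epsilon>) v - F v))\<^sup>2) \<partial>lborel"
  have Gi: "integrable lborel (?G \<epsilon>)" if "\<epsilon> > 0" for \<epsilon> by (rule integrable_riesz_trunc[OF \<alpha> j f that])
  have Gb: "?G \<epsilon> \<in> bcontfun" if "\<epsilon> > 0" for \<epsilon> by (rule riesz_trunc_bcontfun[OF \<alpha> j f that fb])
  have [measurable]: "F \<in> borel_measurable borel" using F by (simp add: L2_space_iff)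
  have FG: "integrable lborel (fourier (?G \<epsilon>))" if e: "\<epsilon> > 0" for \<epsilon>
  proof -
    obtain B where B: "\<And>v. riesz_multiplier \<alpha> j \<epsilon> v \<le> B" using riesz_multiplier_bounded[OF \<alpha> j e] by blast
    show ?thesis
    proof (rule Bochner_Integration.integrable_bound)
      show "integrable lborel (\<lambda>v. complex_of_real B * fourier f v)" using Ff by simp
      show "fourier (?G \<epsilon>) \<in> borel_measurable lborel" using borel_measurable_fourier[OF Gi[OF e]] by simp
      show "AE v in lborel. norm (fourier (?G \<epsilon>) v) \<le> norm (complex_of_real B * fourier f v)"
        using B riesz_multiplier_bounds(1)[OF \<alpha> j e]
        by (intro AE_I2) (auto simp: fourier_riesz_trunc[OF \<alpha> j f e] norm_mult intro!: mult_right_mono order_trans[OF B abs_ge_self])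
    qed
  qed
  have E0: "((\<lambda>\<epsilon>. 2 * ?E \<epsilon>) \<longlongrightarrow> 0) (at_right 0)"
    using ennreal_tendsto_cmult[OF _ fourier_riesz_trunc_tendsto[OF j], of 2] by simp
  \<comment> \<open>The factor in \<open>2 * ?E \<epsilon>\<close> comes from comparing two
    transforms through F with \<open>nn_integral_cmod_square_add\<close>.\<close>
  obtain g where g[measurable]: "g \<in> borel_measurable lborel"
    and gE: "\<And>\<epsilon>. \<epsilon> \<in> {0<..} \<Longrightarrow> (\<integral>\<^sup>+x. ennreal ((cmod (?G \<epsilon> x - g x))\<^sup>2) \<partial>lborel) \<le> 2 * ?E \<epsilon>"
  proof (rule L2_Cauchy_limit[of "{0<..}" "at_right (0::real)" ?G lborel "\<lambda>\<epsilon>. 2 * ?E \<epsilon>"])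
    show "\<forall>\<^sub>F \<epsilon> in at_right 0. \<epsilon> \<in> {0::real<..}" by (simp add: eventually_at_right_less)
    fix a b :: real assume "a \<in> {0<..}" "b \<in> {0<..}"
    then have a: "a > 0" and b: "b > 0" by auto
    note [measurable] = borel_measurable_fourier[OF Gi[OF a]] borel_measurable_fourier[OF Gi[OF b]]
    let ?D = "\<lambda>x. ?G a x - ?G b x"
    have FD: "fourier ?D = (\<lambda>v. fourier (?G a) v - fourier (?G b) v)"
      using fourier_diff[OF Gi[OF a] Gi[OF b]] by blast
    have "?D \<in> bcontfun"
      using Gb[OF a] Gb[OF b] by (rule minus_cont)
    then have "(\<integral>\<^sup>+x. ennreal ((cmod (?D x))\<^sup>2) \<partial>lborel) \<le> (\<integral>\<^sup>+v. ennreal ((cmod (fourier ?D v))\<^sup>2) \<partial>lborel)"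
      by (intro fourier_Bessel_reverse) (auto simp: FD intro: Gi FG a b)
    also have "\<dots> \<le> 2 * ?E a + 2 * (\<integral>\<^sup>+v. ennreal ((cmod (F v - fourier (?G b) v))\<^sup>2) \<partial>lborel)"
      unfolding FD by (rule nn_integral_cmod_square_add) auto
    finally show "(\<integral>\<^sup>+x. ennreal ((cmod (?D x))\<^sup>2) \<partial>lborel) \<le> 2 * ?E a + 2 * ?E b"
      by (simp add: norm_minus_commute)
  qed (use E0 Gi in \<open>auto intro: borel_measurable_integrable\<close>)
  obtain B where "\<And>x. cmod (f x) \<le> B" using fb unfolding bcontfun_def bounded_iff by auto
  then have "f \<in> L2_space" by (rule L2_space_L1_bounded[OF f])
  have E: "((\<lambda>\<epsilon>. \<integral>\<^sup>+x. ennreal ((cmod (?G \<epsilon> x - g x))\<^sup>2) \<partial>lborel) \<longlongrightarrow> 0) (at_right 0)"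
    by (rule tendsto_sandwich[OF _ _ tendsto_const E0]) (auto simp: eventually_at_filter intro!: always_eventually gE)
  \<comment> \<open>One truncation at squared distance below 1 from g suffices to see that g is
    square integrable.\<close>
  have "eventually (\<lambda>\<epsilon>. (\<integral>\<^sup>+x. ennreal ((cmod (?G \<epsilon> x - g x))\<^sup>2) \<partial>lborel) < 1 \<and> \<epsilon> > 0) (at_right 0)"
    using order_tendstoD(2)[OF E, of 1] by (auto intro!: eventually_conj eventually_at_right_less)
  then obtain \<epsilon> where e: "(\<integral>\<^sup>+x. ennreal ((cmod (?G \<epsilon> x - g x))\<^sup>2) \<partial>lborel) < 1" "\<epsilon> > 0"
    using eventually_happens[of _ "at_right (0::real)"] by auto
  obtain B where "\<And>x. cmod (?G \<epsilon> x) \<le> B" using Gb[OF e(2)] unfolding bcontfun_def bounded_iff by auto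
  then have GL2: "?G \<epsilon> \<in> L2_space" by (rule L2_space_L1_bounded[OF Gi[OF e(2)]])
  note [measurable] = borel_measurable_integrable[OF Gi[OF e(2)]]
  have "(\<integral>\<^sup>+x. ennreal ((cmod (g x - 0))\<^sup>2) \<partial>lborel) \<le> 2 * (\<integral>\<^sup>+x. ennreal ((cmod (g x - ?G \<epsilon> x))\<^sup>2) \<partial>lborel)
      + 2 * (\<integral>\<^sup>+x. ennreal ((cmod (?G \<epsilon> x - 0))\<^sup>2) \<partial>lborel)"
    by (rule nn_integral_cmod_square_add) auto
  also have "\<dots> < \<infinity>"
    using e(1) GL2 by (auto simp: L2_space_iff norm_minus_commute ennreal_mult_less_top ennreal_add_less_top intro: less_trans)
  finally have "g \<in> L2_space" using g by (simp add: L2_space_iff)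
  then have "is_strong_riesz_deriv \<alpha> j f g"
    unfolding is_strong_riesz_deriv_def L2_tendsto_def using \<alpha> j \<open>f \<in> L2_space\<close> E
    by (simp add: riesz_trunc_def)
  then show ?thesis by blast
qed

text \<open>The definition of the transform uses cutoffs of g to [-R, R], while the information
  about g comes from truncations in \<epsilon>. Bessel's inequality compares the two families:
  \<epsilon> tends to 0 first with R fixed, then R tends to infinity.\<close>

lemma strong_riesz_deriv_fourier:
  assumes "is_strong_riesz_deriv \<alpha> j f g"
  shows "is_L2_fourier g F"
proof -
  have j: "\<alpha> < 2 * real j" and g: "g \<in> L2_space"
    using assms by (auto simp: is_strong_riesz_deriv_def)
  let ?G = "riesz_trunc \<alpha> j f"
  have lim: "((\<lambda>\<epsilon>. \<integral>\<^sup>+x. ennreal ((cmod (?G \<epsilon> x - g x))\<^sup>2) \<partial>lborel) \<longlongrightarrow> 0) (at_right 0)"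
    using assms unfolding is_strong_riesz_deriv_def L2_tendsto_def riesz_trunc_def by blast
  have [measurable]: "g \<in> borel_measurable borel" "F \<in> borel_measurable borel" using g F by (auto simp: L2_space_iff)
  define gR where "gR R u = indicator {-R..R} u *\<^sub>R g u" for R u
  have gRm [measurable]: "gR R \<in> borel_measurable borel" for R unfolding gR_def by measurable
  \<comment> \<open>On a bounded interval square integrability implies integrability, by comparison
    with 1 + |g|^2, so \<open>fourier\<close> of a cutoff is a genuine integral.\<close>
  have gR: "integrable lborel (gR R)" for R
  proof (rule Bochner_Integration.integrable_bound)
    show "integrable lborel (\<lambda>u. indicator {-R..R} u + (cmod (g u))\<^sup>2)"
      using g by (intro Bochner_Integration.integrable_add) (auto simp: L2_space_def emeasure_lborel_Icc_eq intro!: integrable_real_indicator)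
    have *: "cmod z \<le> 1 + (cmod z)\<^sup>2" for z
    proof -
      have "0 \<le> (cmod z - 1)\<^sup>2" by simp
      then show ?thesis unfolding power2_diff power_one mult_1_right using norm_ge_zero[of z] by linarith
    qed
    show "AE u in lborel. norm (gR R u) \<le> norm (indicator {-R..R} u + (cmod (g u))\<^sup>2)"
      by (intro AE_I2) (simp add: gR_def indicator_def *)
  qed measurable
  \<comment> \<open>The constant 4 comes from two uses of the squared triangle inequality: through
    the transform of a truncation, and then through g.\<close>
  have bound: "(\<integral>\<^sup>+v. ennreal ((cmod (fourier (gR R) v - F v))\<^sup>2) \<partial>lborel)
      \<le> 4 * (\<integral>\<^sup>+x. ennreal ((cmod (gR R x - g x))\<^sup>2) \<partial>lborel)" (is "?L \<le> 4 * ?N") for R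
  proof -
    note [measurable] = borel_measurable_fourier[OF gR]
    have "?L \<le> 2 * (2 * ?N + 2 * 0) + 2 * 0"
    proof (rule tendsto_lowerbound)
      show "((\<lambda>\<epsilon>. 2 * (2 * ?N + 2 * (\<integral>\<^sup>+x. ennreal ((cmod (?G \<epsilon> x - g x))\<^sup>2) \<partial>lborel))
          + 2 * (\<integral>\<^sup>+v. ennreal ((cmod (fourier (?G \<epsilon>) v - F v))\<^sup>2) \<partial>lborel)) \<longlongrightarrow> 2 * (2 * ?N + 2 * 0) + 2 * 0) (at_right 0)"
        by (intro tendsto_add ennreal_tendsto_cmult tendsto_const lim fourier_riesz_trunc_tendsto[OF j]) auto
      show "\<forall>\<^sub>F \<epsilon> in at_right 0. ?L \<le> 2 * (2 * ?N + 2 * (\<integral>\<^sup>+x. ennreal ((cmod (?G \<epsilon> x - g x))\<^sup>2) \<partial>lborel))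
          + 2 * (\<integral>\<^sup>+v. ennreal ((cmod (fourier (?G \<epsilon>) v - F v))\<^sup>2) \<partial>lborel)"
        using eventually_at_right_less[of 0]
      proof eventually_elim
        case (elim \<epsilon>)
        note G = integrable_riesz_trunc[OF \<alpha> j f elim]
        note [measurable] = borel_measurable_integrable[OF G] borel_measurable_fourier[OF G]
        have "?L \<le> 2 * (\<integral>\<^sup>+v. ennreal ((cmod (fourier (gR R) v - fourier (?G \<epsilon>) v))\<^sup>2) \<partial>lborel)
          + 2 * (\<integral>\<^sup>+v. ennreal ((cmod (fourier (?G \<epsilon>) v - F v))\<^sup>2) \<partial>lborel)"
          by (rule nn_integral_cmod_square_add) auto
        also have "(\<integral>\<^sup>+v. ennreal ((cmod (fourier (gR R) v - fourier (?G \<epsilon>) v))\<^sup>2) \<partial>lborel)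
           \<le> (\<integral>\<^sup>+x. ennreal ((cmod (gR R x - ?G \<epsilon> x))\<^sup>2) \<partial>lborel)"
          unfolding fourier_diff[OF gR G, symmetric]
          by (rule fourier_Bessel) (intro Bochner_Integration.integrable_diff gR G)
        also have "\<dots> \<le> 2 * ?N + 2 * (\<integral>\<^sup>+x. ennreal ((cmod (g x - ?G \<epsilon> x))\<^sup>2) \<partial>lborel)"
          by (rule nn_integral_cmod_square_add) auto
        finally show ?case by (simp add: norm_minus_commute add_right_mono mult_left_mono)
      qed
    qed auto
    also have "\<dots> = 4 * ?N" by (simp add: mult.assoc[symmetric])
    finally show ?thesis .
  qed
  have N0: "((\<lambda>R. \<integral>\<^sup>+x. ennreal ((cmod (gR R x - g x))\<^sup>2) \<partial>lborel) \<longlongrightarrow> 0) at_top"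
  proof (rule tendsto_at_topI_sequentially)
    fix X :: "nat \<Rightarrow> real" assume X: "filterlim X at_top sequentially"
    have "(\<lambda>i. \<integral>\<^sup>+x. ennreal ((cmod (gR (X i) x - g x))\<^sup>2) \<partial>lborel) \<longlonglongrightarrow> (\<integral>\<^sup>+x. 0 \<partial>(lborel :: real measure))"
    proof (rule nn_integral_dominated_convergence[where w="\<lambda>x. ennreal ((cmod (g x))\<^sup>2)"])
      show "AE x in lborel. ennreal ((cmod (gR (X i) x - g x))\<^sup>2) \<le> ennreal ((cmod (g x))\<^sup>2)" for i
        by (intro AE_I2 ennreal_leI) (auto simp: gR_def indicator_def)
      show "AE x in lborel. (\<lambda>i. ennreal ((cmod (gR (X i) x - g x))\<^sup>2)) \<longlonglongrightarrow> 0"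
      proof (intro AE_I2 tendsto_eventually)
        fix x
        have "eventually (\<lambda>i. \<bar>x\<bar> \<le> X i) sequentially" using X by (simp add: filterlim_at_top)
        then show "\<forall>\<^sub>F i in sequentially. ennreal ((cmod (gR (X i) x - g x))\<^sup>2) = 0"
          by eventually_elim (auto simp: gR_def indicator_def)
      qed
      show "(\<integral>\<^sup>+x. ennreal ((cmod (g x))\<^sup>2) \<partial>lborel) < \<infinity>" using g by (simp add: L2_space_iff)
    qed measurable
    then show "(\<lambda>i. \<integral>\<^sup>+x. ennreal ((cmod (gR (X i) x - g x))\<^sup>2) \<partial>lborel) \<longlonglongrightarrow> 0" by simp
  qed
  have "((\<lambda>R. \<integral>\<^sup>+v. ennreal ((cmod (fourier (gR R) v - F v))\<^sup>2) \<partial>lborel) \<longlongrightarrow> 0) at_top"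
  proof (rule tendsto_sandwich[OF _ _ tendsto_const])
    show "((\<lambda>R. 4 * (\<integral>\<^sup>+x. ennreal ((cmod (gR R x - g x))\<^sup>2) \<partial>lborel)) \<longlongrightarrow> 0) at_top"
      using ennreal_tendsto_cmult[OF _ N0, of 4] by simp
  qed (use bound in auto)
  then show ?thesis
    unfolding is_L2_fourier_def L2_tendsto_def using g F
    by (simp add: fourier_def gR_def set_lebesgue_integral_def)
qed

text \<open>The choice in \<open>strong_riesz_deriv\<close> also ranges over j, so it matters that
  the transform is F for every admissible j. An admissible j exists by the Archimedean
  property.\<close>

lemma fourier_Cb_strong_riesz_deriv:
  assumes Fb: "F \<in> bcontfun"
  shows "fourier_Cb (strong_riesz_deriv \<alpha> f) = F"
proof -
  obtain j :: nat where "\<alpha> < 2 * real j" using reals_Archimedean2[of "\<alpha> / 2"] by (auto simp: field_simps)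
  then have "\<exists>g j. is_strong_riesz_deriv \<alpha> j f g" using ex_strong_riesz_deriv by blast
  then have "\<exists>j. is_strong_riesz_deriv \<alpha> j f (strong_riesz_deriv \<alpha> f)"
    unfolding strong_riesz_deriv_def by (rule someI_ex)
  then have L2: "is_L2_fourier (strong_riesz_deriv \<alpha> f) F" using strong_riesz_deriv_fourier by blast
  show ?thesis unfolding fourier_Cb_def
  proof (rule the_equality)
    show "is_L2_fourier (strong_riesz_deriv \<alpha> f) F \<and> F \<in> bcontfun" using L2 Fb ..
    show "H = F" if "is_L2_fourier (strong_riesz_deriv \<alpha> f) H \<and> H \<in> bcontfun" for H
      using that by (intro is_L2_fourier_unique[OF _ L2 _ Fb]) blast+
  qed
qed

end

section \<open>Distance to the Bernstein space\<close>

lemma fourier_reflect: "fourier (\<lambda>t. f (- t)) v = fourier f (- v)"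
  unfolding fourier_cis
  by (subst lborel_integral_real_affine[where c="-1" and t=0]) auto

lemma fourier_dilate_modulate:
  assumes "\<delta> > 0"
  shows "fourier (\<lambda>t. complex_of_real \<delta> * f (\<delta> * t) * cis (a * t)) v = fourier f ((v - a) / \<delta>)"
proof -
  have "(LINT u|lborel. f u * cis (- (u * ((v - a) / \<delta>))))
      = \<delta> * (LINT u|lborel. f (\<delta> * u) * cis (- (\<delta> * u * ((v - a) / \<delta>))))"
    using assms by (subst lborel_integral_real_affine[where c=\<delta> and t=0]) (auto simp: scaleR_conv_of_real)
  also have "\<dots> = (LINT u|lborel. complex_of_real \<delta> * f (\<delta> * u) * cis (a * u) * cis (- (u * v)))"
    unfolding integral_mult_right_zero[symmetric]
  proof (intro Bochner_Integration.integral_cong refl)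
    fix u
    have "- (\<delta> * u * ((v - a) / \<delta>)) = a * u + - (u * v)" using assms by (simp add: field_simps)
    then show "complex_of_real \<delta> * (f (\<delta> * u) * cis (- (\<delta> * u * ((v - a) / \<delta>))))
      = complex_of_real \<delta> * f (\<delta> * u) * cis (a * u) * cis (- (u * v))"
      by (simp only: mult.assoc cis_mult)
  qed
  finally show ?thesis unfolding fourier_cis by simp
qed

text \<open>A hat in place of an indicator: its transform decays quadratically and is integrable, so
  by inversion the hat is itself the transform of an integrable function.\<close>

definition tri :: "real \<Rightarrow> real" where "tri v = max 0 (1 - \<bar>v\<bar>)"

lemma tri_bounds: "0 \<le> tri v" "tri v \<le> 1" by (auto simp: tri_def)

lemma tri_eq_0: "1 \<le> \<bar>v\<bar> \<Longrightarrow> tri v = 0" by (auto simp: tri_def)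

lemma measurable_tri [measurable]: "tri \<in> borel_measurable borel"
  unfolding tri_def by measurable

lemma cis_has_vector_derivative:
  "((\<lambda>v. cis (a * v)) has_vector_derivative complex_of_real a * \<i> * cis (a * v)) (at v within S)"
proof -
  have "((\<lambda>z. exp (\<i> * (complex_of_real a * z))) has_field_derivative
      complex_of_real a * \<i> * exp (\<i> * (complex_of_real a * complex_of_real v))) (at (complex_of_real v))"
    by (auto intro!: derivative_eq_intros)
  from has_vector_derivative_real_field[OF this, of S] show ?thesis by (simp add: cis_conv_exp)
qed

text \<open>An explicit antiderivative on [0, 1]; the half on [-1, 0] is the same computation with
  -t after a reflection, and adding the two leaves only the cosine.\<close>

lemma tri_has_fourier_integral:
  assumes t: "t \<noteq> 0"
  shows "has_bochner_integral lborel (\<lambda>v. complex_of_real (tri v) * cis (- (v * t))) (complex_of_real (2 * (1 - cos t) / t\<^sup>2))"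
proof -
  let ?F = "\<lambda>t v. complex_of_real (1 - v) * (\<i> / complex_of_real t) * cis (- t * v) - cis (- t * v) / (complex_of_real t)\<^sup>2"
  have half: "has_bochner_integral lborel (\<lambda>v. indicator {0..1} v *\<^sub>R (complex_of_real (1 - v) * cis (- t * v))) (?F t 1 - ?F t 0)"
    if t: "t \<noteq> 0" for t
  proof (rule has_bochner_integral_FTC_Icc)
    show "continuous_on {0..1} (\<lambda>v. complex_of_real (1 - v) * cis (- t * v))"
      by (intro continuous_intros)
    fix v :: real
    show "(?F t has_vector_derivative complex_of_real (1 - v) * cis (- t * v)) (at v within {0..1})"
      by (rule derivative_eq_intros cis_has_vector_derivative refl)+
        (use t in \<open>simp add: scaleR_conv_of_real field_simps power2_eq_square\<close>)
  qed simp
  have "has_bochner_integral lborel (\<lambda>v. indicator {0..1} (0 + (-1) * v) *\<^sub>R (complex_of_real (1 - (0 + (-1) * v)) * cis (- (- t) * (0 + (-1) * v))))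
      ((?F (- t) 1 - ?F (- t) 0) /\<^sub>R \<bar>-1\<bar>)"
    by (subst lborel_has_bochner_integral_real_affine_iff[symmetric, where c="-1" and t=0]) (use half[of "- t"] t in auto)
  from has_bochner_integral_add[OF half[OF t] this]
  have "has_bochner_integral lborel (\<lambda>v. indicator {0..1} v *\<^sub>R (complex_of_real (1 - v) * cis (- t * v))
       + indicator {0..1} (- v) *\<^sub>R (complex_of_real (1 + v) * cis (- t * v))) (?F t 1 - ?F t 0 + (?F (- t) 1 - ?F (- t) 0))"
    by simp
  also have "?F t 1 - ?F t 0 + (?F (- t) 1 - ?F (- t) 0) = complex_of_real (2 * (1 - cos t) / t\<^sup>2)"
    using t by (simp add: complex_eq_iff field_simps power2_eq_square Re_divide Im_divide)
  finally have *: "has_bochner_integral lborel (\<lambda>v. indicator {0..1} v *\<^sub>R (complex_of_real (1 - v) * cis (- t * v))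
       + indicator {0..1} (- v) *\<^sub>R (complex_of_real (1 + v) * cis (- t * v))) \<dots>" .
  \<comment> \<open>The two closed half intervals share the point 0, where the sum of the pieces is
    2 instead of 1.\<close>
  have "AE v in lborel. v \<noteq> (0::real)" by (rule AE_lborel_singleton)
  then have "AE v in lborel. indicator {0..1} v *\<^sub>R (complex_of_real (1 - v) * cis (- t * v))
       + indicator {0..1} (- v) *\<^sub>R (complex_of_real (1 + v) * cis (- t * v)) = complex_of_real (tri v) * cis (- (v * t))"
    by eventually_elim (auto simp: tri_def indicator_def max_def mult.commute)
  then show ?thesis using * by (subst (asm) has_bochner_integral_cong_AE) auto
qed

lemma integrable_tri: "integrable lborel (\<lambda>v. complex_of_real (tri v))"
  by (rule Bochner_Integration.integrable_bound[where f="indicator {-1..1} :: real \<Rightarrow> real"])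
    (auto simp: tri_def indicator_def emeasure_lborel_Icc_eq intro!: integrable_real_indicator)

lemma tri_bcontfun: "(\<lambda>v. complex_of_real (tri v)) \<in> bcontfun"
proof -
  have "continuous_on UNIV (\<lambda>v. complex_of_real (tri v))" unfolding tri_def by (intro continuous_intros)
  moreover have "bounded (range (\<lambda>v. complex_of_real (tri v)))"
    by (auto simp: bounded_iff tri_bounds intro!: exI[of _ 1])
  ultimately show ?thesis by (simp add: bcontfun_def)
qed

text \<open>Boundedness controls [-1, 1] and the power controls the rest. It serves the transform of
  the hat with exponent 2 and \<open>fourier f\<close> with exponent \<alpha>.\<close>

lemma integrable_power_decay:
  fixes g :: "real \<Rightarrow> complex"
  assumes [measurable]: "g \<in> borel_measurable borel" and B: "\<And>t. cmod (g t) \<le> B"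
    and \<alpha>: "\<alpha> > 1" and C: "\<And>t. t \<noteq> 0 \<Longrightarrow> cmod (g t) \<le> C * \<bar>t\<bar> powr (- \<alpha>)"
  shows "integrable lborel g"
proof -
  have 1: "integrable lborel (\<lambda>t. indicator {1..} t * t powr (- \<alpha>) :: real)"
    using \<alpha> by (intro set_integrable_powr_to_inf) auto
  from lborel_integrable_real_affine[OF this, of "-1" 0]
  have 2: "integrable lborel (\<lambda>t. indicator {1..} (- t) * (- t) powr (- \<alpha>) :: real)" by simp
  let ?w = "\<lambda>t. B * indicator {-1..1} t + C * (indicator {1..} t * t powr (- \<alpha>)) + C * (indicator {1..} (- t) * (- t) powr (- \<alpha>))"
  show ?thesis
  proof (rule Bochner_Integration.integrable_bound)
    show "integrable lborel ?w"
      using 1 2 by (auto intro!: integrable_real_indicator simp: emeasure_lborel_Icc_eq)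
    have C0: "0 \<le> C" using order_trans[OF norm_ge_zero C[of 1]] by simp
    have "cmod (g t) \<le> ?w t" for t
    proof (cases "\<bar>t\<bar> \<le> 1")
      case True
      then show ?thesis using B[of t] C0 by (auto simp: indicator_def intro!: add_increasing2)
    next
      case False
      then have "t \<noteq> 0" by auto
      then show ?thesis using C[of t] False by (cases "t > 0") (auto simp: indicator_def)
    qed
    then show "AE t in lborel. norm (g t) \<le> norm (?w t)"
      by (intro AE_I2) (metis abs_ge_self order_trans real_norm_def)
  qed measurable
qed

lemma integrable_fourier_tri: "integrable lborel (fourier (\<lambda>v. complex_of_real (tri v)))"
proof -
  obtain B where B: "\<And>t. cmod (fourier (\<lambda>v. complex_of_real (tri v)) t) \<le> B"
    using norm_fourier_le[OF integrable_tri] by blast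
  show ?thesis
  proof (rule integrable_power_decay[OF borel_measurable_fourier[OF integrable_tri] B])
    fix t :: real assume t: "t \<noteq> 0"
    have c: "0 \<le> 1 - cos t" "1 - cos t \<le> 2" using cos_ge_minus_one[of t] by (auto simp del: cos_ge_minus_one)
    have "1 \<le> sqrt (2 * pi)" using pi_gt3 by (subst real_le_rsqrt) auto
    then have "1 / sqrt (2 * pi) \<le> 1" by simp
    moreover have "2 * (1 - cos t) \<le> 4" using mult_left_mono[OF c(2), of 2] by simp
    then have "2 * (1 - cos t) / t\<^sup>2 \<le> 4 / t\<^sup>2"
      by (rule divide_right_mono) simp
    ultimately have "1 / sqrt (2 * pi) * (2 * (1 - cos t) / t\<^sup>2) \<le> 1 * (4 / t\<^sup>2)"
      by (rule mult_mono) (use c in simp_all)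
    moreover have "cmod (fourier (\<lambda>v. complex_of_real (tri v)) t) = 1 / sqrt (2 * pi) * (2 * (1 - cos t) / t\<^sup>2)"
      unfolding fourier_cis has_bochner_integral_integral_eq[OF tri_has_fourier_integral[OF t]] norm_mult norm_of_real
      using c by simp
    moreover have "\<bar>t\<bar> powr -2 = 1 / t\<^sup>2" using t by (simp add: powr_minus_divide)
    ultimately show "cmod (fourier (\<lambda>v. complex_of_real (tri v)) t) \<le> 4 * \<bar>t\<bar> powr -2" by simp
  qed simp
qed

text \<open>A partition of unity: only the two integers around x contribute, with weights that add
  up to 1. Beyond the ends of the range one or both of them are missing, which leaves an
  inequality.\<close>

lemma tri_sum:
  fixes n :: nat
  shows "(\<Sum>m\<in>{- int n..int n}. tri (x - of_int m)) \<le> 1"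
    and "\<bar>x\<bar> \<le> real n \<Longrightarrow> (\<Sum>m\<in>{- int n..int n}. tri (x - of_int m)) = 1"
proof -
  define p where "p = \<lfloor>x\<rfloor>"
  have p: "of_int p \<le> x" "x < of_int p + 1" unfolding p_def by linarith+
  have zero: "tri (x - of_int m) = 0" if "m \<notin> {p, p + 1}" for m
  proof (rule tri_eq_0)
    have "m \<le> p - 1 \<or> p + 2 \<le> m" using that by auto
    then have "(of_int m :: real) \<le> of_int p - 1 \<or> of_int p + 2 \<le> (of_int m :: real)" by linarith
    then show "1 \<le> \<bar>x - of_int m\<bar>" using p by linarith
  qed
  have two: "(\<Sum>m\<in>{p, p + 1}. tri (x - of_int m)) = 1"
    using p by (simp add: tri_def)
  have eq: "(\<Sum>m\<in>{- int n..int n}. tri (x - of_int m)) = (\<Sum>m\<in>{- int n..int n} \<inter> {p, p + 1}. tri (x - of_int m))"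
    by (rule sum.mono_neutral_right) (use zero in auto)
  show "(\<Sum>m\<in>{- int n..int n}. tri (x - of_int m)) \<le> 1"
    unfolding eq two[symmetric] by (rule sum_mono2) (auto simp: tri_bounds)
  assume x: "\<bar>x\<bar> \<le> real n"
  show "(\<Sum>m\<in>{- int n..int n}. tri (x - of_int m)) = 1"
    unfolding eq two[symmetric]
  proof (rule sum.mono_neutral_left)
    show "\<forall>m\<in>{p, p + 1} - {- int n..int n} \<inter> {p, p + 1}. tri (x - of_int m) = 0"
    proof
      fix m assume m: "m \<in> {p, p + 1} - {- int n..int n} \<inter> {p, p + 1}"
      have "- int n \<le> p" using x unfolding p_def by linarith
      moreover have "p \<le> int n" using x unfolding p_def by linarith
      \<comment> \<open>The only contributing node that can fall out of range is n + 1, and then x =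
        n, where its hat vanishes.\<close>
      ultimately have "p = int n" "m = p + 1" using m by auto
      then show "tri (x - of_int m) = 0" using x p by (intro tri_eq_0) auto
    qed
  qed auto
qed

text \<open>The reflection turns the transform of the hat into its inverse transform.\<close>

definition hat_transform :: "real \<Rightarrow> complex" where
  "hat_transform t = fourier (\<lambda>v. complex_of_real (tri v)) (- t)"

lemma integrable_hat_transform: "integrable lborel hat_transform"
  using lborel_integrable_real_affine[OF integrable_fourier_tri, of "-1" 0]
  by (simp add: hat_transform_def[abs_def])

lemma fourier_hat_transform: "fourier hat_transform v = complex_of_real (tri v)"
  unfolding hat_transform_def[abs_def] fourier_reflect
  by (rule fourier_inversion[OF integrable_tri tri_bcontfun integrable_fourier_tri])

text \<open>Piecewise linear interpolation at the nodes \<open>m * \<sigma> / (n + 1)\<close>, \<open>\<bar>m\<bar> \<le> n\<close>, stays inside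
  the Bernstein space because a hat function is the transform of an integrable function.\<close>

lemma bernstein1_hat_interpolation:
  fixes F :: "real \<Rightarrow> complex"
  assumes \<sigma>: "\<sigma> > 0"
  defines "\<delta> \<equiv> \<lambda>n. \<sigma> / real (Suc n)"
  shows "\<exists>h\<in>bernstein1 \<sigma>. \<forall>v. fourier h v = (\<Sum>m\<in>{- int n..int n}. F (of_int m * \<delta> n) * complex_of_real (tri (v / \<delta> n - of_int m)))"
proof -
  have d: "\<delta> n > 0" using \<sigma> by (simp add: \<delta>_def)
  define b where "b m t = complex_of_real (\<delta> n) * hat_transform (\<delta> n * t) * cis (of_int m * \<delta> n * t)" for m t
  have b: "integrable lborel (b m)" for m
    unfolding b_def using lborel_integrable_real_affine[OF integrable_hat_transform, of "\<delta> n" 0] d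
    by (intro integrable_mult_cis integrable_mult_right) auto
  have Fb: "fourier (b m) v = complex_of_real (tri (v / \<delta> n - of_int m))" for m v
    unfolding b_def[abs_def] fourier_dilate_modulate[OF d] fourier_hat_transform using d by (simp add: diff_divide_distrib)
  define h where "h t = (\<Sum>m\<in>{- int n..int n}. F (of_int m * \<delta> n) * b m t)" for t
  have Fh: "fourier h v = (\<Sum>m\<in>{- int n..int n}. F (of_int m * \<delta> n) * complex_of_real (tri (v / \<delta> n - of_int m)))" for v
    unfolding h_def[abs_def] by (subst fourier_sum) (auto simp: fourier_cmult Fb b)
  have "fourier h v = 0" if "v \<notin> {- \<sigma><..<\<sigma>}" for v
    unfolding Fh
  proof (intro sum.neutral ballI)
    fix m assume m: "m \<in> {- int n..int n}"
    have "\<sigma> = real (Suc n) * \<delta> n" by (simp add: \<delta>_def)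
    then have "real (Suc n) \<le> \<bar>v\<bar> / \<delta> n" using that d by (auto simp: field_simps abs_if)
    also have "\<dots> = \<bar>v / \<delta> n\<bar>" using d by simp
    finally have "1 \<le> \<bar>v / \<delta> n - of_int m\<bar>" using m by auto
    then show "F (of_int m * \<delta> n) * complex_of_real (tri (v / \<delta> n - of_int m)) = 0" by (simp add: tri_eq_0)
  qed
  moreover have "integrable lborel h" unfolding h_def[abs_def] using b by auto
  ultimately have "h \<in> bernstein1 \<sigma>" by (auto simp: bernstein1_def L1_space_def)
  with Fh show ?thesis by blast
qed

text \<open>The interpolation error at the nodes near v is at most e by uniform continuity. Between
  the last node and \<sigma> the hats sum to some P below 1, and the missing fraction 1 - P of
  \<open>F v\<close> is paid by S, since \<open>F v\<close> is within e of F at the end point; hence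
  \<open>S + 2 * e\<close>.\<close>

lemma bernstein1_approximation:
  fixes F :: "real \<Rightarrow> complex"
  assumes \<sigma>: "\<sigma> > 0" and cont: "continuous_on UNIV F" and S: "\<And>v. \<sigma> \<le> \<bar>v\<bar> \<Longrightarrow> cmod (F v) \<le> S" and e: "e > 0"
  obtains h where "h \<in> bernstein1 \<sigma>" "\<And>v. cmod (F v - fourier h v) \<le> S + 2 * e"
proof -
  have "uniformly_continuous_on {-\<sigma>..\<sigma>} F"
    by (intro compact_uniformly_continuous continuous_on_subset[OF cont]) auto
  then obtain d where d: "d > 0" "\<And>v w. v \<in> {-\<sigma>..\<sigma>} \<Longrightarrow> w \<in> {-\<sigma>..\<sigma>} \<Longrightarrow> \<bar>v - w\<bar> < d \<Longrightarrow> cmod (F v - F w) < e"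
    unfolding uniformly_continuous_on_def using e by (fastforce simp: dist_norm norm_minus_commute)
  obtain n where n: "\<sigma> / d < real n" using reals_Archimedean2 by blast
  define \<delta> where "\<delta> = \<sigma> / real (Suc n)"
  have \<delta>: "0 < \<delta>" "\<delta> < d" "\<sigma> = \<delta> * real n + \<delta>"
  proof -
    show "0 < \<delta>" "\<delta> < d" using \<sigma> n d(1) by (auto simp: \<delta>_def field_simps)
    have "\<sigma> = \<delta> * real (Suc n)" by (simp add: \<delta>_def)
    then show "\<sigma> = \<delta> * real n + \<delta>" by (simp add: algebra_simps)
  qed
  obtain h where h: "h \<in> bernstein1 \<sigma>"
    and Fh: "\<And>v. fourier h v = (\<Sum>m\<in>{- int n..int n}. F (of_int m * \<delta>) * complex_of_real (tri (v / \<delta> - of_int m)))"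
    using bernstein1_hat_interpolation[OF \<sigma>, where n=n and F=F] unfolding \<delta>_def by blast
  have S0: "0 \<le> S" using order_trans[OF norm_ge_zero S[of \<sigma>]] \<sigma> by simp
  have "cmod (F v - fourier h v) \<le> S + 2 * e" for v
  proof (cases "\<bar>v\<bar> < \<sigma>")
    case False
    then have "v \<notin> {- \<sigma><..<\<sigma>}" by auto
    then have "fourier h v = 0" using h by (simp add: bernstein1_def)
    then show ?thesis using S[of v] False e by simp
  next
    case True
    define w where "w m = tri (v / \<delta> - of_int m)" for m
    define P where "P = (\<Sum>m\<in>{- int n..int n}. w m)"
    have w0: "0 \<le> w m" for m by (simp add: w_def tri_bounds)
    have P: "P \<le> 1" "0 \<le> P" unfolding P_def by (auto simp: w_def tri_sum(1) tri_bounds intro: sum_nonneg)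
    \<comment> \<open>A weighted sum of increments of F plus the part of \<open>F v\<close> that the
      weights do not cover.\<close>
    have "F v - fourier h v = (\<Sum>m\<in>{- int n..int n}. (F v - F (of_int m * \<delta>)) * complex_of_real (w m)) + complex_of_real (1 - P) * F v"
      unfolding Fh P_def w_def by (simp add: algebra_simps sum_subtractf sum_distrib_left)
    also have "cmod \<dots> \<le> (\<Sum>m\<in>{- int n..int n}. cmod ((F v - F (of_int m * \<delta>)) * complex_of_real (w m))) + cmod (complex_of_real (1 - P) * F v)"
      by (intro norm_triangle_le add_mono norm_sum order_refl)
    also have "(\<Sum>m\<in>{- int n..int n}. cmod ((F v - F (of_int m * \<delta>)) * complex_of_real (w m))) \<le> (\<Sum>m\<in>{- int n..int n}. e * w m)"
    proof (rule sum_mono)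
      fix m assume m: "m \<in> {- int n..int n}"
      show "cmod ((F v - F (of_int m * \<delta>)) * complex_of_real (w m)) \<le> e * w m"
      proof (cases "\<bar>v / \<delta> - of_int m\<bar> < 1")
        case less: True
        have "\<bar>v - of_int m * \<delta>\<bar> = \<bar>v / \<delta> - of_int m\<bar> * \<delta>"
          using \<delta>(1) by (simp add: abs_mult[symmetric] field_simps flip: abs_of_pos)
        also have "\<dots> < 1 * \<delta>" using less \<delta>(1) by (intro mult_strict_right_mono) auto
        finally have "\<bar>v - of_int m * \<delta>\<bar> < d" using \<delta>(2) by simp
        moreover have "\<bar>of_int m * \<delta>\<bar> \<le> \<sigma>"
        proof -
          have "\<bar>of_int m\<bar> * \<delta> \<le> real n * \<delta>" using m \<delta>(1) by (intro mult_right_mono) auto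
          moreover have "\<sigma> = real n * \<delta> + \<delta>" using \<delta>(3) by (simp add: mult.commute)
          moreover have "\<bar>of_int m * \<delta>\<bar> = \<bar>of_int m\<bar> * \<delta>" using \<delta>(1) by (simp add: abs_mult)
          ultimately show ?thesis using \<delta>(1) by linarith
        qed
        ultimately have "cmod (F v - F (of_int m * \<delta>)) < e" using True by (intro d(2)) auto
        then show ?thesis using w0 by (simp add: norm_mult mult_right_mono)
      next
        case False
        then have "w m = 0" by (simp add: w_def tri_eq_0)
        then show ?thesis by simp
      qed
    qed
    also have "\<dots> = e * P" by (simp add: P_def sum_distrib_left)
    also have "cmod (complex_of_real (1 - P) * F v) \<le> S + e"
    proof (cases "\<bar>v\<bar> \<le> real n * \<delta>")
      case True
      then have "\<bar>v / \<delta>\<bar> \<le> real n" using \<delta>(1) by (simp add: field_simps)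
      then have "P = 1" unfolding P_def w_def by (rule tri_sum(2))
      then show ?thesis using S0 e by simp
    next
      case False
      \<comment> \<open>The end point on the side of v; the gap beyond the last node has width
        \<delta> < d.\<close>
      define s where "s = (if v \<ge> 0 then \<sigma> else - \<sigma>)"
      have "\<bar>v - s\<bar> < d" using False True \<delta> by (auto simp: s_def algebra_simps)
      then have "cmod (F v - F s) < e" using True \<sigma> by (intro d(2)) (auto simp: s_def)
      moreover have "cmod (F s) \<le> S" using \<sigma> by (intro S) (auto simp: s_def)
      ultimately have "cmod (F v) \<le> S + e" using norm_triangle_sub[of "F v" "F s"] by simp
      moreover have "cmod (complex_of_real (1 - P) * F v) \<le> 1 * cmod (F v)"
        unfolding norm_mult norm_of_real using P by (intro mult_right_mono) auto
      ultimately show ?thesis by simp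
    qed
    also have "e * P \<le> e * 1" using P e by (intro mult_left_mono) auto
    finally show ?thesis by simp
  qed
  with h show ?thesis by (rule that)
qed

section \<open>Distance to the Bernstein space as a supremum\<close>

context
  fixes g F :: "real \<Rightarrow> complex" and \<sigma> :: real
  assumes \<sigma>: "\<sigma> > 0" and F: "fourier_Cb g = F" "F \<in> bcontfun"
begin

text \<open>A real supremum is informative only for a bounded set; here both F and the transform of
  an integrable function are bounded.\<close>

lemma dist_inf_bdd: "h \<in> bernstein1 \<sigma> \<Longrightarrow> bdd_above (range (\<lambda>v. cmod (F v - fourier h v)))"
proof -
  assume "h \<in> bernstein1 \<sigma>"
  then have h: "integrable lborel h" by (simp add: bernstein1_def L1_space_def)
  obtain B where B: "\<And>x. cmod (F x) \<le> B" using F(2) unfolding bcontfun_def bounded_iff by auto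
  have "cmod (F v - fourier h v) \<le> B + 1 / sqrt (2 * pi) * (LINT u|lborel. cmod (h u))" for v
    by (rule order_trans[OF norm_triangle_ineq4 add_mono[OF B norm_fourier_le[OF h]]])
  then show ?thesis by (auto simp: bdd_above_def)
qed

lemma dist_inf_lower:
  assumes "\<sigma> \<le> \<bar>v\<bar>"
  shows "cmod (F v) \<le> dist_inf g \<sigma>"
  unfolding dist_inf_def F
proof (rule cINF_greatest)
  show "bernstein1 \<sigma> \<noteq> {}" using bernstein1_hat_interpolation[OF \<sigma>] by blast
  fix h assume h: "h \<in> bernstein1 \<sigma>"
  moreover have "v \<notin> {- \<sigma><..<\<sigma>}" using assms \<sigma> by auto
  ultimately have "fourier h v = 0" by (simp add: bernstein1_def)
  then show "cmod (F v) \<le> (SUP v. cmod (F v - fourier h v))"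
    using cSUP_upper[OF UNIV_I dist_inf_bdd[OF h], of v] by simp
qed

lemma dist_inf_upper:
  assumes S: "\<And>v. \<sigma> \<le> \<bar>v\<bar> \<Longrightarrow> cmod (F v) \<le> S"
  shows "dist_inf g \<sigma> \<le> S"
proof (rule field_le_epsilon)
  fix e :: real assume e: "e > 0"
  have "continuous_on UNIV F" using F(2) by (simp add: bcontfun_def)
  then obtain h where h: "h \<in> bernstein1 \<sigma>" "\<And>v. cmod (F v - fourier h v) \<le> S + 2 * (e / 2)"
    using bernstein1_approximation[where F=F and \<sigma>=\<sigma> and S=S and e="e / 2"] \<sigma> S e by (metis half_gt_zero)
  \<comment> \<open>The infimum over the Bernstein space likewise calls for a lower bound.\<close>
  have "bdd_below ((\<lambda>h. SUP v. cmod (F v - fourier h v)) ` bernstein1 \<sigma>)"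
  proof (rule bdd_belowI2)
    fix h assume "h \<in> bernstein1 \<sigma>"
    then have "cmod (F 0 - fourier h 0) \<le> (SUP v. cmod (F v - fourier h v))"
      by (intro cSUP_upper dist_inf_bdd) auto
    then show "0 \<le> (SUP v. cmod (F v - fourier h v))" using norm_ge_zero order_trans by blast
  qed
  then have "dist_inf g \<sigma> \<le> (SUP v. cmod (F v - fourier h v))"
    unfolding dist_inf_def F by (rule cINF_lower[OF _ h(1)])
  also have "\<dots> \<le> S + e" using h(2) by (intro cSUP_least) auto
  finally show "dist_inf g \<sigma> \<le> S + e" .
qed

end

section \<open>Fejer kernels and a Tauberian theorem\<close>

lemma sum_symmetric_Suc:
  fixes g :: "int \<Rightarrow> 'a::comm_monoid_add"
  shows "(\<Sum>k\<in>{- int (Suc n)..int (Suc n)}. g k) = (\<Sum>k\<in>{- int n..int n}. g k) + (g (int n + 1) + g (- (int n + 1)))"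
proof -
  have "{- int (Suc n)..int (Suc n)} = insert (int n + 1) (insert (- (int n + 1)) {- int n..int n})" by auto
  then show ?thesis by (simp add: ac_simps)
qed

text \<open>Pairing k + 1 with -(k + 1) turns symmetric partial sums into ordinary partial sums of a
  series over the naturals.\<close>

lemma sum_symmetric:
  fixes g :: "int \<Rightarrow> 'a::comm_monoid_add"
  shows "(\<Sum>k\<in>{- int n..int n}. g k) = g 0 + (\<Sum>k<n. g (int k + 1) + g (- (int k + 1)))"
proof (induction n)
  case (Suc n)
  then show ?case unfolding sum_symmetric_Suc by (simp add: add.assoc)
qed simp

text \<open>Half open, so that the translates by multiples of \<sigma> tile the line without
  overlap.\<close>

abbreviation cell :: "real \<Rightarrow> real set" where "cell \<sigma> \<equiv> {- (\<sigma> / 2)..<\<sigma> / 2}"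

lemma cells_indicator:
  assumes "\<sigma> > 0"
  shows "(\<Sum>m\<in>{- int M..int M}. indicator {(of_int m - 1 / 2) * \<sigma>..<(of_int m + 1 / 2) * \<sigma>} v :: real)
    = indicator {- ((real M + 1 / 2) * \<sigma>)..<(real M + 1 / 2) * \<sigma>} v"
proof (induction M)
  case (Suc M)
  define a where "a = real M * \<sigma>"
  have a: "0 \<le> a" using assms by (simp add: a_def)
  have e: "(of_int (int M + 1) - 1 / 2) * \<sigma> = a + \<sigma> / 2" "(of_int (int M + 1) + 1 / 2) * \<sigma> = a + 3 * \<sigma> / 2"
    "(of_int (- (int M + 1)) - 1 / 2) * \<sigma> = - (a + 3 * \<sigma> / 2)" "(of_int (- (int M + 1)) + 1 / 2) * \<sigma> = - (a + \<sigma> / 2)"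
    "(real M + 1 / 2) * \<sigma> = a + \<sigma> / 2" "(real (Suc M) + 1 / 2) * \<sigma> = a + 3 * \<sigma> / 2"
    by (simp_all add: a_def algebra_simps)
  show ?case unfolding sum_symmetric_Suc Suc e using assms a
    by (auto simp: indicator_def)
qed simp

lemma LINT_cell_shift:
  fixes G :: "real \<Rightarrow> 'a::{banach, second_countable_topology}"
  shows "(LINT v|lborel. indicator {(of_int m - 1 / 2) * \<sigma>..<(of_int m + 1 / 2) * \<sigma>} v *\<^sub>R G v)
    = (LINT w|lborel. indicator (cell \<sigma>) w *\<^sub>R G (w + of_int m * \<sigma>))"
proof -
  have "indicator {(of_int m - 1 / 2) * \<sigma>..<(of_int m + 1 / 2) * \<sigma>} (of_int m * \<sigma> + 1 * w) = (indicator (cell \<sigma>) w :: real)" for w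
    by (auto simp: indicator_def algebra_simps)
  then show ?thesis
    by (subst lborel_integral_real_affine[where c=1 and t="of_int m * \<sigma>"]) (auto simp: add.commute)
qed

lemma sum_LINT_cells:
  fixes G :: "real \<Rightarrow> 'a::{banach, second_countable_topology}"
  assumes G: "integrable lborel G" and \<sigma>: "\<sigma> > 0"
  shows "(\<Sum>m\<in>{- int M..int M}. LINT w|lborel. indicator (cell \<sigma>) w *\<^sub>R G (w + of_int m * \<sigma>))
     = (LINT v|lborel. indicator {- ((real M + 1 / 2) * \<sigma>)..<(real M + 1 / 2) * \<sigma>} v *\<^sub>R G v)"
  unfolding LINT_cell_shift[symmetric] cells_indicator[OF \<sigma>, symmetric] scaleR_sum_left
  by (rule Bochner_Integration.integral_sum[symmetric]) (intro integrable_mult_indicator G, simp)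

text \<open>Folding an integral over the line into integrals over one period: the partial sums are
  integrals over growing intervals, dominated by the norm of G.\<close>

lemma LINT_cells:
  fixes G :: "real \<Rightarrow> 'a::{banach, second_countable_topology}"
  assumes G: "integrable lborel G" and \<sigma>: "\<sigma> > 0"
  shows "(\<lambda>M. \<Sum>m\<in>{- int M..int M}. LINT w|lborel. indicator (cell \<sigma>) w *\<^sub>R G (w + of_int m * \<sigma>)) \<longlonglongrightarrow> (LINT v|lborel. G v)"
  unfolding sum_LINT_cells[OF assms]
proof (rule integral_dominated_convergence[where w="\<lambda>v. norm (G v)"])
  note [measurable] = borel_measurable_integrable[OF G]
  show "integrable lborel (\<lambda>v. norm (G v))" using G by simp
  show "AE v in lborel. (\<lambda>M. indicator {- ((real M + 1 / 2) * \<sigma>)..<(real M + 1 / 2) * \<sigma>} v *\<^sub>R G v) \<longlonglongrightarrow> G v"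
  proof (intro AE_I2 tendsto_eventually)
    fix v
    obtain n where n: "\<bar>v\<bar> / \<sigma> < real n" using reals_Archimedean2 by blast
    show "\<forall>\<^sub>F M in sequentially. indicator {- ((real M + 1 / 2) * \<sigma>)..<(real M + 1 / 2) * \<sigma>} v *\<^sub>R G v = G v"
      using eventually_ge_at_top[of n]
    proof eventually_elim
      case (elim M)
      have "\<bar>v\<bar> / \<sigma> < real M + 1 / 2" using n elim by linarith
      then have "\<bar>v\<bar> < (real M + 1 / 2) * \<sigma>" using \<sigma> by (simp add: divide_simps)
      then have "v \<in> {- ((real M + 1 / 2) * \<sigma>)..<(real M + 1 / 2) * \<sigma>}"
        unfolding atLeastLessThan_iff by linarith
      then show ?case by simp
    qed
  qed
  show "AE v in lborel. norm (indicator {- ((real M + 1 / 2) * \<sigma>)..<(real M + 1 / 2) * \<sigma>} v *\<^sub>R G v) \<le> norm (G v)" for M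
    by (intro AE_I2) (auto simp: indicator_def)
qed (use borel_measurable_integrable[OF G] in measurable)

lemma emeasure_cell_finite: "emeasure lborel (cell \<sigma>) < \<infinity>"
  by (intro emeasure_bounded_finite bounded_subset[OF bounded_closed_interval[of "- (\<sigma> / 2)" "\<sigma> / 2"]]) auto

lemma integrable_indicator_cell: "integrable lborel (indicator (cell \<sigma>) :: real \<Rightarrow> real)"
  by (rule integrable_real_indicator[OF _ emeasure_cell_finite]) simp

lemma integrable_cell_bounded:
  fixes \<psi> :: "real \<Rightarrow> 'a::{banach, second_countable_topology}"
  assumes [measurable]: "\<psi> \<in> borel_measurable borel" and B: "\<And>w. w \<in> cell \<sigma> \<Longrightarrow> norm (\<psi> w) \<le> B"
  shows "integrable lborel (\<lambda>w. indicator (cell \<sigma>) w *\<^sub>R \<psi> w)"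
proof (rule Bochner_Integration.integrable_bound[where f="\<lambda>w. \<bar>B\<bar> * indicator (cell \<sigma>) w"])
  show "integrable lborel (\<lambda>w. \<bar>B\<bar> * indicator (cell \<sigma>) w :: real)"
    by (intro integrable_mult_right integrable_indicator_cell)
  show "AE w in lborel. norm (indicator (cell \<sigma>) w *\<^sub>R \<psi> w) \<le> norm (\<bar>B\<bar> * indicator (cell \<sigma>) w)"
  proof (intro AE_I2)
    fix w show "norm (indicator (cell \<sigma>) w *\<^sub>R \<psi> w) \<le> norm (\<bar>B\<bar> * indicator (cell \<sigma>) w)"
      using B[of w] by (cases "w \<in> cell \<sigma>") auto
  qed
qed measurable

text \<open>Orthogonality of the exponentials of period \<sigma>: for nonzero k the antiderivative
  takes equal values at the two ends.\<close>

lemma LINT_cell_cis: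
  assumes \<sigma>: "\<sigma> > 0"
  shows "(LINT v|lborel. indicator (cell \<sigma>) v *\<^sub>R cis (of_int k * (2 * pi / \<sigma>) * v)) = (if k = 0 then complex_of_real \<sigma> else 0)"
proof -
  \<comment> \<open>The fundamental theorem is applied on the closed interval; the added right end
    point is a null set.\<close>
  have "AE v in lborel. v \<noteq> \<sigma> / 2" by (rule AE_lborel_singleton)
  then have "AE v in lborel. indicator (cell \<sigma>) v *\<^sub>R cis (of_int k * (2 * pi / \<sigma>) * v)
      = indicator {- (\<sigma> / 2)..\<sigma> / 2} v *\<^sub>R cis (of_int k * (2 * pi / \<sigma>) * v)"
    by eventually_elim (auto simp: indicator_def)
  then have eq: "(LINT v|lborel. indicator (cell \<sigma>) v *\<^sub>R cis (of_int k * (2 * pi / \<sigma>) * v))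
      = (LINT v|lborel. indicator {- (\<sigma> / 2)..\<sigma> / 2} v *\<^sub>R cis (of_int k * (2 * pi / \<sigma>) * v))"
    by (intro integral_cong_AE) measurable
  show ?thesis
  proof (cases "k = 0")
    case True
    then show ?thesis unfolding eq using \<sigma>
      by (simp add: scaleR_conv_of_real measure_def emeasure_lborel_Icc_eq)
  next
    case False
    let ?a = "of_int k * (2 * pi / \<sigma>)"
    have a: "?a \<noteq> 0" using False \<sigma> by simp
    have "(LINT v|lborel. indicator {- (\<sigma> / 2)..\<sigma> / 2} v *\<^sub>R cis (?a * v))
       = cis (?a * (\<sigma> / 2)) / (complex_of_real ?a * \<i>) - cis (?a * - (\<sigma> / 2)) / (complex_of_real ?a * \<i>)"
    proof (rule integral_FTC_Icc)
      fix v :: real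
      have "((\<lambda>v. cis (?a * v) / (complex_of_real ?a * \<i>)) has_vector_derivative (complex_of_real ?a * \<i> * cis (?a * v)) / (complex_of_real ?a * \<i>)) (at v within {- (\<sigma> / 2)..\<sigma> / 2})"
        by (intro has_vector_derivative_divide cis_has_vector_derivative)
      then show "((\<lambda>v. cis (?a * v) / (complex_of_real ?a * \<i>)) has_vector_derivative cis (?a * v)) (at v within {- (\<sigma> / 2)..\<sigma> / 2})"
        using a by (simp del: of_real_mult of_real_divide)
    qed (use \<sigma> in \<open>auto intro!: continuous_intros\<close>)
    also have "cis (?a * (\<sigma> / 2)) = cis (?a * - (\<sigma> / 2)) * cis (2 * pi * of_int k)"
      unfolding cis_mult using \<sigma> by (simp add: field_simps)
    also have "cis (2 * pi * of_int k) = 1" by (rule cis_multiple_2pi) simp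
    finally show ?thesis unfolding eq using False by simp
  qed
qed

text \<open>The average of the first N Dirichlet kernels, written as a square to make nonnegativity
  evident. It is 0 for N = 0, hence the index \<open>Suc N\<close> in the limits.\<close>

definition fejer :: "nat \<Rightarrow> real \<Rightarrow> real" where
  "fejer N x = (cmod (\<Sum>k<N. cis (real k * x)))\<^sup>2 / real N"

lemma measurable_fejer [measurable]: "fejer N \<in> borel_measurable borel"
  unfolding fejer_def by measurable

lemma fejer_nonneg: "0 \<le> fejer N x" by (simp add: fejer_def)

lemma fejer_le: "fejer N x \<le> real N"
proof -
  have "cmod (\<Sum>k<N. cis (real k * x)) \<le> (\<Sum>k<N. cmod (cis (real k * x)))" by (rule norm_sum)
  then have "(cmod (\<Sum>k<N. cis (real k * x)))\<^sup>2 \<le> (real N)\<^sup>2" by (intro power_mono) auto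
  then show ?thesis by (simp add: fejer_def power2_eq_square divide_le_eq)
qed

lemma fejer_periodic: "fejer N (x + 2 * pi * of_int m) = fejer N x"
proof -
  have "cis (real k * (x + 2 * pi * of_int m)) = cis (real k * x)" for k
  proof -
    have "cis (real k * (x + 2 * pi * of_int m)) = cis (real k * x) * cis (2 * pi * of_int (int k * m))"
      by (simp add: cis_mult algebra_simps)
    also have "cis (2 * pi * of_int (int k * m)) = 1" by (rule cis_multiple_2pi) simp
    finally show ?thesis by simp
  qed
  then show ?thesis by (simp add: fejer_def)
qed

text \<open>In the induction step the new term z adds z * cnj z = 1 and two cross terms with the old
  sum, which together form the Dirichlet kernel of order N.\<close>

lemma sum_Dirichlet_kernels:
  "(\<Sum>n<N. \<Sum>k\<in>{- int n..int n}. cis (of_int k * x)) = complex_of_real ((cmod (\<Sum>k<N. cis (real k * x)))\<^sup>2)"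
proof (induction N)
  case (Suc N)
  let ?S = "\<Sum>k<N. cis (real k * x)" and ?z = "cis (real N * x)"
  have "complex_of_real ((cmod (\<Sum>k<Suc N. cis (real k * x)))\<^sup>2) = (?S + ?z) * cnj (?S + ?z)"
    unfolding complex_norm_square by simp
  also have "\<dots> = ?S * cnj ?S + (?z * cnj ?z + (?z * cnj ?S + ?S * cnj ?z))" by (simp add: algebra_simps)
  also have "?z * cnj ?z = 1" by (simp add: cis_cnj cis_mult)
  also have "?z * cnj ?S = (\<Sum>k<N. cis ((real N - real k) * x))"
    by (simp add: sum_distrib_left cis_cnj cis_mult algebra_simps)
  \<comment> \<open>Summation in reverse order, with N - 1 - k in place of k.\<close>
  also have "\<dots> = (\<Sum>k<N. cis ((real k + 1) * x))"
    by (subst sum.nat_diff_reindex[symmetric]) (auto intro!: sum.cong simp: of_nat_diff)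
  also have "?S * cnj ?z = (\<Sum>k<N. cis (- ((real N - real k) * x)))"
    unfolding sum_distrib_right by (intro sum.cong refl) (simp add: cis_cnj cis_mult algebra_simps)
  also have "\<dots> = (\<Sum>k<N. cis (- ((real k + 1) * x)))"
    by (subst sum.nat_diff_reindex[symmetric]) (auto intro!: sum.cong simp: of_nat_diff)
  also have "1 + ((\<Sum>k<N. cis ((real k + 1) * x)) + (\<Sum>k<N. cis (- ((real k + 1) * x)))) = (\<Sum>k\<in>{- int N..int N}. cis (of_int k * x))"
    unfolding sum_symmetric by (simp add: sum.distrib algebra_simps)
  also have "?S * cnj ?S = complex_of_real ((cmod ?S)\<^sup>2)" by (rule complex_norm_square[symmetric])
  finally show ?case using Suc by simp
qed simp

text \<open>Geometric sum. The product form avoids division by \<open>1 - cis x\<close>, which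
  vanishes at multiples of the period.\<close>

lemma fejer_away_from_0: "fejer N x * (cmod (1 - cis x))\<^sup>2 \<le> 4 / real N"
proof -
  have "(1 - cis x) * (\<Sum>k<N. cis (real k * x)) = 1 - cis x ^ N"
    using one_diff_power_eq[of "cis x" N, symmetric] by (simp only: Complex.DeMoivre)
  then have "cmod (1 - cis x) * cmod (\<Sum>k<N. cis (real k * x)) = cmod (1 - cis x ^ N)"
    by (metis norm_mult)
  also have "\<dots> \<le> 2" using norm_triangle_ineq4[of 1 "cis x ^ N"] by (simp add: norm_power)
  finally have "(cmod (1 - cis x) * cmod (\<Sum>k<N. cis (real k * x)))\<^sup>2 \<le> 2\<^sup>2" by (intro power_mono) auto
  then show ?thesis by (simp add: fejer_def power_mult_distrib mult.commute divide_right_mono)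
qed

text \<open>By orthogonality every Dirichlet kernel contributes only its constant term.\<close>

lemma LINT_cell_fejer:
  assumes \<sigma>: "\<sigma> > 0" and N: "N > 0"
  shows "(LINT v|lborel. indicator (cell \<sigma>) v *\<^sub>R fejer N (2 * pi / \<sigma> * v)) = \<sigma>"
proof -
  let ?h = "2 * pi / \<sigma>"
  have i: "integrable lborel (\<lambda>v. indicator (cell \<sigma>) v *\<^sub>R cis (of_int k * ?h * v))" for k
    by (rule integrable_cell_bounded[where B=1]) auto
  have "complex_of_real (LINT v|lborel. indicator (cell \<sigma>) v *\<^sub>R fejer N (?h * v))
     = (LINT v|lborel. (\<Sum>n<N. \<Sum>k\<in>{- int n..int n}. indicator (cell \<sigma>) v *\<^sub>R cis (of_int k * ?h * v)) / of_nat N)"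
    unfolding integral_complex_of_real[symmetric] scaleR_sum_right[symmetric]
    using sum_Dirichlet_kernels[of "?h * _" N]
    by (intro Bochner_Integration.integral_cong refl) (simp add: fejer_def mult.assoc scaleR_conv_of_real)
  also have "\<dots> = (\<Sum>n<N. \<Sum>k\<in>{- int n..int n}. (LINT v|lborel. indicator (cell \<sigma>) v *\<^sub>R cis (of_int k * ?h * v))) / of_nat N"
    by (simp only: Bochner_Integration.integral_divide_zero Bochner_Integration.integral_sum Bochner_Integration.integrable_sum i)
  also have "\<dots> = complex_of_real \<sigma>"
    unfolding LINT_cell_cis[OF \<sigma>] using N by (simp add: sum.delta)
  finally show ?thesis by (simp only: of_real_eq_iff)
qed

text \<open>The constant K may depend on e: away from 0 the Fejer kernel leaves an error of order
  1/n whose constant grows as the neighbourhood of 0 shrinks.\<close>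

lemma tendsto_from_error_bound:
  fixes a :: "nat \<Rightarrow> 'a::real_normed_vector"
  assumes "\<And>e. e > 0 \<Longrightarrow> \<exists>K. \<forall>n. norm (a n - L) \<le> e + K / real (Suc n)"
  shows "a \<longlonglongrightarrow> L"
proof (rule LIMSEQ_I)
  fix r :: real assume r: "r > 0"
  obtain K where K: "\<And>n. norm (a n - L) \<le> r / 2 + K / real (Suc n)" using assms[of "r / 2"] r by auto
  have "(\<lambda>n. K / real (Suc n)) \<longlonglongrightarrow> 0" using LIMSEQ_Suc[OF lim_const_over_n[of K]] .
  then have "eventually (\<lambda>n. K / real (Suc n) < r / 2) sequentially" using r by (intro order_tendstoD) auto
  then obtain n0 where n0: "\<And>n. n \<ge> n0 \<Longrightarrow> K / real (Suc n) < r / 2" unfolding eventually_sequentially by auto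
  have "norm (a n - L) < r" if "n \<ge> n0" for n
    using K[of n] n0[OF that] by linarith
  then show "\<exists>no. \<forall>n\<ge>no. norm (a n - L) < r" by blast
qed

text \<open>The kernel is nonnegative with fixed mass \<sigma>, so the bound is uniform in N; it
  becomes the majorant for exchanging the limit with the sum over cells.\<close>

lemma LINT_cell_fejer_bound:
  fixes \<psi> :: "real \<Rightarrow> complex"
  assumes \<sigma>: "\<sigma> > 0" and N: "N > 0" and [measurable]: "\<psi> \<in> borel_measurable borel"
    and B: "\<And>w. w \<in> cell \<sigma> \<Longrightarrow> cmod (\<psi> w) \<le> B"
  shows "cmod (LINT w|lborel. indicator (cell \<sigma>) w *\<^sub>R (\<psi> w * complex_of_real (fejer N (2 * pi / \<sigma> * w)))) \<le> B * \<sigma>"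
proof -
  let ?k = "\<lambda>w. fejer N (2 * pi / \<sigma> * w)"
  have ki: "integrable lborel (\<lambda>w. indicator (cell \<sigma>) w *\<^sub>R ?k w)"
    by (rule integrable_cell_bounded[where B="real N"]) (auto simp: fejer_nonneg fejer_le)
  have "cmod (LINT w|lborel. indicator (cell \<sigma>) w *\<^sub>R (\<psi> w * complex_of_real (?k w)))
      \<le> (LINT w|lborel. cmod (indicator (cell \<sigma>) w *\<^sub>R (\<psi> w * complex_of_real (?k w))))"
    by (rule integral_norm_bound)
  also have "\<dots> \<le> (LINT w|lborel. B * (indicator (cell \<sigma>) w *\<^sub>R ?k w))"
  proof (rule integral_mono')
    show "integrable lborel (\<lambda>w. B * (indicator (cell \<sigma>) w *\<^sub>R ?k w))" using ki by (intro integrable_mult_right)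
    fix w
    show *: "cmod (indicator (cell \<sigma>) w *\<^sub>R (\<psi> w * complex_of_real (?k w))) \<le> B * (indicator (cell \<sigma>) w *\<^sub>R ?k w)"
      using mult_right_mono[OF B[of w] fejer_nonneg[of N "2 * pi / \<sigma> * w"]]
      by (cases "w \<in> cell \<sigma>") (simp_all add: norm_mult fejer_nonneg del: atLeastLessThan_iff)
    show "0 \<le> B * (indicator (cell \<sigma>) w *\<^sub>R ?k w)" by (rule order_trans[OF norm_ge_zero *])
  qed
  also have "\<dots> = B * \<sigma>" using LINT_cell_fejer[OF \<sigma> N] by simp
  finally show ?thesis .
qed

lemma cmod_1_minus_cis: "(cmod (1 - cis x))\<^sup>2 = 2 - 2 * cos x"
proof -
  have "(cmod (1 - cis x))\<^sup>2 = 1 - 2 * cos x + ((sin x)\<^sup>2 + (cos x)\<^sup>2)"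
    by (simp add: cmod_power2 power2_diff)
  then show ?thesis by simp
qed

text \<open>Continuity handles small w and \<open>fejer_away_from_0\<close> the rest; the fact
  \<open>pw\<close> combines both in one pointwise majorant, which is integrated against the
  kernel.\<close>

lemma fejer_approximate_identity:
  fixes \<psi> :: "real \<Rightarrow> complex"
  assumes \<sigma>: "\<sigma> > 0" and [measurable]: "\<psi> \<in> borel_measurable borel"
    and B: "\<And>w. w \<in> cell \<sigma> \<Longrightarrow> cmod (\<psi> w) \<le> B" and ct: "isCont \<psi> 0"
  shows "(\<lambda>N. LINT w|lborel. indicator (cell \<sigma>) w *\<^sub>R (\<psi> w * complex_of_real (fejer (Suc N) (2 * pi / \<sigma> * w))))
    \<longlonglongrightarrow> complex_of_real \<sigma> * \<psi> 0"
proof (rule tendsto_from_error_bound)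
  fix e0 :: real assume e0: "e0 > 0"
  define e where "e = e0 / \<sigma>"
  have e: "e > 0" using e0 \<sigma> by (simp add: e_def)
  let ?h = "2 * pi / \<sigma>"
  let ?k = "\<lambda>N w. fejer (Suc N) (?h * w)"
  have B0: "0 \<le> B" using order_trans[OF norm_ge_zero B[of 0]] \<sigma> by simp
  obtain d where d: "d > 0" "\<And>w. \<bar>w\<bar> < d \<Longrightarrow> cmod (\<psi> w - \<psi> 0) < e"
    using ct e unfolding continuous_at_eps_delta by (auto simp: dist_norm)
  define d' where "d' = min d (\<sigma> / 2)"
  have d': "0 < d'" "d' \<le> d" "d' \<le> \<sigma> / 2" using d(1) \<sigma> by (auto simp: d'_def)
  \<comment> \<open>Keeps the argument in [0, pi], where the cosine decreases, so that
    \<open>1 - cis\<close> is bounded away from 0 outside the neighbourhood.\<close>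
  have hd: "0 < ?h * d'" "?h * d' \<le> pi" using d' \<sigma> by (auto simp: divide_simps)
  define c where "c = 2 - 2 * cos (?h * d')"
  have c: "c > 0" using cos_monotone_0_pi[of 0 "?h * d'"] hd by (simp add: c_def)
  \<comment> \<open>Makes \<open>K * c\<close> equal to 2B, the trivial bound for the difference of
    two values of \<psi>.\<close>
  define K where "K = 2 * B / c"
  have K0: "0 \<le> K" using B0 c by (simp add: K_def)
  have pw: "cmod (\<psi> w - \<psi> 0) \<le> e + K * (cmod (1 - cis (?h * w)))\<^sup>2" if w: "w \<in> cell \<sigma>" for w
  proof (cases "\<bar>w\<bar> < d'")
    case True
    then have "cmod (\<psi> w - \<psi> 0) \<le> e" using d(2)[of w] d' by simp
    then show ?thesis using K0 by (simp add: add_increasing2)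
  next
    case False
    have "?h * d' \<le> ?h * \<bar>w\<bar>" using False \<sigma> by (intro mult_left_mono) auto
    moreover have "?h * \<bar>w\<bar> \<le> pi" using w \<sigma> by (auto simp: divide_simps)
    ultimately have "cos (?h * \<bar>w\<bar>) \<le> cos (?h * d')" using hd by (intro cos_monotone_0_pi_le) auto
    moreover have "cos (?h * \<bar>w\<bar>) = cos (?h * w)" by (cases "w \<ge> 0") auto
    ultimately have "c \<le> (cmod (1 - cis (?h * w)))\<^sup>2" unfolding c_def cmod_1_minus_cis by simp
    then have "K * c \<le> K * (cmod (1 - cis (?h * w)))\<^sup>2" using K0 by (rule mult_left_mono)
    moreover have "cmod (\<psi> w - \<psi> 0) \<le> B + B" using \<sigma> w by (intro order_trans[OF norm_triangle_ineq4 add_mono] B) auto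
    moreover have "K * c = B + B" using c by (simp add: K_def)
    ultimately show ?thesis using e by linarith
  qed
  have ki: "integrable lborel (\<lambda>w. indicator (cell \<sigma>) w *\<^sub>R ?k N w)" for N
    by (rule integrable_cell_bounded[where B="real (Suc N)"]) (auto simp: fejer_nonneg fejer_le simp del: of_nat_Suc)
  have bound: "cmod ((LINT w|lborel. indicator (cell \<sigma>) w *\<^sub>R (\<psi> w * complex_of_real (?k N w))) - complex_of_real \<sigma> * \<psi> 0)
      \<le> e0 + (K * 4 * \<sigma>) / real (Suc N)" for N
  proof -
    let ?T = "4 / real (Suc N)"
    have i1: "integrable lborel (\<lambda>w. indicator (cell \<sigma>) w *\<^sub>R (\<psi> w * complex_of_real (?k N w)))"
    proof (rule integrable_cell_bounded[where B="B * real (Suc N)"])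
      show "norm (\<psi> w * complex_of_real (?k N w)) \<le> B * real (Suc N)" if "w \<in> cell \<sigma>" for w
        unfolding norm_mult norm_of_real abs_of_nonneg[OF fejer_nonneg]
        by (intro mult_mono B that fejer_le B0 fejer_nonneg)
    qed measurable
    have i2: "integrable lborel (\<lambda>w. e * (indicator (cell \<sigma>) w *\<^sub>R ?k N w) + K * ?T * indicator (cell \<sigma>) w)"
      using ki[of N] integrable_indicator_cell[of \<sigma>]
      by (rule Bochner_Integration.integrable_add[OF integrable_mult_right integrable_mult_right])
    have pw2: "cmod (indicator (cell \<sigma>) w *\<^sub>R ((\<psi> w - \<psi> 0) * complex_of_real (?k N w)))
        \<le> e * (indicator (cell \<sigma>) w *\<^sub>R ?k N w) + K * ?T * indicator (cell \<sigma>) w" for w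
    proof (cases "w \<in> cell \<sigma>")
      case True
      have "cmod (\<psi> w - \<psi> 0) * ?k N w \<le> (e + K * (cmod (1 - cis (?h * w)))\<^sup>2) * ?k N w"
        by (rule mult_right_mono[OF pw[OF True] fejer_nonneg])
      also have "\<dots> = e * ?k N w + K * (?k N w * (cmod (1 - cis (?h * w)))\<^sup>2)" by (simp only: ring_distribs mult_ac)
      also have "\<dots> \<le> e * ?k N w + K * ?T"
        by (rule add_left_mono[OF mult_left_mono[OF fejer_away_from_0 K0]])
      also have "cmod (\<psi> w - \<psi> 0) * ?k N w = cmod (indicator (cell \<sigma>) w *\<^sub>R ((\<psi> w - \<psi> 0) * complex_of_real (?k N w)))"
        unfolding norm_scaleR norm_mult norm_of_real abs_of_nonneg[OF fejer_nonneg] using True by simp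
      finally show ?thesis using True by simp
    qed simp
    have "complex_of_real \<sigma> * \<psi> 0 = complex_of_real (LINT w|lborel. indicator (cell \<sigma>) w *\<^sub>R ?k N w) * \<psi> 0"
      unfolding LINT_cell_fejer[OF \<sigma> zero_less_Suc] ..
    also have "\<dots> = (LINT w|lborel. complex_of_real (indicator (cell \<sigma>) w *\<^sub>R ?k N w) * \<psi> 0)"
      by (simp only: integral_complex_of_real integral_mult_left_zero)
    finally have "(LINT w|lborel. indicator (cell \<sigma>) w *\<^sub>R (\<psi> w * complex_of_real (?k N w))) - complex_of_real \<sigma> * \<psi> 0
       = (LINT w|lborel. indicator (cell \<sigma>) w *\<^sub>R (\<psi> w * complex_of_real (?k N w)) - complex_of_real (indicator (cell \<sigma>) w *\<^sub>R ?k N w) * \<psi> 0)"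
      using i1 ki by (simp del: of_real_mult add: Bochner_Integration.integral_diff)
    also have "\<dots> = (LINT w|lborel. indicator (cell \<sigma>) w *\<^sub>R ((\<psi> w - \<psi> 0) * complex_of_real (?k N w)))"
      by (intro Bochner_Integration.integral_cong refl) (simp add: scaleR_conv_of_real algebra_simps)
    finally have eq: "(LINT w|lborel. indicator (cell \<sigma>) w *\<^sub>R (\<psi> w * complex_of_real (?k N w))) - complex_of_real \<sigma> * \<psi> 0
      = (LINT w|lborel. indicator (cell \<sigma>) w *\<^sub>R ((\<psi> w - \<psi> 0) * complex_of_real (?k N w)))" .
    have "cmod (LINT w|lborel. indicator (cell \<sigma>) w *\<^sub>R ((\<psi> w - \<psi> 0) * complex_of_real (?k N w))) \<le> (LINT w|lborel. cmod (indicator (cell \<sigma>) w *\<^sub>R ((\<psi> w - \<psi> 0) * complex_of_real (?k N w))))"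
      by (rule integral_norm_bound)
    also have "\<dots> \<le> (LINT w|lborel. e * (indicator (cell \<sigma>) w *\<^sub>R ?k N w) + K * ?T * indicator (cell \<sigma>) w)"
    proof (rule integral_mono'[OF i2])
      show "cmod (indicator (cell \<sigma>) w *\<^sub>R ((\<psi> w - \<psi> 0) * complex_of_real (?k N w)))
          \<le> e * (indicator (cell \<sigma>) w *\<^sub>R ?k N w) + K * ?T * indicator (cell \<sigma>) w" for w
        by (rule pw2)
      then show "0 \<le> e * (indicator (cell \<sigma>) w *\<^sub>R ?k N w) + K * ?T * indicator (cell \<sigma>) w" for w
        by (rule order_trans[OF norm_ge_zero])
    qed
    also have "\<dots> = (LINT w|lborel. e * (indicator (cell \<sigma>) w *\<^sub>R ?k N w)) + (LINT w|lborel. K * ?T * indicator (cell \<sigma>) w)"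
      by (intro Bochner_Integration.integral_add integrable_mult_right ki integrable_indicator_cell)
    also have "\<dots> = e * \<sigma> + K * ?T * \<sigma>"
      using \<sigma> LINT_cell_fejer[OF \<sigma> zero_less_Suc[of N]] by simp
    also have "\<dots> = e0 + (K * 4 * \<sigma>) / real (Suc N)" using \<sigma> by (simp add: e_def)
    finally show ?thesis unfolding eq .
  qed
  show "\<exists>K'. \<forall>N. cmod ((LINT w|lborel. indicator (cell \<sigma>) w *\<^sub>R (\<psi> w * complex_of_real (?k N w))) - complex_of_real \<sigma> * \<psi> 0) \<le> e0 + K' / real (Suc N)"
    using bound by blast
qed

text \<open>Schmidt's slow oscillation condition, used through the delayed means over \<open>{n..<n + m}\<close> with \<open>m\<close>
  proportional to \<open>n\<close>.\<close>

lemma tauberian_slow_oscillation: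
  fixes s :: "nat \<Rightarrow> complex"
  assumes C: "(\<lambda>N. (\<Sum>n<Suc N. s n) / of_nat (Suc N)) \<longlonglongrightarrow> L"
    and osc: "\<And>e. e > 0 \<Longrightarrow> \<exists>p>0. \<exists>n0. \<forall>n\<ge>n0. \<forall>j\<ge>n. real j < real n + p * real n \<longrightarrow> cmod (s j - s n) \<le> e"
  shows "s \<longlonglongrightarrow> L"
proof (rule LIMSEQ_I)
  fix r :: real assume r: "r > 0"
  obtain p n0 where p: "p > 0" and n0: "\<And>n j. n \<ge> n0 \<Longrightarrow> j \<ge> n \<Longrightarrow> real j < real n + p * real n \<Longrightarrow> cmod (s j - s n) \<le> r / 3"
    using osc[of "r / 3"] r by auto
  \<comment> \<open>Chosen so that \<open>(2 / p + 1) * \<eta>\<close> is r / 3; the first factor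
    bounds (2n + m) / m for the block length m below.\<close>
  define \<eta> where "\<eta> = r / 3 / (2 / p + 1)"
  have \<eta>: "\<eta> > 0" using r p by (simp add: \<eta>_def add_pos_pos)
  define A where "A N = (\<Sum>n<N. s n)" for N
  obtain n1 where n1: "\<And>N. N \<ge> n1 \<Longrightarrow> cmod (A (Suc N) / of_nat (Suc N) - L) < \<eta>"
    using LIMSEQ_D[OF C \<eta>] unfolding A_def by blast
  have AL: "cmod (A N - of_nat N * L) \<le> real N * \<eta>" if "N > n1" for N
  proof -
    define M where "M = N - 1"
    have M: "N = Suc M" "M \<ge> n1" using that by (auto simp: M_def)
    have "A N - of_nat N * L = of_nat N * (A (Suc M) / of_nat (Suc M) - L)"
      using M by (simp add: field_simps del: of_nat_Suc)
    then show ?thesis using n1[OF M(2)] by (simp add: norm_mult mult_left_mono less_imp_le del: of_nat_Suc)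
  qed
  have "cmod (s n - L) < r" if n: "n > n0" "n > n1" for n
  proof -
    \<comment> \<open>Rounded up so that m \<ge> p * n, while every index below n + m still
      satisfies the strict inequality of the oscillation condition.\<close>
    define m where "m = nat \<lceil>p * real n\<rceil>"
    have pn: "p * real n > 0" using p n by simp
    have m1: "p * real n \<le> real m" "real m < p * real n + 1" using pn unfolding m_def by linarith+
    have m0: "real m > 0" using m1 pn by linarith
    \<comment> \<open>\<open>s n\<close> is recovered from the block of m terms starting at n: the
      block sum is a difference of two values of A, and its terms differ little from
      \<open>s n\<close>.\<close>
    have "of_nat m * (s n - L) = (A (n + m) - of_nat (n + m) * L) - (A n - of_nat n * L) - (\<Sum>j=n..<n + m. s j - s n)"
    proof -
      have "A (n + m) = A n + (\<Sum>j=n..<n + m. s j)"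
        unfolding A_def by (simp add: lessThan_atLeast0 sum.atLeastLessThan_concat)
      then show ?thesis by (simp add: sum_subtractf algebra_simps)
    qed
    also have "cmod \<dots> \<le> real (n + m) * \<eta> + real n * \<eta> + (\<Sum>j=n..<n + m. r / 3)"
    proof (rule norm_triangle_le_diff[OF add_mono[OF norm_triangle_le_diff[OF add_mono]]])
      show "cmod (\<Sum>j=n..<n + m. s j - s n) \<le> (\<Sum>j=n..<n + m. r / 3)"
      proof (rule order_trans[OF norm_sum sum_mono])
        fix j assume j: "j \<in> {n..<n + m}"
        then have "real (j + 1) \<le> real (n + m)" by (subst of_nat_le_iff) auto
        then show "cmod (s j - s n) \<le> r / 3" using j n m1 by (intro n0) auto
      qed
    qed (use n in \<open>auto intro: AL simp del: of_nat_add\<close>)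
    also have "\<dots> = (2 * real n + real m) * \<eta> + real m * (r / 3)" by (simp add: algebra_simps)
    also have "\<dots> \<le> real m * ((2 / p + 1) * \<eta>) + real m * (r / 3)"
    proof -
      have "real n \<le> real m / p" using m1(1) p by (simp add: field_simps)
      then have "2 * real n + real m \<le> 2 * (real m / p) + real m" by linarith
      also have "\<dots> = real m * (2 / p + 1)" by (simp add: algebra_simps)
      finally have "2 * real n + real m \<le> real m * (2 / p + 1)" .
      then show ?thesis using \<eta> by (simp add: mult_right_mono mult.assoc[symmetric])
    qed
    also have "(2 / p + 1) * \<eta> = r / 3"
    proof -
      have cancel: "q * (r / 3 / q) = r / 3" if "q > 0" for q :: real using that by simp
      have "2 / p + 1 > 0" using p by (simp add: add_pos_pos)
      then show ?thesis unfolding \<eta>_def by (rule cancel)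
    qed
    finally have "real m * cmod (s n - L) \<le> real m * (2 * (r / 3))"
      unfolding norm_mult norm_of_nat by linarith
    then have "cmod (s n - L) \<le> 2 * (r / 3)" using m0 by simp
    then show ?thesis using r by linarith
  qed
  then show "\<exists>no. \<forall>n\<ge>no. norm (s n - L) < r" by (intro exI[of _ "Suc (max n0 n1)"]) auto
qed

section \<open>Cesaro means of samples\<close>

lemma LINT_cell_fejer_shift:
  assumes "\<sigma> > 0"
  shows "fejer N (2 * pi / \<sigma> * (w + of_int m * \<sigma>)) = fejer N (2 * pi / \<sigma> * w)"
proof -
  have "2 * pi / \<sigma> * (w + of_int m * \<sigma>) = 2 * pi / \<sigma> * w + 2 * pi * of_int m"
    using assms by (simp add: field_simps)
  then show ?thesis by (simp only: fejer_periodic)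
qed

text \<open>The half is the half width of a cell: points of the cell around (k + 1) * \<sigma> have
  modulus at least (k + 1/2) * \<sigma>.\<close>

lemma summable_shifted_powr:
  assumes "\<alpha> > (1::real)"
  shows "summable (\<lambda>k. (real k + 1 / 2) powr (- \<alpha>))"
proof (rule summable_comparison_test'[where N=1])
  show "summable (\<lambda>k. real k powr (- \<alpha>))" using assms by (simp add: summable_real_powr_iff)
  show "norm ((real k + 1 / 2) powr (- \<alpha>)) \<le> real k powr (- \<alpha>)" if "k \<ge> 1" for k
    using that assms by (auto intro!: powr_mono2')
qed

context
  fixes \<alpha> \<sigma> C :: real and f :: "real \<Rightarrow> complex"
  assumes \<alpha>: "\<alpha> > 1" and \<sigma>: "\<sigma> > 0" and f: "integrable lborel f" and fb: "f \<in> bcontfun" and Ff: "integrable lborel (fourier f)"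
    and decay: "\<And>v. v \<noteq> 0 \<Longrightarrow> cmod (fourier f v) \<le> C * \<bar>v\<bar> powr (- \<alpha>)"
begin

text \<open>Inversion writes each sample as an integral of \<open>fourier f\<close> against an
  exponential; the averaged exponentials add up to the Fejer kernel.\<close>

lemma Cesaro_samples_eq:
  "(\<Sum>n<Suc N. \<Sum>k\<in>{- int n..int n}. f (\<tau> + 2 * pi / \<sigma> * of_int k)) / of_nat (Suc N)
    = complex_of_real (1 / sqrt (2 * pi)) *
      (LINT v|lborel. fourier f v * cis (\<tau> * v) * complex_of_real (fejer (Suc N) (2 * pi / \<sigma> * v)))"
proof -
  note [measurable] = borel_measurable_integrable[OF Ff]
  let ?h = "2 * pi / \<sigma>" and ?c = "complex_of_real (1 / sqrt (2 * pi))"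
  let ?g = "\<lambda>k v. fourier f v * cis (\<tau> * v) * cis (of_int k * (?h * v))"
  have gi: "integrable lborel (?g k)" for k
    by (intro integrable_mult_cis Ff) measurable
  have fk: "f (\<tau> + ?h * of_int k) = ?c * (LINT v|lborel. ?g k v)" for k
  proof -
    have "f (\<tau> + ?h * of_int k) = fourier (fourier f) (- (\<tau> + ?h * of_int k))"
      by (rule fourier_inversion[OF f fb Ff, symmetric])
    also have "\<dots> = ?c * (LINT v|lborel. ?g k v)"
      unfolding fourier_cis[of "fourier f"] mult.assoc cis_mult
      by (intro arg_cong[where f="\<lambda>z. ?c * z"] Bochner_Integration.integral_cong refl) (simp add: algebra_simps)
    finally show ?thesis .
  qed
  have "(\<Sum>n<Suc N. \<Sum>k\<in>{- int n..int n}. f (\<tau> + ?h * of_int k))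
      = ?c * (\<Sum>n<Suc N. \<Sum>k\<in>{- int n..int n}. LINT v|lborel. ?g k v)"
    unfolding fk sum_distrib_left ..
  also have "(\<Sum>n<Suc N. \<Sum>k\<in>{- int n..int n}. LINT v|lborel. ?g k v)
      = (LINT v|lborel. (\<Sum>n<Suc N. \<Sum>k\<in>{- int n..int n}. ?g k v))"
    by (simp only: Bochner_Integration.integral_sum Bochner_Integration.integrable_sum gi)
  also have "\<dots> = (LINT v|lborel. of_nat (Suc N) * (fourier f v * cis (\<tau> * v) * complex_of_real (fejer (Suc N) (?h * v))))"
    unfolding sum_distrib_left[symmetric] sum_Dirichlet_kernels
    by (intro Bochner_Integration.integral_cong refl) (simp add: fejer_def del: of_nat_Suc)
  also have "\<dots> = of_nat (Suc N) * (LINT v|lborel. fourier f v * cis (\<tau> * v) * complex_of_real (fejer (Suc N) (?h * v)))"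
    by (rule integral_mult_right_zero)
  finally show ?thesis by (simp del: of_nat_Suc)
qed

text \<open>After folding, the kernel is the same on every cell and acts as an approximate identity
  at the multiples of \<sigma>. Tannery's theorem exchanges this limit with the sum over cells, by
  the decay of \<open>fourier f\<close>.\<close>

lemma Cesaro_samples_tendsto:
  "(\<lambda>N. (\<Sum>n<Suc N. \<Sum>k\<in>{- int n..int n}. f (\<tau> + 2 * pi / \<sigma> * of_int k)) / of_nat (Suc N))
    \<longlonglongrightarrow> complex_of_real (\<sigma> / sqrt (2 * pi)) * (fourier f 0 +
      (\<Sum>k. fourier f ((real k + 1) * \<sigma>) * cis (\<tau> * ((real k + 1) * \<sigma>)) + fourier f (- ((real k + 1) * \<sigma>)) * cis (- (\<tau> * ((real k + 1) * \<sigma>)))))"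
proof -
  note [measurable] = borel_measurable_integrable[OF Ff]
  let ?h = "2 * pi / \<sigma>"
  define \<phi> where "\<phi> v = fourier f v * cis (\<tau> * v)" for v
  have [measurable]: "\<phi> \<in> borel_measurable borel" unfolding \<phi>_def by measurable
  have \<phi>i: "integrable lborel \<phi>" unfolding \<phi>_def by (intro integrable_mult_cis Ff) measurable
  have n\<phi>: "cmod (\<phi> v) = cmod (fourier f v)" for v by (simp add: \<phi>_def norm_mult)
  have ct: "continuous_on UNIV \<phi>"
    unfolding \<phi>_def using continuous_on_fourier[OF f] by (intro continuous_intros)
  obtain B where B: "\<And>v. cmod (fourier f v) \<le> B" using norm_fourier_le[OF f] by blast
  \<comment> \<open>Contribution of the cell around m * \<sigma>; periodicity lets the kernel be
    evaluated at the offset w.\<close>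
  define c where "c m N = (LINT w|lborel. indicator (cell \<sigma>) w *\<^sub>R (\<phi> (w + of_int m * \<sigma>) * complex_of_real (fejer (Suc N) (?h * w))))" for m N
  define I where "I N = (LINT v|lborel. \<phi> v * complex_of_real (fejer (Suc N) (?h * v)))" for N
  have "(\<lambda>M. \<Sum>m\<in>{- int M..int M}. c m N) \<longlonglongrightarrow> I N" for N
  proof -
    have "integrable lborel (\<lambda>v. \<phi> v * complex_of_real (fejer (Suc N) (?h * v)))"
      by (rule integrable_mult_bounded[where B="real (Suc N)"]) (use \<phi>i in \<open>auto simp: fejer_nonneg fejer_le simp del: of_nat_Suc\<close>)
    from LINT_cells[OF this \<sigma>] show ?thesis
      unfolding c_def I_def LINT_cell_fejer_shift[OF \<sigma>] .
  qed
  then have lims: "(\<lambda>M. c 0 N + (\<Sum>k<M. c (int k + 1) N + c (- (int k + 1)) N)) \<longlonglongrightarrow> I N" for N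
    unfolding sum_symmetric .
  have sums: "(\<lambda>k. c (int k + 1) N + c (- (int k + 1)) N) sums (I N - c 0 N)" for N
    using tendsto_diff[OF lims[of N] tendsto_const[of "c 0 N"]] by (simp add: sums_def)
  have clim: "c m \<longlonglongrightarrow> complex_of_real \<sigma> * \<phi> (of_int m * \<sigma>)" for m
  proof -
    have "continuous_on UNIV (\<lambda>w. \<phi> (w + of_int m * \<sigma>))"
      by (rule continuous_on_compose2[OF ct]) (auto intro!: continuous_intros)
    then have "isCont (\<lambda>w. \<phi> (w + of_int m * \<sigma>)) 0"
      by (simp add: continuous_on_eq_continuous_at)
    from fejer_approximate_identity[OF \<sigma> _ _ this, of B] B show ?thesis
      unfolding c_def by (simp add: n\<phi>)
  qed
  \<comment> \<open>Both cells stay at distance at least (k + 1/2) * \<sigma> from 0, and the mass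
    of the kernel on a cell is \<sigma>.\<close>
  have bound: "cmod (c (int k + 1) N + c (- (int k + 1)) N) \<le> 2 * (C * ((real k + 1 / 2) * \<sigma>) powr (- \<alpha>) * \<sigma>)" for k N
  proof -
    have *: "cmod (c m N) \<le> C * ((real k + 1 / 2) * \<sigma>) powr (- \<alpha>) * \<sigma>" if m: "\<bar>m\<bar> = int k + 1" for m
      unfolding c_def
    proof (rule LINT_cell_fejer_bound[OF \<sigma> zero_less_Suc])
      fix w assume w: "w \<in> cell \<sigma>"
      have "\<bar>real_of_int m\<bar> = real k + 1" using m by (metis of_int_abs of_int_add of_int_of_nat_eq of_int_1)
      then have "\<bar>of_int m * \<sigma>\<bar> = (real k + 1) * \<sigma>" using \<sigma> by (simp add: abs_mult)
      moreover have "\<bar>w\<bar> \<le> \<sigma> / 2" using w by auto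
      ultimately have "(real k + 1) * \<sigma> - \<sigma> / 2 \<le> \<bar>w + of_int m * \<sigma>\<bar>" by linarith
      then have ge: "(real k + 1 / 2) * \<sigma> \<le> \<bar>w + of_int m * \<sigma>\<bar>" by (simp add: algebra_simps)
      have pos: "(real k + 1 / 2) * \<sigma> > 0" using \<sigma> by (simp add: add_nonneg_pos)
      have C0: "0 \<le> C" using order_trans[OF norm_ge_zero decay[of 1]] by simp
      have "cmod (\<phi> (w + of_int m * \<sigma>)) \<le> C * \<bar>w + of_int m * \<sigma>\<bar> powr (- \<alpha>)"
        unfolding n\<phi> using ge pos by (intro decay) auto
      also have "\<dots> \<le> C * ((real k + 1 / 2) * \<sigma>) powr (- \<alpha>)"
        using ge pos \<alpha> by (intro mult_left_mono powr_mono2' C0) auto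
      finally show "cmod (\<phi> (w + of_int m * \<sigma>)) \<le> C * ((real k + 1 / 2) * \<sigma>) powr (- \<alpha>)" .
    qed measurable
    show ?thesis using norm_triangle_ineq[of "c (int k + 1) N" "c (- (int k + 1)) N"] *[of "int k + 1"] *[of "- (int k + 1)"] by simp
  qed
  have "(\<lambda>N. \<Sum>k. c (int k + 1) N + c (- (int k + 1)) N) \<longlonglongrightarrow>
      (\<Sum>k. complex_of_real \<sigma> * \<phi> (of_int (int k + 1) * \<sigma>) + complex_of_real \<sigma> * \<phi> (of_int (- (int k + 1)) * \<sigma>))"
  proof (rule tannerys_theorem[THEN conjunct2, THEN conjunct2])
    show "(\<lambda>N. c (int k + 1) N + c (- (int k + 1)) N) \<longlonglongrightarrow> complex_of_real \<sigma> * \<phi> (of_int (int k + 1) * \<sigma>) + complex_of_real \<sigma> * \<phi> (of_int (- (int k + 1)) * \<sigma>)" for k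
      by (intro tendsto_add clim)
    show "\<forall>\<^sub>F (k, N) in at_top \<times>\<^sub>F sequentially. norm (c (int k + 1) N + c (- (int k + 1)) N) \<le> 2 * (C * ((real k + 1 / 2) * \<sigma>) powr (- \<alpha>) * \<sigma>)"
      using bound by (intro always_eventually) auto
    have "summable (\<lambda>k. 2 * C * \<sigma> * \<sigma> powr (- \<alpha>) * (real k + 1 / 2) powr (- \<alpha>))"
      by (intro summable_mult summable_shifted_powr \<alpha>)
    then show "summable (\<lambda>k. 2 * (C * ((real k + 1 / 2) * \<sigma>) powr (- \<alpha>) * \<sigma>))"
      by (simp add: powr_mult mult_ac)
  qed simp
  \<comment> \<open>The cell around 0 is kept apart, since the decay bound says nothing at frequency
    0.\<close>
  then have "(\<lambda>N. (I N - c 0 N) + c 0 N) \<longlonglongrightarrow>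
      (\<Sum>k. complex_of_real \<sigma> * \<phi> (of_int (int k + 1) * \<sigma>) + complex_of_real \<sigma> * \<phi> (of_int (- (int k + 1)) * \<sigma>)) + complex_of_real \<sigma> * \<phi> (of_int 0 * \<sigma>)"
    unfolding sums_unique[OF sums, symmetric] by (intro tendsto_add clim)
  then have lim: "I \<longlonglongrightarrow> complex_of_real \<sigma> * fourier f 0 +
      (\<Sum>k. complex_of_real \<sigma> * (\<phi> ((real k + 1) * \<sigma>) + \<phi> (- ((real k + 1) * \<sigma>))))"
    by (simp add: \<phi>_def[of 0] add.commute distrib_left minus_mult_left[symmetric] del: minus_add_distrib)
  have "summable (\<lambda>k. \<phi> ((real k + 1) * \<sigma>) + \<phi> (- ((real k + 1) * \<sigma>)))"
  proof (rule summable_comparison_test'[where N=0])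
    show "summable (\<lambda>k. 2 * C * \<sigma> powr (- \<alpha>) * (real k + 1 / 2) powr (- \<alpha>))"
      by (intro summable_mult summable_shifted_powr \<alpha>)
    fix k :: nat
    have C0: "0 \<le> C" using order_trans[OF norm_ge_zero decay[of 1]] by simp
    have k0: "(real k + 1) * \<sigma> > 0" using \<sigma> by (simp add: add_nonneg_pos)
    have le0: "C * ((real k + 1) * \<sigma>) powr (- \<alpha>) \<le> C * ((real k + 1 / 2) * \<sigma>) powr (- \<alpha>)"
      using \<sigma> \<alpha> by (intro mult_left_mono powr_mono2' C0) (auto intro!: mult_pos_pos add_nonneg_pos)
    have le: "cmod (\<phi> v) \<le> C * ((real k + 1 / 2) * \<sigma>) powr (- \<alpha>)" if "\<bar>v\<bar> = (real k + 1) * \<sigma>" for v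
    proof -
      have "v \<noteq> 0" using that k0 by auto
      then show ?thesis using order_trans[OF decay[of v]] le0 unfolding that n\<phi> by blast
    qed
    have "cmod (\<phi> ((real k + 1) * \<sigma>) + \<phi> (- ((real k + 1) * \<sigma>))) \<le> C * ((real k + 1 / 2) * \<sigma>) powr (- \<alpha>) + C * ((real k + 1 / 2) * \<sigma>) powr (- \<alpha>)"
      by (intro norm_triangle_mono le) (use \<sigma> in \<open>simp_all add: abs_mult\<close>)
    then show "norm (\<phi> ((real k + 1) * \<sigma>) + \<phi> (- ((real k + 1) * \<sigma>))) \<le> 2 * C * \<sigma> powr (- \<alpha>) * (real k + 1 / 2) powr (- \<alpha>)"
      by (simp add: powr_mult mult_ac)
  qed
  then have "(\<Sum>k. complex_of_real \<sigma> * (\<phi> ((real k + 1) * \<sigma>) + \<phi> (- ((real k + 1) * \<sigma>))))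
     = complex_of_real \<sigma> * (\<Sum>k. \<phi> ((real k + 1) * \<sigma>) + \<phi> (- ((real k + 1) * \<sigma>)))"
    by (rule suminf_mult)
  with lim have "I \<longlonglongrightarrow> complex_of_real \<sigma> * (fourier f 0 + (\<Sum>k. \<phi> ((real k + 1) * \<sigma>) + \<phi> (- ((real k + 1) * \<sigma>))))"
    by (simp only: distrib_left)
  from tendsto_mult_left[OF this, of "complex_of_real (1 / sqrt (2 * pi))"] show ?thesis
    unfolding Cesaro_samples_eq I_def \<phi>_def by (simp add: mult.assoc)
qed

end

section \<open>Bounded variation: increments, decay and summable samples\<close>

lemma BV_interlacing_sum:
  fixes f :: "real \<Rightarrow> complex" and a b :: "int \<Rightarrow> real"
  assumes M: "\<And>(x :: nat \<Rightarrow> real) n. mono x \<Longrightarrow> (\<Sum>i<n. cmod (f (x (Suc i)) - f (x i))) \<le> M"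
    and ab: "\<And>k. a k \<le> b k" "\<And>k. b k \<le> a (k + 1)"
  shows "(\<Sum>k\<in>{- int N..int N}. cmod (f (b k) - f (a k))) \<le> M"
proof -
  \<comment> \<open>Even positions carry a, odd positions b, shifted by N: interlacing merges both
    families into one monotone sequence, and the increments from b to the next a are nonnegative
    extras.\<close>
  define x where "x i = (if even i then a (int (i div 2) - int N) else b (int (i div 2) - int N))" for i :: nat
  have x: "x (2 * i) = a (int i - int N)" "x (Suc (2 * i)) = b (int i - int N)" for i by (auto simp: x_def)
  have "mono x"
  proof (rule incseq_SucI)
    fix i
    obtain m where "i = 2 * m \<or> i = Suc (2 * m)" using oddE evenE by (metis Suc_eq_plus1)
    then show "x i \<le> x (Suc i)"
    proof
      assume "i = 2 * m" then show ?thesis using ab(1) by (simp add: x)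
    next
      assume i: "i = Suc (2 * m)"
      have "x (Suc i) = a (int m - int N + 1)" using x(1)[of "Suc m"] i by (simp add: algebra_simps)
      then show ?thesis using ab(2) i by (simp add: x)
    qed
  qed
  then have le: "(\<Sum>i<2 * n. cmod (f (x (Suc i)) - f (x i))) \<le> M" for n by (rule M)
  have half: "(\<Sum>i<n. cmod (f (b (int i - int N)) - f (a (int i - int N)))) \<le> (\<Sum>i<2 * n. cmod (f (x (Suc i)) - f (x i)))" for n
    by (induction n) (auto simp: x add_increasing2 intro: add_increasing2 order_trans)
  have "(\<Sum>k\<in>{- int N..int N}. cmod (f (b k) - f (a k))) = (\<Sum>i<2 * N + 1. cmod (f (b (int i - int N)) - f (a (int i - int N))))"
    by (rule sum.reindex_bij_witness[of _ "\<lambda>i. int i - int N" "\<lambda>k. nat (k + int N)"]) auto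
  also have "\<dots> \<le> M" using half le by (rule order_trans)
  finally show ?thesis .
qed

text \<open>For a fixed offset w the points w + m * \<delta> are monotone in m, so the sum over the
  cells is at most M pointwise; integrating over one cell contributes its length \<delta>.\<close>

lemma BV_translation_integral:
  fixes g :: "real \<Rightarrow> complex"
  assumes g: "integrable lborel g" and d: "\<delta> > 0"
    and M: "\<And>(x :: nat \<Rightarrow> real) n. mono x \<Longrightarrow> (\<Sum>i<n. cmod (g (x (Suc i)) - g (x i))) \<le> M"
  shows "(LINT v|lborel. cmod (g (v + \<delta>) - g v)) \<le> \<delta> * M"
proof -
  have gd: "integrable lborel (\<lambda>v. g (v + \<delta>))"
    using lborel_integrable_real_affine[OF g, of 1 \<delta>] by (simp add: add.commute)
  let ?G = "\<lambda>v. cmod (g (v + \<delta>) - g v)"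
  have G: "integrable lborel ?G" using g gd by (intro integrable_norm Bochner_Integration.integrable_diff)
  have Gm: "integrable lborel (\<lambda>w. ?G (w + of_int m * \<delta>))" for m
    using lborel_integrable_real_affine[OF G, of 1 "of_int m * \<delta>"] by (simp add: add.commute)
  have "(\<Sum>m\<in>{- int N..int N}. LINT w|lborel. indicator (cell \<delta>) w *\<^sub>R ?G (w + of_int m * \<delta>)) \<le> \<delta> * M" for N
  proof -
    have i: "integrable lborel (\<lambda>w. indicator (cell \<delta>) w *\<^sub>R ?G (w + of_int m * \<delta>))" for m
      by (intro integrable_mult_indicator Gm) simp
    have "(\<Sum>m\<in>{- int N..int N}. LINT w|lborel. indicator (cell \<delta>) w *\<^sub>R ?G (w + of_int m * \<delta>))
       = (LINT w|lborel. (\<Sum>m\<in>{- int N..int N}. indicator (cell \<delta>) w *\<^sub>R ?G (w + of_int m * \<delta>)))"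
      by (simp only: Bochner_Integration.integral_sum i)
    also have "\<dots> \<le> (LINT w|lborel. M * indicator (cell \<delta>) w)"
    proof (rule integral_mono)
      show "integrable lborel (\<lambda>w. \<Sum>m\<in>{- int N..int N}. indicator (cell \<delta>) w *\<^sub>R ?G (w + of_int m * \<delta>))"
        by (intro Bochner_Integration.integrable_sum i)
      show "integrable lborel (\<lambda>w. M * indicator (cell \<delta>) w)" using integrable_indicator_cell by (rule integrable_mult_right)
      fix w
      have "(\<Sum>m\<in>{- int N..int N}. ?G (w + of_int m * \<delta>)) \<le> M"
        by (rule BV_interlacing_sum[OF M]) (use d in \<open>auto simp: algebra_simps\<close>)
      then show "(\<Sum>m\<in>{- int N..int N}. indicator (cell \<delta>) w *\<^sub>R ?G (w + of_int m * \<delta>)) \<le> M * indicator (cell \<delta>) w"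
        by (cases "w \<in> cell \<delta>") auto
    qed
    also have "\<dots> = \<delta> * M" using d by simp
    finally show ?thesis .
  qed
  then show ?thesis by (intro LIMSEQ_le_const2[OF LINT_cells[OF G d]]) auto
qed

text \<open>Averaging the inversion integral with its translate by half a period of the exponential.\<close>

lemma BV_transform_decay:
  fixes f :: "real \<Rightarrow> complex"
  assumes f: "integrable lborel f" "f \<in> bcontfun" and Ff: "integrable lborel (fourier f)" and BV: "fourier f \<in> BV_space"
  obtains K where "\<And>t. t \<noteq> 0 \<Longrightarrow> cmod (f t) \<le> K / \<bar>t\<bar>"
proof -
  obtain M where M: "\<And>(x :: nat \<Rightarrow> real) n. mono x \<Longrightarrow> (\<Sum>i<n. cmod (fourier f (x (Suc i)) - fourier f (x i))) \<le> M"
    using BV unfolding BV_space_def by blast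
  have "cmod (f t) \<le> (1 / sqrt (2 * pi) * (pi * M)) / \<bar>t\<bar>" if t: "t \<noteq> 0" for t
  proof -
    \<comment> \<open>Makes \<open>cis (\<delta> * t)\<close> equal to -1, so the transform of the
      increment doubles \<open>f t\<close> instead of cancelling it.\<close>
    define \<delta> where "\<delta> = pi / \<bar>t\<bar>"
    have d: "\<delta> > 0" using t by (simp add: \<delta>_def)
    have Fd: "integrable lborel (\<lambda>v. fourier f (v + \<delta>))"
      using lborel_integrable_real_affine[OF Ff, of 1 \<delta>] by (simp add: add.commute)
    have "cis (\<delta> * t) = -1"
      using t by (cases "t > 0") (auto simp: \<delta>_def complex_eq_iff)
    then have "fourier (\<lambda>v. fourier f (v + \<delta>) - fourier f v) (- t) = - 2 * f t"
      unfolding fourier_diff[OF Fd Ff] fourier_shift fourier_inversion[OF f Ff] by (simp add: cis_cnj[symmetric])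
    then have "2 * cmod (f t) = cmod (fourier (\<lambda>v. fourier f (v + \<delta>) - fourier f v) (- t))" by (simp add: norm_mult)
    also have "\<dots> \<le> 1 / sqrt (2 * pi) * (LINT v|lborel. cmod (fourier f (v + \<delta>) - fourier f v))"
      using Fd Ff by (intro norm_fourier_le Bochner_Integration.integrable_diff)
    also have "\<dots> \<le> 1 / sqrt (2 * pi) * (\<delta> * M)"
      by (intro mult_left_mono BV_translation_integral[OF Ff d M]) auto
    finally have "cmod (f t) \<le> 1 / sqrt (2 * pi) * (\<delta> * M)" using norm_ge_zero[of "f t"] by linarith
    then show ?thesis by (simp add: \<delta>_def)
  qed
  then show ?thesis by (rule that)
qed

text \<open>A Riemann sum of |f| exceeds the integral by at most h * M: each sample is compared with
  the values of f in its cell, and for a fixed offset w the differences form a variation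
  sum.\<close>

lemma BV_samples_summable:
  fixes f :: "real \<Rightarrow> complex"
  assumes f: "integrable lborel f" and BV: "f \<in> BV_space" and h: "h > 0"
  shows "summable (\<lambda>k. cmod (f (\<tau> + h * (real k + 1))) + cmod (f (\<tau> - h * (real k + 1))))"
proof -
  obtain M where M: "\<And>(x :: nat \<Rightarrow> real) n. mono x \<Longrightarrow> (\<Sum>i<n. cmod (f (x (Suc i)) - f (x i))) \<le> M"
    using BV unfolding BV_space_def by blast
  let ?G = "\<lambda>v. cmod (f (v + \<tau>))"
  have ft: "integrable lborel (\<lambda>v. f (v + \<tau>))"
    using lborel_integrable_real_affine[OF f, of 1 \<tau>] by (simp add: add.commute)
  have ftm: "integrable lborel (\<lambda>w. f (w + of_int m * h + \<tau>))" for m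
    using lborel_integrable_real_affine[OF f, of 1 "of_int m * h + \<tau>"] by (simp add: ac_simps)
  note [measurable] = borel_measurable_integrable[OF f]
  have bd: "h * (\<Sum>m\<in>{- int N..int N}. cmod (f (of_int m * h + \<tau>))) \<le> (LINT v|lborel. ?G v) + h * M" for N
  proof -
    have i0: "integrable lborel (\<lambda>w. indicator (cell h) w *\<^sub>R cmod (f (of_int m * h + \<tau>)))" for m
      using integrable_indicator_cell[of h] by simp
    have i1: "integrable lborel (\<lambda>w. indicator (cell h) w *\<^sub>R ?G (w + of_int m * h))" for m
      by (intro integrable_mult_indicator integrable_norm ftm) simp
    have i2: "integrable lborel (\<lambda>w. indicator (cell h) w *\<^sub>R cmod (f (w + of_int m * h + \<tau>) - f (of_int m * h + \<tau>)))" for m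
    proof (rule Bochner_Integration.integrable_bound[OF Bochner_Integration.integrable_add[OF i1[of m] i0[of m]]])
      show "AE w in lborel. norm (indicator (cell h) w *\<^sub>R cmod (f (w + of_int m * h + \<tau>) - f (of_int m * h + \<tau>)))
         \<le> norm (indicator (cell h) w *\<^sub>R ?G (w + of_int m * h) + indicator (cell h) w *\<^sub>R cmod (f (of_int m * h + \<tau>)))"
        by (intro AE_I2) (auto simp: indicator_def norm_triangle_ineq4)
    qed measurable
    have "h * (\<Sum>m\<in>{- int N..int N}. cmod (f (of_int m * h + \<tau>)))
       = (\<Sum>m\<in>{- int N..int N}. LINT w|lborel. indicator (cell h) w *\<^sub>R cmod (f (of_int m * h + \<tau>)))"
      using h by (simp add: sum_distrib_left)
    also have "\<dots> \<le> (\<Sum>m\<in>{- int N..int N}. (LINT w|lborel. indicator (cell h) w *\<^sub>R ?G (w + of_int m * h)) +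
        (LINT w|lborel. indicator (cell h) w *\<^sub>R cmod (f (w + of_int m * h + \<tau>) - f (of_int m * h + \<tau>))))"
    proof (intro sum_mono)
      fix m
      have "cmod (f (of_int m * h + \<tau>)) \<le> ?G (w + of_int m * h) + cmod (f (w + of_int m * h + \<tau>) - f (of_int m * h + \<tau>))" for w
        using norm_triangle_sub[of "f (of_int m * h + \<tau>)" "f (w + of_int m * h + \<tau>)"] by (simp add: norm_minus_commute)
      then show "(LINT w|lborel. indicator (cell h) w *\<^sub>R cmod (f (of_int m * h + \<tau>)))
        \<le> (LINT w|lborel. indicator (cell h) w *\<^sub>R ?G (w + of_int m * h)) +
        (LINT w|lborel. indicator (cell h) w *\<^sub>R cmod (f (w + of_int m * h + \<tau>) - f (of_int m * h + \<tau>)))"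
        unfolding Bochner_Integration.integral_add[OF i1 i2, symmetric]
        by (intro integral_mono i0 Bochner_Integration.integrable_add i1 i2) (simp add: indicator_def)
    qed
    also have "\<dots> = (\<Sum>m\<in>{- int N..int N}. LINT w|lborel. indicator (cell h) w *\<^sub>R ?G (w + of_int m * h))
      + (LINT w|lborel. (\<Sum>m\<in>{- int N..int N}. indicator (cell h) w *\<^sub>R cmod (f (w + of_int m * h + \<tau>) - f (of_int m * h + \<tau>))))"
      unfolding sum.distrib by (simp only: Bochner_Integration.integral_sum i2)
    also have "\<dots> \<le> (LINT v|lborel. ?G v) + (LINT w|lborel. M * indicator (cell h) w)"
    proof (rule add_mono)
      show "(\<Sum>m\<in>{- int N..int N}. LINT w|lborel. indicator (cell h) w *\<^sub>R ?G (w + of_int m * h)) \<le> (LINT v|lborel. ?G v)"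
        unfolding sum_LINT_cells[OF integrable_norm[OF ft] h]
        by (rule integral_mono') (use ft in \<open>auto simp: indicator_def\<close>)
      show "(LINT w|lborel. (\<Sum>m\<in>{- int N..int N}. indicator (cell h) w *\<^sub>R cmod (f (w + of_int m * h + \<tau>) - f (of_int m * h + \<tau>))))
         \<le> (LINT w|lborel. M * indicator (cell h) w)"
      proof (rule integral_mono)
        show "integrable lborel (\<lambda>w. \<Sum>m\<in>{- int N..int N}. indicator (cell h) w *\<^sub>R cmod (f (w + of_int m * h + \<tau>) - f (of_int m * h + \<tau>)))"
          by (intro Bochner_Integration.integrable_sum i2)
        show "integrable lborel (\<lambda>w. M * indicator (cell h) w)" using integrable_indicator_cell by (rule integrable_mult_right)
        fix w :: real
        have "(\<Sum>m\<in>{- int N..int N}. cmod (f (w + of_int m * h + \<tau>) - f (of_int m * h + \<tau>))) \<le> M" if w: "w \<in> cell h"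
        \<comment> \<open>The sign of w decides whether the node or the shifted point comes first in
          the interlacing.\<close>
        proof (cases "w \<ge> 0")
          case True
          show ?thesis by (rule BV_interlacing_sum[OF M]) (use True w h in \<open>auto simp: algebra_simps\<close>)
        next
          case False
          show ?thesis
            unfolding norm_minus_commute[of "f (w + _ + _)"]
            by (rule BV_interlacing_sum[OF M]) (use False w h in \<open>auto simp: algebra_simps\<close>)
        qed
        then show "(\<Sum>m\<in>{- int N..int N}. indicator (cell h) w *\<^sub>R cmod (f (w + of_int m * h + \<tau>) - f (of_int m * h + \<tau>))) \<le> M * indicator (cell h) w"
          by (cases "w \<in> cell h") auto
      qed
    qed
    also have "\<dots> = (LINT v|lborel. ?G v) + h * M" using h by simp
    finally show ?thesis .
  qed
  show ?thesis
  proof (rule summableI_nonneg_bounded)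
    fix N
    let ?g = "\<lambda>m::int. cmod (f (of_int m * h + \<tau>))"
    have "(\<Sum>k<N. cmod (f (\<tau> + h * (real k + 1))) + cmod (f (\<tau> - h * (real k + 1)))) = (\<Sum>k<N. ?g (int k + 1) + ?g (- (int k + 1)))"
      by (simp add: algebra_simps)
    also have "\<dots> \<le> (\<Sum>m\<in>{- int N..int N}. ?g m)" unfolding sum_symmetric by simp
    also have "\<dots> \<le> ((LINT v|lborel. ?G v) + h * M) / h" using bd[of N] h by (simp add: field_simps)
    finally show "(\<Sum>k<N. cmod (f (\<tau> + h * (real k + 1))) + cmod (f (\<tau> - h * (real k + 1)))) \<le> ((LINT v|lborel. ?G v) + h * M) / h" .
  qed auto
qed

section \<open>Poisson summation and the remainder\<close>

lemma fourier_power_decay: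
  fixes f :: "real \<Rightarrow> complex"
  assumes Fb: "(\<lambda>v. complex_of_real (\<bar>v\<bar> powr \<alpha>) * fourier f v) \<in> bcontfun"
  obtains C where "\<And>v. v \<noteq> 0 \<Longrightarrow> cmod (fourier f v) \<le> C * \<bar>v\<bar> powr (- \<alpha>)"
proof -
  obtain C where C: "\<And>v. cmod (complex_of_real (\<bar>v\<bar> powr \<alpha>) * fourier f v) \<le> C"
    using Fb unfolding bcontfun_def bounded_iff by auto
  have "cmod (fourier f v) \<le> C * \<bar>v\<bar> powr (- \<alpha>)" if "v \<noteq> 0" for v
    using C[of v] that by (simp add: norm_mult powr_minus field_simps)
  then show ?thesis by (rule that)
qed

context
  fixes \<alpha> \<sigma> C :: real and f :: "real \<Rightarrow> complex"
  assumes \<alpha>: "\<alpha> > 1" and \<sigma>: "\<sigma> > 0" and A: "f \<in> class_A"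
    and decay: "\<And>v. v \<noteq> 0 \<Longrightarrow> cmod (fourier f v) \<le> C * \<bar>v\<bar> powr (- \<alpha>)"
begin

text \<open>Decay with \<alpha> > 1, together with boundedness near 0, makes the transform
  integrable; from here on inversion is available.\<close>

lemma class_A_integrable: "integrable lborel f" "f \<in> bcontfun" "integrable lborel (fourier f)"
proof -
  show f: "integrable lborel f" "f \<in> bcontfun" using A by (auto simp: class_A_def L1_space_def)
  show "integrable lborel (fourier f)"
    by (rule integrable_power_decay[OF borel_measurable_fourier[OF f(1)] norm_fourier_le[OF f(1)] \<alpha> decay])
qed

lemma samples_tendsto:
  "(\<lambda>n. \<Sum>k\<in>{- int n..int n}. f (\<tau> + 2 * pi / \<sigma> * of_int k)) \<longlonglongrightarrow>
    complex_of_real (\<sigma> / sqrt (2 * pi)) * (fourier f 0 +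
      (\<Sum>k. fourier f ((real k + 1) * \<sigma>) * cis (\<tau> * ((real k + 1) * \<sigma>)) + fourier f (- ((real k + 1) * \<sigma>)) * cis (- (\<tau> * ((real k + 1) * \<sigma>)))))"
    (is "?s \<longlonglongrightarrow> _")
proof (rule tauberian_slow_oscillation[OF Cesaro_samples_tendsto[OF \<alpha> \<sigma> class_A_integrable decay]])
  fix e :: real assume e: "e > 0"
  define h where "h = 2 * pi / \<sigma>"
  have h: "h > 0" using \<sigma> by (simp add: h_def)
  define t where "t k = f (\<tau> + h * (real k + 1)) + f (\<tau> - h * (real k + 1))" for k
  have s: "?s n = f \<tau> + (\<Sum>k<n. t k)" for n
    unfolding sum_symmetric t_def h_def[symmetric] by (simp add: algebra_simps)
  consider "f \<in> BV_space" | "fourier f \<in> BV_space" using A by (auto simp: class_A_def)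
  then show "\<exists>p>0. \<exists>n0. \<forall>n\<ge>n0. \<forall>j\<ge>n. real j < real n + p * real n \<longrightarrow> cmod (?s j - ?s n) \<le> e"
  proof cases
    case 1
    have "summable t"
      by (rule summable_comparison_test'[OF BV_samples_summable[OF class_A_integrable(1) 1 h], of 0 _ \<tau>])
        (simp add: t_def norm_triangle_ineq)
    then have "Cauchy (\<lambda>n. \<Sum>k<n. t k)" by (rule LIMSEQ_imp_Cauchy[OF summable_LIMSEQ])
    from CauchyD[OF this e] obtain n0 where "\<forall>m\<ge>n0. \<forall>n\<ge>n0. norm ((\<Sum>k<m. t k) - (\<Sum>k<n. t k)) < e" by blast
    \<comment> \<open>For a Cauchy sequence any positive p works; 1 is taken.\<close>
    then have "\<forall>n\<ge>n0. \<forall>j\<ge>n. real j < real n + 1 * real n \<longrightarrow> cmod (?s j - ?s n) \<le> e"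
      unfolding s by (auto intro!: less_imp_le)
    then show ?thesis using zero_less_one by blast
  next
    case 2
    obtain K where K: "\<And>t. t \<noteq> 0 \<Longrightarrow> cmod (f t) \<le> K / \<bar>t\<bar>"
      using BV_transform_decay[OF class_A_integrable 2] by blast
    have K0: "0 \<le> K" using order_trans[OF norm_ge_zero K[of 1]] by simp
    \<comment> \<open>A block of p * n terms, each at most 4K / (h * n), then sums to e * 4K / (4K +
      1); the added 1 keeps the denominator positive when K = 0.\<close>
    define p where "p = e * h / (4 * K + 1)"
    have p: "p > 0" using e h K0 by (simp add: p_def)
    \<comment> \<open>Ensures |\<tau>| < h * n / 2, so that both points of a pair stay at distance
      at least h * n / 2 from 0.\<close>
    obtain n0 where n0: "2 * \<bar>\<tau>\<bar> / h < real n0" using reals_Archimedean2 by blast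
    have "cmod (?s j - ?s n) \<le> e" if n: "n \<ge> n0" and j: "j \<ge> n" "real j < real n + p * real n" for n j
    proof -
      have "0 \<le> 2 * \<bar>\<tau>\<bar> / h" using h by simp
      then have n_pos: "real n > 0" using n0 n by linarith
      have "2 * \<bar>\<tau>\<bar> / h < real n" using n0 n by linarith
      then have \<tau>: "2 * \<bar>\<tau>\<bar> < h * real n" using h by (simp add: field_simps)
      have tk: "cmod (t k) \<le> 4 * K / (h * real n)" if k: "k \<ge> n" for k
      proof -
        have "h * real n \<le> h * (real k + 1)" using k h by (intro mult_left_mono) auto
        then have ge: "h * real n / 2 \<le> \<bar>\<tau> + h * (real k + 1)\<bar>" "h * real n / 2 \<le> \<bar>\<tau> - h * (real k + 1)\<bar>"
          using \<tau> by linarith+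
        have pos: "h * real n / 2 > 0" using h n_pos by simp
        have "cmod (f x) \<le> K / (h * real n / 2)" if "h * real n / 2 \<le> \<bar>x\<bar>" for x
        proof -
          have "cmod (f x) \<le> K / \<bar>x\<bar>" using that pos by (intro K) auto
          also have "\<dots> \<le> K / (h * real n / 2)" using that pos K0 by (intro divide_left_mono) auto
          finally show ?thesis .
        qed
        from norm_triangle_mono[OF this[OF ge(1)] this[OF ge(2)]] show ?thesis by (simp add: t_def)
      qed
      have "?s j - ?s n = (\<Sum>k=n..<j. t k)"
        unfolding s using j(1) by (simp add: lessThan_atLeast0 sum_diff_nat_ivl)
      also have "cmod \<dots> \<le> (\<Sum>k=n..<j. 4 * K / (h * real n))"
        by (rule order_trans[OF norm_sum sum_mono]) (use tk in auto)
      also have "\<dots> = (real j - real n) * (4 * K / (h * real n))" using j(1) by (simp add: of_nat_diff)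
      also have "\<dots> \<le> (p * real n) * (4 * K / (h * real n))"
        using j(2) K0 h n_pos by (intro mult_right_mono) auto
      also have "\<dots> = e * (4 * K / (4 * K + 1))" using n_pos h by (simp add: p_def)
      also have "\<dots> \<le> e * 1" using e K0 by (intro mult_left_mono) (auto simp: divide_le_eq)
      finally show ?thesis by simp
    qed
    then show ?thesis using p by blast
  qed
qed

text \<open>\<open>samples_tendsto\<close> evaluates the \<open>lim\<close> in
  \<open>quad_remainder\<close>. Its term at frequency 0 cancels the integral, because the step h
  times \<sigma> / sqrt (2 pi) is sqrt (2 pi).\<close>

theorem quad_remainder_Poisson:
  "quad_remainder \<sigma> (\<lambda>t. f (\<tau> + t)) = - complex_of_real (sqrt (2 * pi)) *
    (\<Sum>k. fourier f ((real k + 1) * \<sigma>) * cis (\<tau> * ((real k + 1) * \<sigma>)) + fourier f (- ((real k + 1) * \<sigma>)) * cis (- (\<tau> * ((real k + 1) * \<sigma>))))"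
proof -
  have "(LINT t|lborel. f (\<tau> + t)) = (LINT t|lborel. f t)"
    using lborel_integral_real_affine[of 1 f \<tau>] by simp
  also have "\<dots> = complex_of_real (sqrt (2 * pi)) * fourier f 0" by (simp add: fourier_cis)
  finally have 1: "(LINT t|lborel. f (\<tau> + t)) = complex_of_real (sqrt (2 * pi)) * fourier f 0" .
  have "2 * pi / \<sigma> * (\<sigma> / sqrt (2 * pi)) = sqrt (2 * pi)"
    using \<sigma> by (simp add: real_div_sqrt)
  then have 2: "complex_of_real (2 * pi / \<sigma>) * (complex_of_real (\<sigma> / sqrt (2 * pi)) * z) = complex_of_real (sqrt (2 * pi)) * z" for z
    by (simp only: mult.assoc[symmetric] of_real_mult[symmetric])
  show ?thesis
    unfolding quad_remainder_def Let_def limI[OF samples_tendsto] 1 2 by (simp only: distrib_left minus_mult_left[symmetric]) simp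
qed

text \<open>All frequencies of the series have modulus at least \<sigma>, so D applies to each, and
  the power of (k + 1) * \<sigma> splits into a power of \<sigma> and the terms of a convergent
  series.\<close>

lemma remainder_upper_bound:
  assumes D: "\<And>v. \<sigma> \<le> \<bar>v\<bar> \<Longrightarrow> \<bar>v\<bar> powr \<alpha> * cmod (fourier f v) \<le> D"
  shows "cmod (quad_remainder \<sigma> (\<lambda>t. f (\<tau> + t))) \<le> sqrt (2 * pi) * (2 * (\<Sum>k. (real k + 1) powr (- \<alpha>))) * \<sigma> powr (- \<alpha>) * D"
proof -
  let ?a = "\<lambda>k. fourier f ((real k + 1) * \<sigma>) * cis (\<tau> * ((real k + 1) * \<sigma>)) + fourier f (- ((real k + 1) * \<sigma>)) * cis (- (\<tau> * ((real k + 1) * \<sigma>)))"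
  have sm: "summable (\<lambda>k. (real k + 1) powr (- \<alpha>))"
    using summable_real_powr_iff[of "- \<alpha>"] \<alpha> summable_Suc_iff[of "\<lambda>k. real k powr (- \<alpha>)"] by (simp add: add.commute)
  have a: "norm (?a k) \<le> (real k + 1) powr (- \<alpha>) * (2 * \<sigma> powr (- \<alpha>) * D)" for k
  proof -
    have F: "cmod (fourier f v) \<le> (real k + 1) powr (- \<alpha>) * \<sigma> powr (- \<alpha>) * D" if v: "\<bar>v\<bar> = (real k + 1) * \<sigma>" for v
    proof -
      have "1 * \<sigma> \<le> \<bar>v\<bar>" unfolding v using \<sigma> by (intro mult_right_mono) auto
      then have "\<bar>v\<bar> > 0" "\<bar>v\<bar> powr \<alpha> * cmod (fourier f v) \<le> D" using \<sigma> D by auto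
      then have "cmod (fourier f v) \<le> \<bar>v\<bar> powr (- \<alpha>) * D" by (simp add: powr_minus field_simps)
      then show ?thesis unfolding v by (simp add: powr_mult)
    qed
    have "norm (?a k) \<le> (real k + 1) powr (- \<alpha>) * \<sigma> powr (- \<alpha>) * D + (real k + 1) powr (- \<alpha>) * \<sigma> powr (- \<alpha>) * D"
      unfolding norm_mult norm_cis mult_1_right
      by (intro norm_triangle_mono) (use \<sigma> F in \<open>simp_all add: norm_mult abs_mult\<close>)
    then show ?thesis by (simp add: mult_ac)
  qed
  have "norm (\<Sum>k. ?a k) \<le> (\<Sum>k. (real k + 1) powr (- \<alpha>) * (2 * \<sigma> powr (- \<alpha>) * D))"
    by (rule norm_suminf_le[OF a summable_mult2[OF sm]])
  also have "\<dots> = (\<Sum>k. (real k + 1) powr (- \<alpha>)) * (2 * \<sigma> powr (- \<alpha>) * D)"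
    by (rule suminf_mult2[OF sm, symmetric])
  finally have "sqrt (2 * pi) * norm (\<Sum>k. ?a k) \<le> sqrt (2 * pi) * ((\<Sum>k. (real k + 1) powr (- \<alpha>)) * (2 * \<sigma> powr (- \<alpha>) * D))"
    by (rule mult_left_mono) simp
  then show ?thesis unfolding quad_remainder_Poisson norm_mult norm_minus_cancel norm_of_real by (simp add: mult_ac)
qed

text \<open>\<open>fourier f (\<plusminus>\<sigma>)\<close> are Fourier coefficients of the remainder as a function of \<open>\<tau>\<close>.\<close>

lemma remainder_coefficient_bound:
  assumes T: "\<And>\<tau>. \<tau> \<in> {- pi / \<sigma>..pi / \<sigma>} \<Longrightarrow> cmod (quad_remainder \<sigma> (\<lambda>t. f (\<tau> + t))) \<le> T"
    and s: "s = 1 \<or> s = (-1::int)"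
  shows "sqrt (2 * pi) * cmod (fourier f (of_int s * \<sigma>)) \<le> T"
proof -
  \<comment> \<open>The period in \<tau>. Its cell lies within the range covered by T, and 2 pi / H
    = \<sigma> turns \<open>LINT_cell_cis\<close> into orthogonality of the exponentials in
    \<tau>.\<close>
  define H where "H = 2 * pi / \<sigma>"
  have H: "H > 0" "2 * pi / H = \<sigma>" "H / 2 = pi / \<sigma>" using \<sigma> by (auto simp: H_def)
  let ?F = "\<lambda>k::int. fourier f (of_int k * \<sigma>)"
  define a where "a k \<tau> = ?F (int k + 1) * cis (of_int (int k + 1) * \<sigma> * \<tau>) + ?F (- (int k + 1)) * cis (of_int (- (int k + 1)) * \<sigma> * \<tau>)" for k \<tau>
  have R: "quad_remainder \<sigma> (\<lambda>t. f (\<tau> + t)) = - complex_of_real (sqrt (2 * pi)) * (\<Sum>k. a k \<tau>)" for \<tau>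
    unfolding quad_remainder_Poisson a_def by (simp add: mult_ac add.commute minus_mult_left[symmetric] del: minus_add_distrib)
  \<comment> \<open>Multiplication by the conjugate exponential of frequency s * \<sigma> isolates
    that coefficient.\<close>
  define g where "g k \<tau> = indicator (cell H) \<tau> *\<^sub>R (a k \<tau> * cis (of_int (- s) * \<sigma> * \<tau>))" for k \<tau>
  have C0: "0 \<le> C" using order_trans[OF norm_ge_zero decay[of 1]] by simp
  define b where "b k = 2 * C * \<sigma> powr (- \<alpha>) * (real k + 1) powr (- \<alpha>)" for k
  have sm: "summable b"
    unfolding b_def using summable_real_powr_iff[of "- \<alpha>"] \<alpha> summable_Suc_iff[of "\<lambda>k. real k powr (- \<alpha>)"]
    by (intro summable_mult) (simp add: add.commute)
  have F: "cmod (?F m) \<le> C * \<sigma> powr (- \<alpha>) * (real k + 1) powr (- \<alpha>)" if "\<bar>m\<bar> = int k + 1" for m k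
  proof -
    have "\<bar>real_of_int m\<bar> = real k + 1" using that by (metis of_int_abs of_int_add of_int_of_nat_eq of_int_1)
    then have v: "\<bar>of_int m * \<sigma>\<bar> = (real k + 1) * \<sigma>" using \<sigma> by (simp add: abs_mult)
    have "(real k + 1) * \<sigma> > 0" using \<sigma> by (simp add: add_nonneg_pos)
    then have "of_int m * \<sigma> \<noteq> 0" using v by auto
    from decay[OF this] show ?thesis unfolding v by (simp add: powr_mult mult_ac)
  qed
  have ab: "cmod (a k \<tau> * cis (of_int (- s) * \<sigma> * \<tau>)) \<le> b k" for k \<tau>
  proof -
    have "cmod (a k \<tau>) \<le> C * \<sigma> powr (- \<alpha>) * (real k + 1) powr (- \<alpha>) + C * \<sigma> powr (- \<alpha>) * (real k + 1) powr (- \<alpha>)"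
      unfolding a_def by (rule norm_triangle_mono) (use F[of "int k + 1" k] F[of "- (int k + 1)" k] in \<open>simp_all add: norm_mult\<close>)
    then show ?thesis by (simp add: norm_mult b_def)
  qed
  have am [measurable]: "(\<lambda>\<tau>. a k \<tau> * cis (of_int (- s) * \<sigma> * \<tau>)) \<in> borel_measurable borel" for k
    unfolding a_def by measurable
  have gi: "integrable lborel (g k)" for k
    unfolding g_def by (rule integrable_cell_bounded[OF am ab])
  have gb: "cmod (g k \<tau>) \<le> b k * indicator (cell H) \<tau>" for k \<tau>
    using ab by (cases "\<tau> \<in> cell H") (auto simp: g_def simp del: atLeastLessThan_iff)
  \<comment> \<open>Absolute summability of the coefficients, from \<alpha> > 1, allows integration
    of the series term by term.\<close>
  have "(LINT \<tau>|lborel. (\<Sum>k. g k \<tau>)) = (\<Sum>k. LINT \<tau>|lborel. g k \<tau>)"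
  proof (rule integral_suminf[OF gi])
    show "AE \<tau> in lborel. summable (\<lambda>k. norm (g k \<tau>))"
      by (intro AE_I2 summable_comparison_test'[OF summable_mult2[OF sm], of 0]) (use gb in simp)
    have "(LINT \<tau>|lborel. norm (g k \<tau>)) \<le> (LINT \<tau>|lborel. b k * indicator (cell H) \<tau>)" for k
      by (intro integral_mono gb integrable_norm gi integrable_mult_right integrable_indicator_cell)
    then have "(LINT \<tau>|lborel. norm (g k \<tau>)) \<le> b k * H" for k using H(1) by simp
    then show "summable (\<lambda>k. LINT \<tau>|lborel. norm (g k \<tau>))"
      by (intro summable_comparison_test'[OF summable_mult2[OF sm, of H], of 0]) (simp add: integral_nonneg_AE)
  qed
  \<comment> \<open>For s = 1 or s = -1 the matching frequency sits in the pair k = 0, as its first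
    or second exponential.\<close>
  also have "(\<lambda>k. LINT \<tau>|lborel. g k \<tau>) = (\<lambda>k. if k = 0 then complex_of_real H * ?F s else 0)"
  proof
    fix k
    have c: "(LINT \<tau>|lborel. indicator (cell H) \<tau> *\<^sub>R cis (of_int m * \<sigma> * \<tau>)) = (if m = 0 then complex_of_real H else 0)" for m
      using LINT_cell_cis[OF H(1), of m] unfolding H(2) .
    have ci: "integrable lborel (\<lambda>\<tau>. indicator (cell H) \<tau> *\<^sub>R cis (of_int m * \<sigma> * \<tau>))" for m
      by (rule integrable_cell_bounded[where B=1]) auto
    have "g k = (\<lambda>\<tau>. ?F (int k + 1) * (indicator (cell H) \<tau> *\<^sub>R cis (of_int (int k + 1 - s) * \<sigma> * \<tau>))
        + ?F (- (int k + 1)) * (indicator (cell H) \<tau> *\<^sub>R cis (of_int (- (int k + 1) - s) * \<sigma> * \<tau>)))"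
    proof
      fix \<tau>
      have "cis (of_int m * \<sigma> * \<tau>) * cis (of_int (- s) * \<sigma> * \<tau>) = cis (of_int (m - s) * \<sigma> * \<tau>)" for m
        by (simp add: cis_mult algebra_simps)
      then show "g k \<tau> = ?F (int k + 1) * (indicator (cell H) \<tau> *\<^sub>R cis (of_int (int k + 1 - s) * \<sigma> * \<tau>))
        + ?F (- (int k + 1)) * (indicator (cell H) \<tau> *\<^sub>R cis (of_int (- (int k + 1) - s) * \<sigma> * \<tau>))"
        unfolding g_def a_def distrib_right mult.assoc scaleR_right_distrib by (simp only: mult_scaleR_right mult.assoc)
    qed
    then have "(LINT \<tau>|lborel. g k \<tau>) = ?F (int k + 1) * (if int k + 1 - s = 0 then complex_of_real H else 0)
        + ?F (- (int k + 1)) * (if - (int k + 1) - s = 0 then complex_of_real H else 0)"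
      using ci by (simp only: Bochner_Integration.integral_add integrable_mult_right integral_mult_right_zero c)
    then show "(LINT \<tau>|lborel. g k \<tau>) = (if k = 0 then complex_of_real H * ?F s else 0)"
      using s by (cases "k = 0") (auto simp: mult.commute)
  qed
  also have "(\<Sum>k. if k = 0 then complex_of_real H * ?F s else 0) = complex_of_real H * ?F s"
    using suminf_finite[of "{0::nat}" "\<lambda>k. if k = 0 then complex_of_real H * ?F s else 0"] by simp
  finally have eq: "complex_of_real H * ?F s = (LINT \<tau>|lborel. (\<Sum>k. g k \<tau>))" ..
  have "cmod (complex_of_real H * ?F s) \<le> (LINT \<tau>|lborel. cmod (\<Sum>k. g k \<tau>))"
    unfolding eq by (rule integral_norm_bound)
  also have "\<dots> \<le> (LINT \<tau>|lborel. (T / sqrt (2 * pi)) * indicator (cell H) \<tau>)"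
  proof (rule integral_mono')
    show "integrable lborel (\<lambda>\<tau>. (T / sqrt (2 * pi)) * indicator (cell H) \<tau>)"
      using integrable_indicator_cell by (rule integrable_mult_right)
    fix \<tau>
    show *: "cmod (\<Sum>k. g k \<tau>) \<le> (T / sqrt (2 * pi)) * indicator (cell H) \<tau>"
    proof (cases "\<tau> \<in> cell H")
      case True
      have "summable (\<lambda>k. a k \<tau>)"
        by (rule summable_comparison_test'[OF sm, of 0]) (use ab in \<open>simp add: norm_mult\<close>)
      then have "(\<Sum>k. g k \<tau>) = (\<Sum>k. a k \<tau>) * cis (of_int (- s) * \<sigma> * \<tau>)"
        using True by (simp add: g_def suminf_mult2 del: atLeastLessThan_iff)
      then have "sqrt (2 * pi) * cmod (\<Sum>k. g k \<tau>) = cmod (quad_remainder \<sigma> (\<lambda>t. f (\<tau> + t)))"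
        unfolding R by (simp add: norm_mult)
      also have "\<dots> \<le> T" using True H(3) by (intro T) auto
      finally show ?thesis using True by (simp add: field_simps del: atLeastLessThan_iff)
    next
      case False
      then show ?thesis by (simp add: g_def del: atLeastLessThan_iff)
    qed
    show "0 \<le> (T / sqrt (2 * pi)) * indicator (cell H) \<tau>" by (rule order_trans[OF norm_ge_zero *])
  qed
  also have "\<dots> = T / sqrt (2 * pi) * H" using H(1) by simp
  finally have "H * cmod (?F s) \<le> H * (T / sqrt (2 * pi))" using H(1) by (simp add: norm_mult mult.commute)
  then have "cmod (?F s) \<le> T / sqrt (2 * pi)" using H(1) by (rule mult_left_le_imp_le)
  then show ?thesis by (simp add: field_simps)
qed

end

section \<open>Equivalence of the two orders of decay\<close>

theorem theorem8p1:
  fixes \<alpha> t0 :: real and f :: "real \<Rightarrow> complex" and lam :: "real \<Rightarrow> real"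
  assumes "\<alpha> > 1"
    and "f \<in> class_A"
    and "(\<lambda>v. complex_of_real (\<bar>v\<bar> powr \<alpha>) * fourier f v) \<in> L2_space \<inter> bcontfun"
    and "t0 > 0"
    and "\<And>t. t \<ge> t0 \<Longrightarrow> lam t \<ge> 0"
    and "antimono_on {t0..} lam"
  shows "(\<lambda>\<sigma>. dist_inf (strong_riesz_deriv \<alpha> f) \<sigma>) \<in> O[at_top](lam)
    \<longleftrightarrow> (\<exists>c>0. \<exists>\<sigma>0\<ge>t0. \<forall>\<sigma>\<ge>\<sigma>0. \<forall>\<tau>\<in>{- pi / \<sigma>..pi / \<sigma>}.
          cmod (quad_remainder \<sigma> (\<lambda>t. f (\<tau> + t))) \<le> c * \<sigma> powr (-\<alpha>) * lam \<sigma>)"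
proof -
  define F where "F = (\<lambda>v. complex_of_real (\<bar>v\<bar> powr \<alpha>) * fourier f v)"
  have F: "F \<in> L2_space" "F \<in> bcontfun" using assms(3) by (auto simp: F_def)
  have nF: "cmod (F v) = \<bar>v\<bar> powr \<alpha> * cmod (fourier f v)" for v by (simp add: F_def norm_mult)
  obtain C where C: "\<And>v. v \<noteq> 0 \<Longrightarrow> cmod (fourier f v) \<le> C * \<bar>v\<bar> powr (- \<alpha>)"
    using fourier_power_decay[of \<alpha> f] F(2) unfolding F_def by blast
  \<comment> \<open>The context of this fact fixes a positive \<sigma>, instantiated here with
    1.\<close>
  note A = class_A_integrable[OF assms(1) zero_less_one assms(2) C]
  have FC: "fourier_Cb (strong_riesz_deriv \<alpha> f) = F"
    using assms(1) by (intro fourier_Cb_strong_riesz_deriv[OF _ A F_def F]) auto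
  let ?D = "dist_inf (strong_riesz_deriv \<alpha> f)"
  show ?thesis
  proof
    assume "?D \<in> O[at_top](lam)"
    then obtain c where c: "c > 0" "eventually (\<lambda>\<sigma>. norm (?D \<sigma>) \<le> c * norm (lam \<sigma>)) at_top"
      by (elim landau_o.bigE)
    then obtain N where N: "\<And>\<sigma>. \<sigma> \<ge> N \<Longrightarrow> norm (?D \<sigma>) \<le> c * norm (lam \<sigma>)"
      unfolding eventually_at_top_linorder by blast
    let ?Z = "sqrt (2 * pi) * (2 * (\<Sum>k. (real k + 1) powr (- \<alpha>)))"
    have "0 \<le> (\<Sum>k. (real k + 1) powr (- \<alpha>))"
    proof (rule suminf_nonneg)
      show "summable (\<lambda>k. (real k + 1) powr (- \<alpha>))"
        using summable_real_powr_iff[of "- \<alpha>"] assms(1) summable_Suc_iff[of "\<lambda>k. real k powr (- \<alpha>)"]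
        by (simp add: add.commute)
    qed simp
    then have Z: "0 \<le> ?Z" by simp
    have "cmod (quad_remainder \<sigma> (\<lambda>t. f (\<tau> + t))) \<le> ((?Z + 1) * c) * \<sigma> powr (- \<alpha>) * lam \<sigma>"
      if \<sigma>: "\<sigma> \<ge> max t0 N" for \<sigma> \<tau>
    proof -
      have s0: "\<sigma> > 0" using \<sigma> assms(4) by simp
      have l0: "lam \<sigma> \<ge> 0" using \<sigma> assms(5) by simp
      have D: "?D \<sigma> \<le> c * lam \<sigma>" using N[of \<sigma>] \<sigma> l0 by simp
      have "cmod (quad_remainder \<sigma> (\<lambda>t. f (\<tau> + t))) \<le> ?Z * \<sigma> powr (- \<alpha>) * (c * lam \<sigma>)"
      proof (rule remainder_upper_bound[OF assms(1) s0 assms(2) C])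
        fix v assume "\<sigma> \<le> \<bar>v\<bar>"
        from dist_inf_lower[OF s0 FC F(2) this] show "\<bar>v\<bar> powr \<alpha> * cmod (fourier f v) \<le> c * lam \<sigma>"
          using D unfolding nF by linarith
      qed
      \<comment> \<open>Only nonnegativity of \<open>?Z\<close> is at hand, and (ii) asks for a
        positive constant; adding 1 provides it.\<close>
      also have "\<dots> \<le> (?Z + 1) * \<sigma> powr (- \<alpha>) * (c * lam \<sigma>)"
        using c(1) l0 by (intro mult_right_mono) auto
      finally show ?thesis by (simp add: mult_ac)
    qed
    moreover have "(?Z + 1) * c > 0" using Z c(1) by (intro mult_pos_pos) auto
    ultimately show "\<exists>c>0. \<exists>\<sigma>0\<ge>t0. \<forall>\<sigma>\<ge>\<sigma>0. \<forall>\<tau>\<in>{- pi / \<sigma>..pi / \<sigma>}.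
          cmod (quad_remainder \<sigma> (\<lambda>t. f (\<tau> + t))) \<le> c * \<sigma> powr (-\<alpha>) * lam \<sigma>"
      by (intro exI[of _ "(?Z + 1) * c"] conjI exI[of _ "max t0 N"]) auto
  next
    assume "\<exists>c>0. \<exists>\<sigma>0\<ge>t0. \<forall>\<sigma>\<ge>\<sigma>0. \<forall>\<tau>\<in>{- pi / \<sigma>..pi / \<sigma>}.
          cmod (quad_remainder \<sigma> (\<lambda>t. f (\<tau> + t))) \<le> c * \<sigma> powr (-\<alpha>) * lam \<sigma>"
    then obtain c \<sigma>0 where c: "c > 0" "\<sigma>0 \<ge> t0"
      and R: "\<And>\<sigma> \<tau>. \<sigma> \<ge> \<sigma>0 \<Longrightarrow> \<tau> \<in> {- pi / \<sigma>..pi / \<sigma>} \<Longrightarrow> cmod (quad_remainder \<sigma> (\<lambda>t. f (\<tau> + t))) \<le> c * \<sigma> powr (-\<alpha>) * lam \<sigma>"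
      by blast
    \<comment> \<open>The hypothesis is applied with |v| in the role of \<sigma>, which makes v
      itself one of the two lowest frequencies of that remainder.\<close>
    have Fle: "cmod (F v) \<le> c * lam \<bar>v\<bar>" if v: "\<sigma>0 \<le> \<bar>v\<bar>" for v
    proof -
      have v0: "\<bar>v\<bar> > 0" using v c(2) assms(4) by linarith
      define s :: int where "s = (if v > 0 then 1 else -1)"
      have s: "s = 1 \<or> s = -1" "of_int s * \<bar>v\<bar> = v" using v0 by (auto simp: s_def)
      have "1 * cmod (fourier f v) \<le> sqrt (2 * pi) * cmod (fourier f (of_int s * \<bar>v\<bar>))"
        unfolding s(2) using pi_gt3 by (intro mult_right_mono real_le_rsqrt) auto
      also have "\<dots> \<le> c * \<bar>v\<bar> powr (- \<alpha>) * lam \<bar>v\<bar>"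
        by (rule remainder_coefficient_bound[OF assms(1) v0 assms(2) C _ s(1)]) (use R v in auto)
      finally have "\<bar>v\<bar> powr \<alpha> * cmod (fourier f v) \<le> \<bar>v\<bar> powr \<alpha> * (c * \<bar>v\<bar> powr (- \<alpha>) * lam \<bar>v\<bar>)"
        by (intro mult_left_mono) auto
      also have "\<dots> = c * lam \<bar>v\<bar>" using v0 by (simp add: powr_minus field_simps)
      finally show ?thesis unfolding nF .
    qed
    have "norm (?D \<sigma>) \<le> c * norm (lam \<sigma>)" if \<sigma>: "\<sigma> \<ge> \<sigma>0" for \<sigma>
    proof -
      have s0: "\<sigma> > 0" and l0: "lam \<sigma> \<ge> 0" using \<sigma> c(2) assms(4,5) by auto
      have "?D \<sigma> \<le> c * lam \<sigma>"
      proof (rule dist_inf_upper[OF s0 FC F(2)])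
        fix v assume v: "\<sigma> \<le> \<bar>v\<bar>"
        have "lam \<bar>v\<bar> \<le> lam \<sigma>" using v \<sigma> c(2) by (intro monotone_onD[OF assms(6)]) auto
        then have "c * lam \<bar>v\<bar> \<le> c * lam \<sigma>" using c(1) by (intro mult_left_mono) auto
        then show "cmod (F v) \<le> c * lam \<sigma>" using Fle[of v] v \<sigma> by linarith
      qed
      \<comment> \<open>The Landau bound concerns the absolute value, so the upper bound alone would
        not suffice.\<close>
      moreover have "0 \<le> ?D \<sigma>" using order_trans[OF norm_ge_zero dist_inf_lower[OF s0 FC F(2), of \<sigma>]] by simp
      ultimately show ?thesis using l0 by simp
    qed
    then show "?D \<in> O[at_top](lam)"
      by (intro landau_o.bigI[OF c(1)]) (auto simp: eventually_at_top_linorder)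
  qed
qed

end
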